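(* Let $I$ be a compact interval and let $f : I\to I$ be $C^2$ and nonsingular. Then every metric attractor of $f$ that does not contain critical points coincides with a topologically attracting periodic orbit.
   Context: An interval map $f$ is nonsingular if $f^{-1}(A)$ has zero Lebesgue measure for every Borel set $A$ with zero Lebesgue measure. A critical point of $f$ is a point where $f'$ vanishes. For a forward invariant compact set $A$, the basin of attraction is $B(A):=\{x:\omega(x)\subset A\}$. A forward invariant compact set $A$ is a (minimal) metric attractor if $B(A)$ has positive Lebesgue measure and $B(A')$ has Lebesgue measure zero for every forward invariant compact set $A'$ strictly contained in $A$. A periodic point $x$ of period $p$ (and its orbit) is topologically attracting if $B(\{x,f(x),\ldots,f^{p-1}(x)\})$ has nonempty interior. *)

theory Defs
  imports "HOL-Analysis.Analysis"
begin

text \<open>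
  A map of a set \<open>I\<close> into itself is given by a total function \<open>f :: real \<Rightarrow> real\<close> with
  \<open>f \<in> I \<rightarrow> I\<close>; all notions below depend only on the values of \<open>f\<close> on \<open>I\<close>. Derivatives are
  taken within \<open>I\<close>, hence are one-sided at the endpoints of a compact interval.
\<close>

definition C2_on :: "real set \<Rightarrow> (real \<Rightarrow> real) \<Rightarrow> bool" where
  "C2_on I f \<longleftrightarrow> (\<exists>f' f''.
     (\<forall>x\<in>I. (f has_real_derivative f' x) (at x within I)) \<and>
     (\<forall>x\<in>I. (f' has_real_derivative f'' x) (at x within I)) \<and>
     continuous_on I f'')"

definition critical_point :: "real set \<Rightarrow> (real \<Rightarrow> real) \<Rightarrow> real \<Rightarrow> bool" where
  "critical_point I f c \<longleftrightarrow> c \<in> I \<and> (f has_real_derivative 0) (at c within I)"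

text \<open>\<open>null_sets lborel\<close> consists of the Borel sets of Lebesgue measure zero.\<close>

definition nonsingular :: "real set \<Rightarrow> (real \<Rightarrow> real) \<Rightarrow> bool" where
  "nonsingular I f \<longleftrightarrow>
     (\<forall>A\<in>null_sets lborel. A \<subseteq> I \<longrightarrow> f -` A \<inter> I \<in> null_sets lebesgue)"

definition omega_limit :: "(real \<Rightarrow> real) \<Rightarrow> real \<Rightarrow> real set" where
  "omega_limit f x =
     {y. \<exists>r. strict_mono (r :: nat \<Rightarrow> nat) \<and> (\<lambda>n. (f ^^ r n) x) \<longlonglongrightarrow> y}"

definition basin :: "real set \<Rightarrow> (real \<Rightarrow> real) \<Rightarrow> real set \<Rightarrow> real set" where
  "basin I f A = {x \<in> I. omega_limit f x \<subseteq> A}"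

definition forward_invariant_compact :: "real set \<Rightarrow> (real \<Rightarrow> real) \<Rightarrow> real set \<Rightarrow> bool" where
  "forward_invariant_compact I f A \<longleftrightarrow> A \<subseteq> I \<and> compact A \<and> f ` A \<subseteq> A"

definition metric_attractor :: "real set \<Rightarrow> (real \<Rightarrow> real) \<Rightarrow> real set \<Rightarrow> bool" where
  "metric_attractor I f A \<longleftrightarrow>
     forward_invariant_compact I f A \<and>
     emeasure lebesgue (basin I f A) > 0 \<and>
     (\<forall>A'. forward_invariant_compact I f A' \<and> A' \<subset> A \<longrightarrow>
        basin I f A' \<in> null_sets lebesgue)"

text \<open>The period \<open>p\<close> need not be the least one; the orbit does not depend on this choice.\<close>

definition periodic_point :: "real set \<Rightarrow> (real \<Rightarrow> real) \<Rightarrow> nat \<Rightarrow> real \<Rightarrow> bool" where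
  "periodic_point I f p x \<longleftrightarrow> x \<in> I \<and> p > 0 \<and> (f ^^ p) x = x"

definition periodic_orbit :: "(real \<Rightarrow> real) \<Rightarrow> nat \<Rightarrow> real \<Rightarrow> real set" where
  "periodic_orbit f p x = (\<lambda>k. (f ^^ k) x) ` {..<p}"

text \<open>The interior is taken in the phase space \<open>I\<close>.\<close>

definition topologically_attracting :: "real set \<Rightarrow> (real \<Rightarrow> real) \<Rightarrow> nat \<Rightarrow> real \<Rightarrow> bool" where
  "topologically_attracting I f p x \<longleftrightarrow>
     periodic_point I f p x \<and>
     (top_of_set I) interior_of (basin I f (periodic_orbit f p x)) \<noteq> {}"

end

theory Submission imports Defs begin

text \<open>
  Almost every point of the basin has limit set \<open>A\<close>, so the claim is that \<open>A\<close> is finite: a finite limit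
  set of an orbit that does not land on it is a cycle attracting on one side. Suppose that \<open>A\<close> is
  infinite. Near \<open>A\<close> the map is a local diffeomorphism with Lipschitz \<open>log |f'|\<close>, hence iterates have
  bounded distortion along intervals whose images have bounded total length (Denjoy, Schwartz).

  First, \<open>A\<close> is a null set. Let an orbit in \<open>A\<close> first visit a neighbourhood of a small gap of \<open>A\<close>, of size
  comparable to the gap, and pull the gap back along the orbit. An orientation preserving return of a
  pulled back gap to the gap would trap the orbit in an interval, so every point lies in at most two
  of the pulled back gaps. Hence their total length is bounded, and the point of \<open>A\<close> sees gaps of \<open>A\<close> of
  definite proportion at arbitrarily small scales; this happens only at a null set of points.

  Secondly, since \<open>A\<close> is null, distortion along disjoint intervals near \<open>A\<close> is as close to 1 as
  desired. Points with finite orbit are dense near \<open>A\<close> and cut out small nice intervals \<open>V\<close>, whose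
  boundary never enters \<open>V\<close>. Pulling back from one return domain of length at most \<open>|V|/2\<close> to the
  preceding one contracts relative lengths by the factor 4/5, so \<open>V\<close> is reached with bounded distortion
  from arbitrarily small neighbourhoods of a point of the orbit. Hence the set \<open>E\<close> of points that stay
  near \<open>A\<close>, which does not contain \<open>V\<close>, is porous along almost every orbit; but almost every orbit in
  the basin ends up in \<open>E\<close>, and the porous points of \<open>E\<close> form a null set.
\<close>

section \<open>Iterates near a set without critical points\<close>

text \<open>A \<open>C^2\<close> map carries no Schwarzian condition, so the distortion tool is
  Denjoy's, with constant \<open>exp (C * M)\<close> where \<open>M\<close> bounds the measure of a
  neighbourhood of \<open>A\<close>. Hence the order of the two halves: the contraction between
  short return domains needs this constant close to 1, which is available once \<open>A\<close> is
  known to be null. The first half concerns orbits inside \<open>A\<close>, the second orbits merely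
  attracted by \<open>A\<close>; this is why \<open>E\<close> replaces \<open>A\<close> there. The
  recurring obstacle is that pullbacks along an orbit may become too long to stay away from critical
  points. If this happens for targets shrinking to a point, compactness yields a nondegenerate
  interval that contains a point of \<open>A\<close> and all of whose images are short. Such a point
  has a finite orbit, and the orbit of \<open>x\<close> avoids the interval. This is excluded by
  targets that a finite orbit meets only finitely often, or by pullbacks in which the orbit is well
  centred. Nonsingularity enters through null preimages of null sets: it transfers porosity at a
  later time to the initial point and keeps almost every orbit off a finite
  \<open>A\<close>.\<close>

lemma funpow_apply_add: "(f ^^ (m + n)) z = (f ^^ m) ((f ^^ n) z)"
  by (simp add: funpow_add)

text \<open>Convergence along each residue class leaves at most \<open>p\<close> limit points; this
  is how limit sets are shown to be finite.\<close>

lemma omega_limit_residues: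
  fixes f :: "real \<Rightarrow> real"
  assumes p: "0 < p"
    and lim: "\<And>r. r < p \<Longrightarrow> (\<lambda>k. (f ^^ (t + r + k * p)) x) \<longlonglongrightarrow> g r"
  shows "omega_limit f x \<subseteq> g ` {..<p}"
proof
  fix y assume "y \<in> omega_limit f x"
  then obtain h where h: "strict_mono (h :: nat \<Rightarrow> nat)" and hy: "(\<lambda>n. (f ^^ h n) x) \<longlonglongrightarrow> y"
    by (auto simp: omega_limit_def)
  show "y \<in> g ` {..<p}"
  proof (rule ccontr)
    assume ny: "y \<notin> g ` {..<p}"
    have "closed (g ` {..<p})" by (simp add: finite_imp_closed)
    then have "open (- g ` {..<p})" by auto
    then obtain d where d: "d > 0" "ball y d \<subseteq> - g ` {..<p}"
      using ny openE by blast
    \<comment> \<open>\<open>V\<close> contains every \<open>g r\<close> and keeps distance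
      \<open>d / 2\<close> from \<open>y\<close>, so an orbit that ends up in \<open>V\<close>
      cannot accumulate at \<open>y\<close>.\<close>
    define V where "V = {z. d / 2 < dist y z}"
    have oV: "open V" unfolding V_def by (intro open_Collect_less continuous_intros)
    have gV: "g r \<in> V" if "r < p" for r
      using d that unfolding V_def by (force simp: subset_iff)
    have "\<forall>r\<in>{..<p}. eventually (\<lambda>k. (f ^^ (t + r + k * p)) x \<in> V) sequentially"
      using lim gV oV topological_tendstoD by blast
    then have "eventually (\<lambda>k. \<forall>r\<in>{..<p}. (f ^^ (t + r + k * p)) x \<in> V) sequentially"
      by (intro eventually_ball_finite) auto
    then obtain K where K: "\<And>k r. k \<ge> K \<Longrightarrow> r < p \<Longrightarrow> (f ^^ (t + r + k * p)) x \<in> V"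
      by (auto simp: eventually_sequentially)
    have inV: "(f ^^ i) x \<in> V" if i: "i \<ge> t + K * p" for i
    proof -
      have "i = t + (i - t) mod p + ((i - t) div p) * p"
        using i by (metis add.assoc add.commute add_leD1 le_add_diff_inverse mod_div_mult_eq)
      moreover have "(i - t) div p \<ge> K" using i p by (simp add: less_eq_div_iff_mult_less_eq)
      moreover have "(i - t) mod p < p" using p by simp
      ultimately show ?thesis using K by metis
    qed
    have "eventually (\<lambda>n. (f ^^ h n) x \<in> V) sequentially"
      unfolding eventually_sequentially
      using inV seq_suble[OF h] by (meson le_trans)
    moreover have "eventually (\<lambda>n. (f ^^ h n) x \<in> ball y (d/2)) sequentially"
      using hy d(1) by (intro topological_tendstoD) auto
    ultimately have "eventually (\<lambda>n. False) sequentially"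
      by eventually_elim (auto simp: V_def)
    then show False by simp
  qed
qed

text \<open>Integrate the counting function of the family: it is at most \<open>k\<close> on
  \<open>R\<close> and vanishes elsewhere.\<close>

lemma sum_measure_le_multiplicity:
  fixes S :: "'i \<Rightarrow> real set"
  assumes fin: "finite I" and meas: "\<And>i. i \<in> I \<Longrightarrow> S i \<in> lmeasurable"
    and sub: "\<And>i. i \<in> I \<Longrightarrow> S i \<subseteq> R" and R: "R \<in> lmeasurable"
    and mult: "\<And>z. card {i \<in> I. z \<in> S i} \<le> k"
  shows "(\<Sum>i\<in>I. measure lebesgue (S i)) \<le> real k * measure lebesgue R"
proof -
  have ii: "integrable lebesgue (\<lambda>z. indicat_real (S i) z)" if "i \<in> I" for i
    using meas[OF that] by (auto simp: fmeasurable_def intro!: integrable_real_indicator)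
  have "(\<Sum>i\<in>I. measure lebesgue (S i)) = (\<Sum>i\<in>I. integral\<^sup>L lebesgue (indicat_real (S i)))"
    by simp
  also have "\<dots> = integral\<^sup>L lebesgue (\<lambda>z. \<Sum>i\<in>I. indicat_real (S i) z)"
    using ii by (subst Bochner_Integration.integral_sum) auto
  also have "\<dots> \<le> integral\<^sup>L lebesgue (\<lambda>z. real k * indicat_real R z)"
  proof (rule integral_mono)
    show "integrable lebesgue (\<lambda>z. \<Sum>i\<in>I. indicat_real (S i) z)" using ii by auto
    show "integrable lebesgue (\<lambda>z. real k * indicat_real R z)"
      using R by (auto simp: fmeasurable_def intro!: integrable_real_indicator)
    fix z
    show "(\<Sum>i\<in>I. indicat_real (S i) z) \<le> real k * indicat_real R z"
    proof (cases "z \<in> R")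
      case True
      have "(\<Sum>i\<in>I. indicat_real (S i) z) = real (card {i \<in> I. z \<in> S i})"
        using fin by (simp add: indicator_def sum.If_cases Int_def)
      then show ?thesis using True mult[of z] by simp
    next
      case False
      then have "\<And>i. i \<in> I \<Longrightarrow> z \<notin> S i" using sub by blast
      then show ?thesis using False by simp
    qed
  qed
  also have "\<dots> = real k * measure lebesgue R" by simp
  finally show ?thesis .
qed

text \<open>Closed neighbourhoods, so that they are compact together with \<open>A\<close> and have
  finite measure.\<close>

definition nhd :: "real set \<Rightarrow> real \<Rightarrow> real set" where
  "nhd A r = {z. \<exists>a\<in>A. \<bar>z - a\<bar> \<le> r}"

lemma compact_nhd:
  assumes "compact A" shows "compact (nhd A r)"
proof -
  have "z \<in> nhd A r \<longleftrightarrow> (\<exists>a t. z = a + t \<and> a \<in> A \<and> \<bar>t\<bar> \<le> r)" for z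
  proof
    assume "z \<in> nhd A r"
    then obtain a where "a \<in> A" "\<bar>z - a\<bar> \<le> r" unfolding nhd_def by auto
    then show "\<exists>a t. z = a + t \<and> a \<in> A \<and> \<bar>t\<bar> \<le> r"
      by (intro exI[of _ a] exI[of _ "z - a"]) simp
  qed (force simp: nhd_def)
  then have "nhd A r = {a + t | a t. a \<in> A \<and> t \<in> cball 0 r}"
    by (intro set_eqI) (simp add: dist_real_def)
  then show ?thesis using compact_sums[OF assms compact_cball[of 0 r]] by (simp only:)
qed

lemma nhd_mono: "r \<le> s \<Longrightarrow> nhd A r \<subseteq> nhd A s"
  unfolding nhd_def by force

text \<open>Two radii: orbits are followed in \<open>nhd A \<rho>\<close>, and intervals of length
  at most \<open>\<rho>\<close> around their points then stay in \<open>nhd A (2 * \<rho>)\<close>,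
  where \<open>f'\<close> is controlled. The map lives on the whole line, so endpoints of the phase
  space do not interfere with inverse branches.\<close>

locale regular_map =
  fixes f f' :: "real \<Rightarrow> real" and A :: "real set" and \<rho> c C M :: real
  assumes deriv: "\<And>z. (f has_real_derivative f' z) (at z)"
    and cont_deriv: "continuous_on UNIV f'"
    and compact_A: "compact A"
    and inv_A: "f ` A \<subseteq> A"
    and rho: "0 < \<rho>"
    and c_pos: "0 < c" and c_le: "c \<le> 1" and C_nonneg: "0 \<le> C"
    and lower: "\<And>z. z \<in> nhd A (2 * \<rho>) \<Longrightarrow> c \<le> \<bar>f' z\<bar>"
    and lipschitz: "\<And>z w. z \<in> nhd A (2 * \<rho>) \<Longrightarrow> w \<in> nhd A (2 * \<rho>) \<Longrightarrow>
          \<bar>ln \<bar>f' z\<bar> - ln \<bar>f' w\<bar>\<bar> \<le> C * \<bar>z - w\<bar>"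
    and measure_le: "measure lebesgue (nhd A (2 * \<rho>)) \<le> M"
begin

abbreviation "Reg \<equiv> nhd A (2 * \<rho>)"

definition Df :: "nat \<Rightarrow> real \<Rightarrow> real" where
  "Df n z = (\<Prod>i<n. f' ((f ^^ i) z))"

abbreviation len :: "nat \<Rightarrow> real \<Rightarrow> real \<Rightarrow> real" where
  "len n u v \<equiv> \<bar>(f ^^ n) u - (f ^^ n) v\<bar>"

text \<open>Only the times \<open>j < n\<close> count, since \<open>Df n\<close> evaluates
  \<open>f'\<close> only there; the \<open>n\<close>-th image itself may leave the
  neighbourhood.\<close>

definition in_reg :: "nat \<Rightarrow> real set \<Rightarrow> bool" where
  "in_reg n J \<longleftrightarrow> (\<forall>j<n. (f ^^ j) ` J \<subseteq> Reg)"

lemma M_nonneg: "0 \<le> M"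
  using measure_le measure_nonneg order_trans by blast

lemma Reg_lmeasurable: "Reg \<in> lmeasurable"
  using compact_nhd[OF compact_A] by (rule lmeasurable_compact)

lemma deriv_iter: "((f ^^ n) has_real_derivative Df n z) (at z)"
proof (induction n)
  case 0
  then show ?case by (simp add: Df_def id_def)
next
  case (Suc n)
  have "((\<lambda>z. f ((f ^^ n) z)) has_real_derivative f' ((f ^^ n) z) * Df n z) (at z)"
    by (rule DERIV_chain2[OF deriv Suc])
  then show ?case by (simp add: Df_def mult.commute o_def)
qed

lemma isCont_iter: "isCont (f ^^ n) z"
  using deriv_iter DERIV_isCont by blast

lemma continuous_on_iter: "continuous_on S (f ^^ n)"
  using isCont_iter continuous_at_imp_continuous_on by blast

lemma tendsto_iter: "(g \<longlongrightarrow> l) F \<Longrightarrow> ((\<lambda>k. (f ^^ n) (g k)) \<longlongrightarrow> (f ^^ n) l) F"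
  using isCont_iter isCont_tendsto_compose by blast

lemma Df_add: "Df (m + n) z = Df m ((f ^^ n) z) * Df n z"
proof -
  have "Df (n + m) z = (\<Prod>i<n. f' ((f ^^ i) z)) * (\<Prod>i\<in>{n..<n+m}. f' ((f ^^ i) z))"
    unfolding Df_def by (metis le_add1 lessThan_atLeast0 prod.atLeastLessThan_concat zero_le)
  also have "(\<Prod>i\<in>{n..<n+m}. f' ((f ^^ i) z)) = (\<Prod>i<m. f' ((f ^^ (i + n)) z))"
    using prod.shift_bounds_nat_ivl[of "\<lambda>i. f' ((f ^^ i) z)" 0 n m]
    by (simp add: lessThan_atLeast0 add.commute)
  finally show ?thesis by (simp add: Df_def funpow_apply_add add.commute)
qed

lemma continuous_on_Df: "continuous_on S (Df n)"
proof -
  have "continuous_on S (\<lambda>z. f' ((f ^^ i) z))" for i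
    using continuous_on_compose2[OF cont_deriv continuous_on_iter[of S i]] by simp
  then show ?thesis unfolding Df_def by (intro continuous_on_prod) auto
qed

lemma iter_A: "a \<in> A \<Longrightarrow> (f ^^ n) a \<in> A"
  by (induction n) (use inv_A in auto)

lemma Reg_nonzero: "z \<in> Reg \<Longrightarrow> f' z \<noteq> 0"
  using lower c_pos by fastforce

lemma in_reg_subset: "in_reg n J \<Longrightarrow> J' \<subseteq> J \<Longrightarrow> in_reg n J'"
  unfolding in_reg_def by blast

lemma in_reg_le: "in_reg n J \<Longrightarrow> m \<le> n \<Longrightarrow> in_reg m J"
  unfolding in_reg_def by auto

lemma in_reg_shift: "in_reg (m + n) J \<Longrightarrow> in_reg m ((f ^^ n) ` J)"
  unfolding in_reg_def
proof (intro allI impI)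
  fix j assume *: "\<forall>j<m + n. (f ^^ j) ` J \<subseteq> Reg" and j: "j < m"
  then have "(f ^^ (j + n)) ` J \<subseteq> Reg" by simp
  then show "(f ^^ j) ` (f ^^ n) ` J \<subseteq> Reg"
    by (simp add: funpow_apply_add image_subset_iff)
qed

lemma Df_nonzero: "in_reg n J \<Longrightarrow> z \<in> J \<Longrightarrow> Df n z \<noteq> 0"
  unfolding Df_def in_reg_def using Reg_nonzero by (auto simp: image_subset_iff)

lemma Df_sign:
  assumes "is_interval J" "in_reg n J"
  shows "(\<forall>z\<in>J. Df n z > 0) \<or> (\<forall>z\<in>J. Df n z < 0)"
proof (rule ccontr)
  assume "\<not> ?thesis"
  then obtain z w where zw: "z \<in> J" "w \<in> J" "Df n z < 0" "Df n w > 0"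
    using Df_nonzero[OF assms(2)] by (metis linorder_less_linear)
  have "connected (Df n ` J)"
    using assms(1) continuous_on_Df connected_continuous_image is_interval_connected by blast
  then have "0 \<in> Df n ` J"
    using zw by (meson connectedD_interval imageI less_imp_le)
  then show False using Df_nonzero[OF assms(2)] by force
qed

lemma iter_increasing:
  assumes "is_interval J" "\<forall>z\<in>J. Df n z > 0" "z \<in> J" "w \<in> J" "z < w"
  shows "(f ^^ n) z < (f ^^ n) w"
proof (rule DERIV_pos_imp_increasing[OF assms(5)])
  fix y assume "z \<le> y" "y \<le> w"
  then have "y \<in> J" using assms(1,3,4) by (meson mem_is_interval_1_I)
  then show "\<exists>d. ((f ^^ n) has_real_derivative d) (at y) \<and> 0 < d" using assms(2) deriv_iter by blast
qed

lemma iter_decreasing: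
  assumes "is_interval J" "\<forall>z\<in>J. Df n z < 0" "z \<in> J" "w \<in> J" "z < w"
  shows "(f ^^ n) z > (f ^^ n) w"
proof (rule DERIV_neg_imp_decreasing[OF assms(5)])
  fix y assume "z \<le> y" "y \<le> w"
  then have "y \<in> J" using assms(1,3,4) by (meson mem_is_interval_1_I)
  then show "\<exists>d. ((f ^^ n) has_real_derivative d) (at y) \<and> d < 0" using assms(2) deriv_iter by blast
qed

lemma iter_monotone:
  assumes "is_interval J" "in_reg n J"
  shows "(\<forall>z\<in>J. \<forall>w\<in>J. z < w \<longrightarrow> (f ^^ n) z < (f ^^ n) w) \<or>
         (\<forall>z\<in>J. \<forall>w\<in>J. z < w \<longrightarrow> (f ^^ n) z > (f ^^ n) w)"
  using Df_sign[OF assms] iter_increasing[OF assms(1)] iter_decreasing[OF assms(1)] by blast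

lemma iter_inj:
  assumes "is_interval J" "in_reg n J"
  shows "inj_on (f ^^ n) J"
  unfolding inj_on_def using iter_monotone[OF assms] by (metis linorder_less_linear order_less_irrefl)

lemma iter_closed_segment:
  assumes "u \<le> v" "in_reg n {u..v}"
  shows "(f ^^ n) ` {u..v} = closed_segment ((f ^^ n) u) ((f ^^ n) v)"
proof -
  have conn: "connected ((f ^^ n) ` {u..v})"
    by (intro connected_continuous_image continuous_on_iter) simp
  have "closed_segment ((f ^^ n) u) ((f ^^ n) v) \<subseteq> (f ^^ n) ` {u..v}"
    using connected_contains_Icc[OF conn] assms(1) by (simp add: closed_segment_eq_real_ivl)
  moreover have "(f ^^ n) z \<in> closed_segment ((f ^^ n) u) ((f ^^ n) v)" if z: "z \<in> {u..v}" for z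
  proof -
    have "z = u \<or> z = v \<or> (u < z \<and> z < v)" using z by auto
    moreover have "u \<in> {u..v}" "v \<in> {u..v}" using assms(1) by auto
    ultimately show ?thesis
      using iter_monotone[OF is_interval_cc assms(2)] z unfolding closed_segment_eq_real_ivl
      by (smt (verit, best) atLeastAtMost_iff)
  qed
  ultimately show ?thesis by blast
qed

lemma iter_open_segment:
  assumes "u < v" "in_reg n {u..v}"
  shows "(f ^^ n) ` {u<..<v} = open_segment ((f ^^ n) u) ((f ^^ n) v)"
proof -
  have inj: "inj_on (f ^^ n) {u..v}" using iter_inj assms(2) is_interval_cc by blast
  have "{u<..<v} = {u..v} - {u, v}" by auto
  then have "(f ^^ n) ` {u<..<v} = (f ^^ n) ` {u..v} - (f ^^ n) ` {u, v}"
    using inj assms(1) by (metis (no_types, lifting) Diff_subset atLeastAtMost_iff empty_subsetI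
        inj_on_image_set_diff insert_subset less_imp_le order_refl)
  then show ?thesis using iter_closed_segment[OF less_imp_le[OF assms(1)] assms(2)]
    by (simp add: open_segment_def)
qed

lemma iter_dist_le:
  assumes "in_reg n {u..v}" "z \<in> {u..v}" "w \<in> {u..v}"
  shows "len n z w \<le> len n u v"
proof -
  have "(f ^^ n) z \<in> closed_segment ((f ^^ n) u) ((f ^^ n) v)"
       "(f ^^ n) w \<in> closed_segment ((f ^^ n) u) ((f ^^ n) v)"
    using iter_closed_segment[OF _ assms(1)] assms(2,3) by auto
  then show ?thesis by (auto simp: closed_segment_eq_real_ivl split: if_splits)
qed

text \<open>Induction on time: as long as the earlier images lie in \<open>Reg\<close>, the next
  iterate is monotone, so its image lies between the images of the endpoints. It is then shorter
  than \<open>\<rho>\<close> and contains a point within \<open>\<rho>\<close> of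
  \<open>A\<close>.\<close>

lemma in_regI:
  assumes w: "w \<in> {u..v}" and near: "\<And>j. j < n \<Longrightarrow> (f ^^ j) w \<in> nhd A \<rho>"
    and small: "\<And>j. j < n \<Longrightarrow> len j u v \<le> \<rho>"
  shows "in_reg n {u..v}"
  using near small
proof (induction n)
  case 0
  then show ?case by (simp add: in_reg_def)
next
  case (Suc n)
  then have IH: "in_reg n {u..v}" by simp
  have "(f ^^ n) z \<in> Reg" if z: "z \<in> {u..v}" for z
  proof -
    have "len n z w \<le> \<rho>"
      using iter_dist_le[OF IH z w] Suc.prems(2)[of n] by simp
    moreover obtain a where "a \<in> A" "\<bar>(f ^^ n) w - a\<bar> \<le> \<rho>"
      using Suc.prems(1)[of n] unfolding nhd_def by auto
    ultimately show ?thesis unfolding nhd_def by force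
  qed
  then show ?case using IH unfolding in_reg_def by (auto simp: less_Suc_eq)
qed

text \<open>Denjoy's estimate: \<open>ln \<bar>Df n z\<bar>\<close> is a sum along the orbit, and
  the Lipschitz bound compares two such sums term by term.\<close>

lemma Df_distortion:
  assumes "\<And>j. j < n \<Longrightarrow> (f ^^ j) z \<in> Reg" "\<And>j. j < n \<Longrightarrow> (f ^^ j) w \<in> Reg"
    and "(\<Sum>j<n. len j z w) \<le> S"
  shows "\<bar>Df n z\<bar> \<le> exp (C * S) * \<bar>Df n w\<bar>"
proof -
  have pos: "\<bar>f' ((f ^^ j) z)\<bar> > 0" "\<bar>f' ((f ^^ j) w)\<bar> > 0" if "j < n" for j
    using assms that Reg_nonzero by auto
  have "ln \<bar>Df n z\<bar> = (\<Sum>j<n. ln \<bar>f' ((f ^^ j) z)\<bar>)" "ln \<bar>Df n w\<bar> = (\<Sum>j<n. ln \<bar>f' ((f ^^ j) w)\<bar>)"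
    using pos unfolding Df_def abs_prod by (subst ln_prod; force)+
  then have "ln \<bar>Df n z\<bar> - ln \<bar>Df n w\<bar> = (\<Sum>j<n. ln \<bar>f' ((f ^^ j) z)\<bar> - ln \<bar>f' ((f ^^ j) w)\<bar>)"
    by (simp add: sum_subtractf)
  also have "\<dots> \<le> (\<Sum>j<n. C * len j z w)"
    using assms lipschitz by (intro sum_mono) (smt (verit) lessThan_iff)
  also have "\<dots> \<le> C * S" using assms(3) C_nonneg by (simp add: sum_distrib_left[symmetric] mult_left_mono)
  finally have le: "ln \<bar>Df n z\<bar> \<le> C * S + ln \<bar>Df n w\<bar>" by simp
  have "\<bar>Df n z\<bar> > 0" "\<bar>Df n w\<bar> > 0"
    unfolding Df_def abs_prod using pos by (auto intro!: prod_pos)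
  then show ?thesis using le
    by (metis exp_add exp_le_cancel_iff exp_ln)
qed

lemma iter_mvt: "\<exists>\<xi>\<in>closed_segment u v. (f ^^ n) u - (f ^^ n) v = (u - v) * Df n \<xi>"
proof (cases u v rule: linorder_cases)
  case less
  then obtain \<xi> where "u < \<xi>" "\<xi> < v" "(f ^^ n) v - (f ^^ n) u = (v - u) * Df n \<xi>"
    using MVT2[OF less, of "f ^^ n" "Df n"] deriv_iter by auto
  then show ?thesis by (intro bexI[of _ \<xi>]) (auto simp: closed_segment_eq_real_ivl algebra_simps)
next
  case greater
  then obtain \<xi> where "v < \<xi>" "\<xi> < u" "(f ^^ n) u - (f ^^ n) v = (u - v) * Df n \<xi>"
    using MVT2[OF greater, of "f ^^ n" "Df n"] deriv_iter by auto
  then show ?thesis by (intro bexI[of _ \<xi>]) (auto simp: closed_segment_eq_real_ivl)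
qed auto

text \<open>Bounded distortion stated for lengths: two applications of the mean value theorem
  compare the stretching of two subsegments. The products avoid division by degenerate
  lengths.\<close>

lemma four_point:
  assumes reg: "in_reg n {a..b}" and S: "(\<Sum>j<n. len j a b) \<le> S"
    and uv: "u \<in> {a..b}" "v \<in> {a..b}" and pq: "p \<in> {a..b}" "q \<in> {a..b}"
  shows "len n u v * \<bar>p - q\<bar> \<le> exp (C * S) * (len n p q * \<bar>u - v\<bar>)"
proof -
  obtain z where z: "z \<in> closed_segment u v" "(f ^^ n) u - (f ^^ n) v = (u - v) * Df n z"
    using iter_mvt by blast
  obtain w where w: "w \<in> closed_segment p q" "(f ^^ n) p - (f ^^ n) q = (p - q) * Df n w"
    using iter_mvt by blast
  have zw: "z \<in> {a..b}" "w \<in> {a..b}"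
    using z(1) w(1) uv pq by (auto simp: closed_segment_eq_real_ivl split: if_splits)
  have "(\<Sum>j<n. len j z w) \<le> (\<Sum>j<n. len j a b)"
    using iter_dist_le zw in_reg_le[OF reg] by (intro sum_mono) auto
  then have "\<bar>Df n z\<bar> \<le> exp (C * S) * \<bar>Df n w\<bar>"
    using reg zw S unfolding in_reg_def by (intro Df_distortion) (auto simp: image_subset_iff)
  then have "\<bar>u - v\<bar> * \<bar>p - q\<bar> * \<bar>Df n z\<bar> \<le> \<bar>u - v\<bar> * \<bar>p - q\<bar> * (exp (C * S) * \<bar>Df n w\<bar>)"
    by (intro mult_left_mono) auto
  then show ?thesis unfolding z(2) w(2) abs_mult by (simp add: mult_ac)
qed

text \<open>The images of the open interval lie in \<open>Reg\<close>, whose measure is at most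
  \<open>M\<close>, and cover each point at most \<open>k\<close> times.\<close>

lemma sum_lengths_le:
  assumes uv: "u < v" and reg: "in_reg n {u..v}"
    and mult: "\<And>z. card {j. j < n \<and> z \<in> (f ^^ j) ` {u<..<v}} \<le> k"
  shows "(\<Sum>j<n. len j u v) \<le> real k * M"
proof -
  have m: "(f ^^ j) ` {u<..<v} \<in> lmeasurable \<and>
      measure lebesgue ((f ^^ j) ` {u<..<v}) = len j u v" if "j < n" for j
  proof -
    have "in_reg j {u..v}" using reg that in_reg_le by simp
    then show ?thesis
      using iter_open_segment[OF uv] by (simp add: open_segment_eq_real_ivl abs_real_def)
  qed
  have "(\<Sum>j<n. measure lebesgue ((f ^^ j) ` {u<..<v})) \<le> real k * measure lebesgue Reg"
  proof (rule sum_measure_le_multiplicity)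
    show "(f ^^ i) ` {u<..<v} \<subseteq> Reg" if "i \<in> {..<n}" for i
      using reg that unfolding in_reg_def by fastforce
  qed (use m mult Reg_lmeasurable in auto)
  also have "\<dots> \<le> real k * M" using measure_le by (simp add: mult_left_mono)
  finally show ?thesis using m by simp
qed

lemma sum_lengths_le_disjoint:
  assumes uv: "u < v" and reg: "in_reg n {u..v}"
    and disj: "\<And>i j. i < j \<Longrightarrow> j < n \<Longrightarrow> (f ^^ i) ` {u<..<v} \<inter> (f ^^ j) ` {u<..<v} = {}"
  shows "(\<Sum>j<n. len j u v) \<le> M"
proof -
  have "card {j. j < n \<and> z \<in> (f ^^ j) ` {u<..<v}} \<le> 1" for z
  proof -
    let ?B = "{j. j < n \<and> z \<in> (f ^^ j) ` {u<..<v}}"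
    have "i = k" if "i \<in> ?B" "k \<in> ?B" for i k
      using disj[of i k] disj[of k i] that by (cases i k rule: linorder_cases) (blast | simp)+
    then show ?thesis by (simp add: card_le_Suc0_iff_eq)
  qed
  from sum_lengths_le[OF uv reg this] show ?thesis by simp
qed

end

section \<open>Intervals that stay small\<close>

lemma omega_limitI:
  fixes f :: "real \<Rightarrow> real"
  assumes "\<And>e N. e > 0 \<Longrightarrow> \<exists>n\<ge>N. \<bar>(f ^^ n) x - y\<bar> < e"
  shows "y \<in> omega_limit f x"
proof -
  have "\<exists>r. \<forall>k. \<bar>(f ^^ r k) x - y\<bar> < inverse (real (Suc k)) \<and> r k < r (Suc k)"
  proof (rule dependent_nat_choice)
    show "\<exists>n. \<bar>(f ^^ n) x - y\<bar> < inverse (real (Suc 0))"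
      using assms[of "inverse (real (Suc 0))" 0] by auto
    fix n k
    obtain n' where "n' \<ge> Suc n" "\<bar>(f ^^ n') x - y\<bar> < inverse (real (Suc (Suc k)))"
      using assms[of "inverse (real (Suc (Suc k)))" "Suc n"] by auto
    then show "\<exists>n'. \<bar>(f ^^ n') x - y\<bar> < inverse (real (Suc (Suc k))) \<and> n < n'" by auto
  qed
  then obtain r where r: "\<And>k. \<bar>(f ^^ r k) x - y\<bar> < inverse (real (Suc k))" "\<And>k. r k < r (Suc k)"
    by blast
  have "(\<lambda>k. (f ^^ r k) x - y) \<longlonglongrightarrow> 0"
    using r(1) less_imp_le by (intro Lim_null_comparison[OF _ LIMSEQ_inverse_real_of_nat] always_eventually)
      (auto simp: real_norm_def)
  then have "(\<lambda>k. (f ^^ r k) x) \<longlonglongrightarrow> y" by (simp add: LIM_zero_iff)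
  moreover have "strict_mono r" using r(2) by (simp add: strict_mono_Suc_iff)
  ultimately show ?thesis unfolding omega_limit_def by blast
qed

lemma omega_limit_recurrent:
  fixes f :: "real \<Rightarrow> real"
  assumes "y \<in> omega_limit f x" "open U" "y \<in> U"
  shows "\<exists>n\<ge>N. (f ^^ n) x \<in> U"
proof -
  obtain r where r: "strict_mono (r :: nat \<Rightarrow> nat)" "(\<lambda>n. (f ^^ r n) x) \<longlonglongrightarrow> y"
    using assms(1) by (auto simp: omega_limit_def)
  then obtain K where "\<And>k. k \<ge> K \<Longrightarrow> (f ^^ r k) x \<in> U"
    using topological_tendstoD[OF r(2) assms(2,3)] by (auto simp: eventually_sequentially)
  then have "(f ^^ r (max K N)) x \<in> U" "r (max K N) \<ge> N"
    using seq_suble[OF r(1), of "max K N"] by auto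
  then show ?thesis by blast
qed

lemma finite_interval_minus_interior:
  fixes S :: "real set"
  assumes "is_interval S"
  shows "finite (S - interior S)"
proof (rule finite_subset)
  show "S - interior S \<subseteq> {Inf S, Sup S}"
  proof
    fix z assume z: "z \<in> S - interior S"
    have "(\<forall>w\<in>S. z \<le> w) \<or> (\<forall>w\<in>S. w \<le> z)"
    proof (rule ccontr)
      assume "\<not> ?thesis"
      then obtain a b where ab: "a \<in> S" "b \<in> S" "a < z" "z < b" by force
      then have "{a<..<b} \<subseteq> S"
        using assms by (meson greaterThanLessThan_iff less_imp_le mem_is_interval_1_I subsetI)
      then have "{a<..<b} \<subseteq> interior S" by (simp add: interior_maximal)
      then show False using z ab by auto
    qed
    then show "z \<in> {Inf S, Sup S}"
      using z cInf_eq_minimum[of z S] cSup_eq_maximum[of z S] by auto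
  qed
qed simp

text \<open>The point \<open>x\<close> may belong to \<open>A\<close> or only be attracted by it;
  both cases are used. \<open>infinite_A\<close> is the assumption to be refuted, and it forbids
  that the orbit is trapped in an interval where an iterate is monotone.\<close>

locale regular_orbit = regular_map +
  fixes x :: real
  assumes near: "\<And>i. (f ^^ i) x \<in> nhd A \<rho>"
    and omega: "omega_limit f x = A"
    and infinite_A: "infinite A"
begin

abbreviation "X i \<equiv> (f ^^ i) x"

lemma X_shift: "X (i + j) = (f ^^ j) (X i)"
  using funpow_apply_add[of j i f x] by (simp add: add.commute)

lemma recurrent: "a \<in> A \<Longrightarrow> open U \<Longrightarrow> a \<in> U \<Longrightarrow> \<exists>n\<ge>N. X n \<in> U"
  using omega_limit_recurrent omega by blast

lemma A_near: "a \<in> A \<Longrightarrow> (f ^^ j) a \<in> nhd A \<rho>"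
  using iter_A[of a j] rho unfolding nhd_def by force

lemma near_Reg: "nhd A \<rho> \<subseteq> Reg"
  using rho by (intro nhd_mono) simp

text \<open>Along the times \<open>t + k * s\<close> the orbit follows a monotone map of
  \<open>J\<close>. A bounded monotone sequence converges, so the limit set would be finite.\<close>

lemma trap:
  assumes s: "0 < s" and J: "\<And>k. X (t + k * s) \<in> J"
    and mono: "(\<forall>z\<in>J. \<forall>w\<in>J. z < w \<longrightarrow> (f ^^ s) z < (f ^^ s) w) \<or>
               (\<forall>z\<in>J. \<forall>w\<in>J. z < w \<longrightarrow> (f ^^ s) z > (f ^^ s) w)"
  shows False
proof -
  \<comment> \<open>Steps of \<open>2 * s\<close> make the map order preserving also when
    \<open>f ^^ s\<close> is decreasing.\<close>
  define a where "a k = X (t + k * (2 * s))" for k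
  have aJ: "a k \<in> J" "(f ^^ s) (a k) \<in> J" for k
  proof -
    show "a k \<in> J" using J[of "k * 2"] by (simp add: a_def mult.assoc)
    have "t + k * (2 * s) + s = t + (2 * k + 1) * s" by (simp add: algebra_simps)
    then show "(f ^^ s) (a k) \<in> J" unfolding a_def using J[of "2 * k + 1"] X_shift by metis
  qed
  have a_Suc: "a (Suc k) = (f ^^ s) ((f ^^ s) (a k))" for k
  proof -
    have "t + Suc k * (2 * s) = t + k * (2 * s) + s + s" by simp
    then show ?thesis unfolding a_def using X_shift by metis
  qed
  have step: "a (Suc k) \<le> a (Suc l)" if "a k \<le> a l" for k l
    using mono aJ[of k] aJ[of l] that unfolding a_Suc by (smt (verit, best))
  have "incseq a \<or> decseq a"
  proof (cases "a 0 \<le> a 1")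
    case True
    have "a k \<le> a (Suc k)" for k by (induction k) (use True step in auto)
    then show ?thesis by (simp add: incseq_SucI)
  next
    case False
    have "a (Suc k) \<le> a k" for k by (induction k) (use False step in auto)
    then show ?thesis by (simp add: decseq_SucI)
  qed
  then have "monoseq a" using monoseq_iff by blast
  moreover have "Bseq a"
  proof -
    have "bounded (nhd A \<rho>)" using compact_nhd[OF compact_A] compact_imp_bounded by blast
    then obtain B where "\<And>z. z \<in> nhd A \<rho> \<Longrightarrow> norm z \<le> B" unfolding bounded_iff by blast
    then show ?thesis using near unfolding a_def by (intro BseqI') blast
  qed
  ultimately obtain l where l: "a \<longlonglongrightarrow> l"
    using Bseq_monoseq_convergent convergent_def by blast
  have "omega_limit f x \<subseteq> (\<lambda>r. (f ^^ r) l) ` {..<2 * s}"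
  proof (rule omega_limit_residues[where t = t])
    fix r
    have "X (t + r + k * (2 * s)) = (f ^^ r) (a k)" for k
      unfolding a_def using X_shift[of "t + k * (2 * s)" r] by (simp add: algebra_simps)
    then show "(\<lambda>k. X (t + r + k * (2 * s))) \<longlonglongrightarrow> (f ^^ r) l"
      using tendsto_iter[OF l] by simp
  qed (use s in simp)
  then show False using omega infinite_A finite_subset by blast
qed

lemma trap_interval:
  assumes "0 < s" "\<And>k. X (t + k * s) \<in> J" "is_interval J" "in_reg s J"
  shows False
  using trap[OF assms(1,2) iter_monotone[OF assms(3,4)]] .

text \<open>The images of \<open>T\<close> at the times \<open>m + k * n\<close> form a chain in
  which consecutive members meet; their union is an interval that \<open>f ^^ n\<close> maps into
  itself.\<close>

lemma nonwandering_hull: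
  assumes T: "is_interval T" "\<And>j. in_reg j T"
    and meet: "(f ^^ m) ` T \<inter> (f ^^ (m + n)) ` T \<noteq> {}"
  obtains S where "is_interval S" "(f ^^ m) ` T \<subseteq> S" "\<And>j. in_reg j S" "(f ^^ n) ` S \<subseteq> S"
proof
  define F where "F k = (f ^^ (m + k * n)) ` T" for k
  define S where "S = (\<Union>k. F k)"
  obtain a b where ab: "a \<in> T" "b \<in> T" "(f ^^ m) a = (f ^^ (m + n)) b" using meet by auto
  have conF: "connected (F k)" for k
    unfolding F_def using T(1) is_interval_connected continuous_on_iter
    by (intro connected_continuous_image) auto
  have FF: "F k \<inter> F (Suc k) \<noteq> {}" for k
  proof -
    have "(f ^^ (m + k * n)) a = (f ^^ (k * n)) ((f ^^ m) a)"
      by (metis add.commute funpow_apply_add)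
    also have "\<dots> = (f ^^ (m + Suc k * n)) b"
      unfolding ab(3) using funpow_apply_add[of "k * n" "m + n" f b] by (simp add: algebra_simps)
    finally show ?thesis using ab unfolding F_def by blast
  qed
  have con: "connected (\<Union>k\<le>K. F k)" for K
  proof (induction K)
    case 0
    then show ?case using conF by simp
  next
    case (Suc K)
    have "(\<Union>k\<le>Suc K. F k) = (\<Union>k\<le>K. F k) \<union> F (Suc K)" by (auto simp: atMost_Suc)
    moreover have "(\<Union>k\<le>K. F k) \<inter> F (Suc K) \<noteq> {}" using FF[of K] by blast
    ultimately show ?case using Suc conF connected_Un by metis
  qed
  have "connected (\<Union>(range (\<lambda>K. \<Union>k\<le>K. F k)))"
  proof (rule connected_Union)
    show "\<Inter>(range (\<lambda>K. \<Union>k\<le>K. F k)) \<noteq> {}"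
    proof -
      have "(f ^^ m) a \<in> (\<Union>k\<le>K. F k)" for K
        using ab(1) by (intro UN_I[of 0]) (auto simp: F_def)
      then show ?thesis by blast
    qed
  qed (use con in blast)
  moreover have "\<Union>(range (\<lambda>K. \<Union>k\<le>K. F k)) = S" unfolding S_def by auto
  ultimately show "is_interval S" using is_interval_connected_1 by simp
  show "(f ^^ m) ` T \<subseteq> S" unfolding S_def F_def using UN_upper[of 0 UNIV "\<lambda>k. (f ^^ (m + k * n)) ` T"] by simp
  show "in_reg j S" for j
    unfolding in_reg_def
  proof (intro allI impI)
    fix i
    have "(f ^^ (i + (m + k * n))) ` T \<subseteq> Reg" for k
      using T(2)[of "Suc (i + (m + k * n))"] unfolding in_reg_def by blast
    then show "(f ^^ i) ` S \<subseteq> Reg" unfolding S_def F_def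
      by (auto simp: funpow_apply_add[symmetric] image_subset_iff)
  qed
  show "(f ^^ n) ` S \<subseteq> S"
  proof
    fix z assume "z \<in> (f ^^ n) ` S"
    then obtain k w where "w \<in> T" "z = (f ^^ n) ((f ^^ (m + k * n)) w)" unfolding S_def F_def by auto
    then have "w \<in> T" "z = (f ^^ (m + Suc k * n)) w"
      using funpow_apply_add[of n "m + k * n" f w] by (simp_all add: algebra_simps)
    then have "z \<in> F (Suc k)" unfolding F_def by blast
    then show "z \<in> S" unfolding S_def by blast
  qed
qed

lemma invariant_interval_no_orbit:
  assumes "is_interval S" "\<And>j. in_reg j S" "(f ^^ n) ` S \<subseteq> S" "0 < n"
  shows "X i \<notin> S"
proof
  assume i: "X i \<in> S"
  have "X (i + k * n) \<in> S" for k
  proof (induction k)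
    case (Suc k)
    have "X (i + Suc k * n) = (f ^^ n) (X (i + k * n))"
      using X_shift[of "i + k * n" n] by (simp add: algebra_simps)
    then show ?case using Suc assms(3) by auto
  qed (use i in simp)
  then show False using trap_interval assms(1,2,4) by blast
qed

lemma nonwandering_no_orbit:
  assumes "is_interval T" "\<And>j. in_reg j T"
    and "(f ^^ m) ` T \<inter> (f ^^ (m + n)) ` T \<noteq> {}" and n: "0 < n"
  shows "X i \<notin> T"
proof
  assume i: "X i \<in> T"
  obtain S where S: "is_interval S" "(f ^^ m) ` T \<subseteq> S" "\<And>j. in_reg j S" "(f ^^ n) ` S \<subseteq> S"
    using nonwandering_hull[OF assms(1-3)] by blast
  then have "X (i + m) \<in> S" using i X_shift by auto
  then show False using invariant_interval_no_orbit[OF S(1,3,4) n] by blast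
qed

lemma few_visits:
  assumes T: "is_interval T" "\<And>j. in_reg j T" and visits: "\<And>N. \<exists>n\<ge>N. X n \<in> T"
  shows False
proof -
  obtain i where i: "X i \<in> T" using visits by blast
  obtain j where j: "j \<ge> Suc i" "X j \<in> T" using visits by blast
  have "X j = (f ^^ (j - i)) (X i)" using X_shift[of i "j - i"] j by simp
  then have "(f ^^ 0) ` T \<inter> (f ^^ (0 + (j - i))) ` T \<noteq> {}"
    using i j by (metis IntI add_0 emptyE funpow_0 image_eqI)
  then show False using nonwandering_no_orbit[OF T] i j by (metis Suc_le_eq zero_less_diff)
qed

text \<open>The orbit of \<open>x\<close> avoids the invariant interval \<open>S\<close> but
  accumulates at every point of \<open>A\<close>. So points of \<open>A\<close> in \<open>S\<close>
  are endpoints of \<open>S\<close>, of which there are at most two, and \<open>y\<close> keeps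
  returning to them.\<close>

lemma nonwandering_finite_orbit:
  assumes "is_interval T" "\<And>j. in_reg j T"
    and "(f ^^ m) ` T \<inter> (f ^^ (m + n)) ` T \<noteq> {}" and n: "0 < n"
    and y: "y \<in> T" "y \<in> A"
  shows "finite (range (\<lambda>k. (f ^^ k) y))"
proof -
  obtain S where S: "is_interval S" "(f ^^ m) ` T \<subseteq> S" "\<And>j. in_reg j S" "(f ^^ n) ` S \<subseteq> S"
    using nonwandering_hull[OF assms(1-3)] by blast
  have no: "a \<notin> interior S" if "a \<in> A" for a
    using recurrent[OF that open_interior] invariant_interval_no_orbit[OF S(1,3,4) n]
      interior_subset by blast
  have inS: "(f ^^ (m + k * n)) y \<in> S" for k
  proof (induction k)
    case (Suc k)
    have "(f ^^ (m + Suc k * n)) y = (f ^^ n) ((f ^^ (m + k * n)) y)"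
      using funpow_apply_add[of n "m + k * n" f y] by (simp add: algebra_simps)
    then show ?case using Suc S(4) by auto
  qed (use y S(2) in auto)
  then have fin: "(f ^^ (m + k * n)) y \<in> S - interior S" for k
    using no iter_A[OF y(2)] by blast
  have "range (\<lambda>k. (f ^^ k) y) \<subseteq>
      (\<lambda>k. (f ^^ k) y) ` {..<m} \<union> (\<Union>r<n. (f ^^ r) ` (S - interior S))"
  proof
    fix z assume "z \<in> range (\<lambda>k. (f ^^ k) y)"
    then obtain k where k: "z = (f ^^ k) y" by auto
    show "z \<in> (\<lambda>k. (f ^^ k) y) ` {..<m} \<union> (\<Union>r<n. (f ^^ r) ` (S - interior S))"
    proof (cases "k < m")
      case False
      have "k = (k - m) mod n + (m + (k - m) div n * n)" using False by simp
      then have "z = (f ^^ ((k - m) mod n)) ((f ^^ (m + (k - m) div n * n)) y)"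
        unfolding k using funpow_apply_add by metis
      moreover have "(k - m) mod n < n" using n by simp
      ultimately show ?thesis using fin by blast
    qed (use k in auto)
  qed
  moreover have "finite \<dots>" using finite_interval_minus_interior[OF S(1)] by simp
  ultimately show ?thesis by (rule finite_subset)
qed

text \<open>If the images of the segment were pairwise disjoint, their total length would be finite, so by
  bounded distortion a slightly longer segment would stay small as well; but the latter contains a
  point of \<open>A\<close> in its interior and hence is revisited by the orbit of \<open>x\<close>.\<close>

lemma small_interval:
  assumes uv: "u < v" and small: "\<And>j. len j u v \<le> \<rho> / 2"
    and y: "y \<in> {u..v}" "y \<in> A"
  shows "finite (range (\<lambda>k. (f ^^ k) y)) \<and> (\<forall>i. X i \<notin> {u..v})"
proof -
  have reg: "in_reg n {u..v}" for n
    using in_regI[OF y(1) A_near[OF y(2)]] small rho by (smt (verit) field_sum_of_halves)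
  have "\<exists>i j. i < j \<and> (f ^^ i) ` {u..v} \<inter> (f ^^ j) ` {u..v} \<noteq> {}"
  proof (rule ccontr)
    assume no: "\<not> ?thesis"
    have sumM: "(\<Sum>j<n. len j u v) \<le> M" for n
    proof (rule sum_lengths_le_disjoint[OF uv reg])
      fix i j :: nat assume "i < j"
      then have "(f ^^ i) ` {u..v} \<inter> (f ^^ j) ` {u..v} = {}" using no by blast
      moreover have "{u<..<v} \<subseteq> {u..v}" by auto
      ultimately show "(f ^^ i) ` {u<..<v} \<inter> (f ^^ j) ` {u<..<v} = {}" by blast
    qed
    \<comment> \<open>Under distortion \<open>exp (C * (2 * M))\<close>, a piece of this relative
      length at either end has an image at most half as long as that of the segment. The longer
      segment therefore at most doubles at each time, which in turn gives the sum
      \<open>2 * M\<close> that the distortion bound needs.\<close>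
    define \<kappa> where "\<kappa> = exp (- C * (2 * M)) / 2"
    have k0: "\<kappa> > 0" unfolding \<kappa>_def by simp
    define u' v' where uv': "u' = u - \<kappa> * (v - u)" "v' = v + \<kappa> * (v - u)"
    have lt: "u' < u" "v < v'" using uv k0 unfolding uv' by auto
    have le2: "len n u' v' \<le> 2 * len n u v" for n
    proof (induction n rule: less_induct)
      case (less n)
      have reg': "in_reg n {u'..v'}"
      proof (rule in_regI)
        show "y \<in> {u'..v'}" using y(1) lt by auto
        show "len j u' v' \<le> \<rho>" if "j < n" for j
          using less[OF that] small[of j] by simp
      qed (use A_near y in auto)
      have "(\<Sum>j<n. len j u' v') \<le> (\<Sum>j<n. 2 * len j u v)"
        using less by (intro sum_mono) auto
      also have "\<dots> \<le> 2 * M" using sumM[of n] by (simp add: sum_distrib_left[symmetric])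
      finally have S: "(\<Sum>j<n. len j u' v') \<le> 2 * M" .
      have part: "len n w' w \<le> len n u v / 2"
        if w: "w' \<in> {u'..v'}" "w \<in> {u'..v'}" "\<bar>w' - w\<bar> = \<kappa> * (v - u)" for w w'
      proof -
        have "len n w' w * \<bar>u - v\<bar> \<le>
            exp (C * (2 * M)) * (len n u v * (\<kappa> * (v - u)))"
          using four_point[OF reg' S w(1,2), of u v] uv lt unfolding w(3) by auto
        also have "\<dots> = len n u v / 2 * \<bar>u - v\<bar>"
          using uv unfolding \<kappa>_def by (simp add: exp_minus field_simps)
        finally show ?thesis using uv by simp
      qed
      have ku: "\<kappa> * (v - u) > 0" using uv k0 by simp
      have "len n u' u \<le> len n u v / 2"
           "len n v' v \<le> len n u v / 2"
        using lt uv ku by (intro part; simp add: uv')+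
      then show ?case by (smt (verit) field_sum_of_halves)
    qed
    have reg': "in_reg n {u'..v'}" for n
    proof (rule in_regI)
      show "y \<in> {u'..v'}" using y(1) lt by auto
      show "len j u' v' \<le> \<rho>" for j
        using le2[of j] small[of j] by simp
    qed (use A_near y in auto)
    have "y \<in> {u'<..<v'}" using y(1) lt by auto
    then have "\<exists>n\<ge>N. X n \<in> {u'..v'}" for N
      using recurrent[OF y(2) open_greaterThanLessThan, of u' v' N] by (meson greaterThanLessThan_subseteq_atLeastAtMost_iff order_refl subsetD)
    then show False using few_visits[OF is_interval_cc reg'] by blast
  qed
  then obtain i j where ij: "i < j" "(f ^^ i) ` {u..v} \<inter> (f ^^ j) ` {u..v} \<noteq> {}" by blast
  then have "(f ^^ i) ` {u..v} \<inter> (f ^^ (i + (j - i))) ` {u..v} \<noteq> {}" "0 < j - i" by auto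
  then show ?thesis
    using nonwandering_no_orbit[OF is_interval_cc reg] nonwandering_finite_orbit[OF is_interval_cc reg _ _ y]
    by blast
qed

end

section \<open>Pulling back intervals along an orbit\<close>

context regular_orbit
begin

text \<open>All images of the segment are short and hence stay where \<open>f'\<close> does not vanish, so the condition
  on the endpoints says that \<open>f ^^ m\<close> maps \<open>{u..v}\<close> homeomorphically onto \<open>{p..q}\<close>.\<close>

definition pullback :: "nat \<Rightarrow> nat \<Rightarrow> real \<Rightarrow> real \<Rightarrow> real \<Rightarrow> real \<Rightarrow> bool" where
  "pullback i m u v p q \<longleftrightarrow> u < X i \<and> X i < v \<and> p < q \<and>
     (\<forall>j\<le>m. len j u v \<le> \<rho> / 2) \<and>
     ((f ^^ m) u = p \<and> (f ^^ m) v = q \<or> (f ^^ m) u = q \<and> (f ^^ m) v = p)"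

lemma small_in_reg:
  assumes "X i \<in> {u..v}" "\<And>j. j < m \<Longrightarrow> len j u v \<le> \<rho> / 2"
  shows "in_reg m {u..v}"
proof (rule in_regI[OF assms(1)])
  show "(f ^^ j) (X i) \<in> nhd A \<rho>" for j using near[of "i + j"] X_shift by simp
  show "len j u v \<le> \<rho>" if "j < m" for j using assms(2)[OF that] rho by linarith
qed

lemma pullback_reg: "pullback i m u v p q \<Longrightarrow> in_reg (Suc m) {u..v}"
  unfolding pullback_def by (intro small_in_reg[of i]) auto

lemma pullback_reg': "pullback i m u v p q \<Longrightarrow> j \<le> m \<Longrightarrow> in_reg j {u..v}"
  using pullback_reg in_reg_le le_SucI by blast

lemma pullback_less: "pullback i m u v p q \<Longrightarrow> u < v"
  unfolding pullback_def by linarith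

lemma pullback_image:
  assumes "pullback i m u v p q"
  shows "(f ^^ m) ` {u<..<v} = {p<..<q}"
proof -
  have "(f ^^ m) ` {u<..<v} = open_segment ((f ^^ m) u) ((f ^^ m) v)"
    using iter_open_segment[OF pullback_less[OF assms] pullback_reg'[OF assms]] by simp
  then show ?thesis using assms unfolding pullback_def open_segment_eq_real_ivl by auto
qed

lemma pullback_image_closed:
  assumes "pullback i m u v p q"
  shows "(f ^^ m) ` {u..v} = {p..q}"
proof -
  have "(f ^^ m) ` {u..v} = closed_segment ((f ^^ m) u) ((f ^^ m) v)"
    using iter_closed_segment[OF less_imp_le[OF pullback_less[OF assms]] pullback_reg'[OF assms]] by simp
  then show ?thesis using assms unfolding pullback_def closed_segment_eq_real_ivl by auto
qed

lemma pullback_length: "pullback i m u v p q \<Longrightarrow> len m u v = q - p"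
  unfolding pullback_def by auto

lemma pullback_0:
  assumes "X i \<in> {p<..<q}" "q - p \<le> \<rho> / 2"
  shows "pullback i 0 p q p q"
  using assms unfolding pullback_def by auto

lemma pullback_compose:
  assumes a: "pullback i m u v p q" and b: "pullback (i + m) n p q p' q'"
  shows "pullback i (m + n) u v p' q'"
proof -
  have e: "(f ^^ (m + k)) z = (f ^^ k) ((f ^^ m) z)" for k z
    using funpow_apply_add[of k m f z] by (simp add: add.commute)
  have "len j u v \<le> \<rho> / 2" if j: "j \<le> m + n" for j
  proof (cases "j \<le> m")
    case False
    then have "j = m + (j - m)" "j - m \<le> n" using j by auto
    then show ?thesis using e a b unfolding pullback_def by (metis abs_minus_commute)
  qed (use a in \<open>auto simp: pullback_def\<close>)
  then show ?thesis using a b e unfolding pullback_def by auto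
qed

lemma pullback_tail:
  assumes a: "pullback i m u v p q" and k: "k \<le> m"
  shows "pullback (i + k) (m - k) (min ((f ^^ k) u) ((f ^^ k) v)) (max ((f ^^ k) u) ((f ^^ k) v)) p q"
proof -
  have "X i \<in> {u<..<v}" using a unfolding pullback_def by auto
  then have "X (i + k) \<in> open_segment ((f ^^ k) u) ((f ^^ k) v)"
    using iter_open_segment[OF pullback_less[OF a] pullback_reg'[OF a k]] X_shift by blast
  moreover have e: "(f ^^ (k + j)) z = (f ^^ j) ((f ^^ k) z)" for j z
    using funpow_apply_add[of j k f z] by (simp add: add.commute)
  have "len j ((f ^^ k) u) ((f ^^ k) v) \<le> \<rho> / 2" if "j \<le> m - k" for j
    using a that k e unfolding pullback_def by (metis Nat.le_diff_conv2 add.commute)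
  moreover have "(f ^^ m) z = (f ^^ (m - k)) ((f ^^ k) z)" for z
    using e[of "m - k" z] k by simp
  ultimately show ?thesis using a unfolding pullback_def open_segment_eq_real_ivl min_def max_def
    by (auto split: if_splits simp: abs_minus_commute)
qed

lemma pullback_restrict:
  assumes a: "pullback i m u v p q" and p': "p \<le> p'" "p' < X (i + m)" and q': "X (i + m) < q'" "q' \<le> q"
  obtains u' v' where "u \<le> u'" "v' \<le> v" "pullback i m u' v' p' q'"
proof -
  have Xi: "X i \<in> {u..v}" "(f ^^ m) (X i) = X (i + m)" using a X_shift unfolding pullback_def by auto
  have "p' \<in> {p..q}" "q' \<in> {p..q}" using p' q' by auto
  then obtain w1 w2 where w: "w1 \<in> {u..v}" "w2 \<in> {u..v}" "(f ^^ m) w1 = p'" "(f ^^ m) w2 = q'"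
    using pullback_image_closed[OF a] by (metis imageE)
  have len: "len j z z' \<le> \<rho> / 2" if "j \<le> m" "z \<in> {u..v}" "z' \<in> {u..v}" for j z z'
    using iter_dist_le[OF pullback_reg'[OF a that(1)] that(2,3)] a that(1)
    unfolding pullback_def by (meson order_trans)
  from iter_monotone[OF is_interval_cc pullback_reg'[OF a order_refl]]
  show thesis
  proof
    assume mono: "\<forall>z\<in>{u..v}. \<forall>w\<in>{u..v}. z < w \<longrightarrow> (f ^^ m) z < (f ^^ m) w"
    have "w1 < X i" "X i < w2"
      using mono w Xi p' q' by (metis less_asym linorder_neqE_linordered_idom order_less_irrefl)+
    then have "pullback i m w1 w2 p' q'" using w p' q' len unfolding pullback_def by auto
    then show thesis using that w by auto
  next
    assume mono: "\<forall>z\<in>{u..v}. \<forall>w\<in>{u..v}. z < w \<longrightarrow> (f ^^ m) z > (f ^^ m) w"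
    have "w2 < X i" "X i < w1"
      using mono w Xi p' q' by (metis less_asym linorder_neqE_linordered_idom order_less_irrefl)+
    then have "pullback i m w2 w1 p' q'" using w p' q' len unfolding pullback_def by auto
    then show thesis using that w by auto
  qed
qed

text \<open>On the interval of radius \<open>\<rho> / 2\<close> about \<open>X i\<close> the map is
  injective and contracts distances at most by the factor \<open>c\<close>. Its image therefore
  extends at least \<open>c * (\<rho> / 2)\<close> to both sides of \<open>X (Suc i)\<close> and
  contains \<open>u\<close> and \<open>v\<close>.\<close>

lemma pullback_step:
  assumes a: "pullback (Suc i) m u v p q" and small: "v - u \<le> c * (\<rho> / 2)"
  obtains u' v' where "pullback i (Suc m) u' v' p q" "c * (v' - u') \<le> v - u"
    "f u' = u \<and> f v' = v \<or> f u' = v \<and> f v' = u"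
proof -
  note result = that
  define y r where "y = X i" and "r = \<rho> / 2"
  define I where "I = {y - r..y + r}"
  have r: "0 < r" using rho unfolding r_def by simp
  have fy: "f y = X (Suc i)" unfolding y_def by simp
  have inReg: "z \<in> Reg" if "z \<in> I" for z
  proof -
    obtain a where "a \<in> A" "\<bar>y - a\<bar> \<le> \<rho>" using near[of i] unfolding y_def nhd_def by auto
    moreover have "\<bar>z - y\<bar> \<le> \<rho>" using that r unfolding I_def r_def by auto
    ultimately show ?thesis unfolding nhd_def by force
  qed
  then have reg: "in_reg 1 I" unfolding in_reg_def by auto
  have exp_f: "c * \<bar>z - w\<bar> \<le> \<bar>f z - f w\<bar>" if "z \<in> I" "w \<in> I" for z w
  proof -
    obtain \<xi> where \<xi>: "\<xi> \<in> closed_segment z w" "f z - f w = (z - w) * f' \<xi>"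
      using iter_mvt[of z w 1] by (auto simp: Df_def)
    then have "\<xi> \<in> I" using that unfolding I_def closed_segment_eq_real_ivl by (auto split: if_splits)
    then have "c \<le> \<bar>f' \<xi>\<bar>" using lower inReg by blast
    then show ?thesis unfolding \<xi>(2) abs_mult by (subst mult.commute[of "\<bar>z - w\<bar>"]) (rule mult_right_mono, auto)
  qed
  have pts: "y \<in> I" "y - r \<in> I" "y + r \<in> I" using r unfolding I_def by auto
  have img: "f ` I = closed_segment (f (y - r)) (f (y + r))"
    using iter_closed_segment[of "y - r" "y + r" 1] reg r unfolding I_def by simp
  have far: "c * r \<le> \<bar>f (y - r) - f y\<bar>" "c * r \<le> \<bar>f (y + r) - f y\<bar>"
    using exp_f[of "y - r" y] exp_f[of "y + r" y] pts r by auto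
  have uv: "u < f y" "f y < v" "v - u \<le> c * r"
    using a small unfolding pullback_def fy r_def by auto
  have fin: thesis
    if "w \<in> I" "w' \<in> I" "w < y" "y < w'" "f w = u \<and> f w' = v \<or> f w = v \<and> f w' = u" for w w'
  proof -
    have cw: "c * (w' - w) \<le> v - u" using exp_f[of w w'] that uv by auto
    then have "c * (w' - w) \<le> c * r" using uv by linarith
    then have len: "w' - w \<le> \<rho> / 2" using c_pos unfolding r_def by simp
    have "len j w w' \<le> \<rho> / 2" if "j \<le> Suc m" for j
    proof (cases j)
      case (Suc k)
      then have "len k u v \<le> \<rho> / 2" using a that unfolding pullback_def by auto
      then show ?thesis using \<open>f w = u \<and> f w' = v \<or> f w = v \<and> f w' = u\<close> Suc
        by (auto simp del: funpow.simps simp add: funpow_Suc_right abs_minus_commute)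
    qed (use len \<open>w < y\<close> \<open>y < w'\<close> in auto)
    moreover have "(f ^^ Suc m) w = (f ^^ m) (f w)" "(f ^^ Suc m) w' = (f ^^ m) (f w')"
      by (simp_all del: funpow.simps add: funpow_Suc_right)
    ultimately have "pullback i (Suc m) w w' p q"
      using a that unfolding pullback_def y_def by auto
    then show thesis using \<open>f w = u \<and> f w' = v \<or> f w = v \<and> f w' = u\<close> cw by (intro result)
  qed
  have "is_interval I" unfolding I_def by (rule is_interval_cc)
  from iter_monotone[OF this reg]
  consider "\<forall>z\<in>I. \<forall>w\<in>I. z < w \<longrightarrow> f z < f w" | "\<forall>z\<in>I. \<forall>w\<in>I. z < w \<longrightarrow> f z > f w" by auto
  then show thesis
  proof cases
    case 1
    then have "f (y - r) < f y" "f y < f (y + r)" using pts r by auto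
    then have "u \<in> f ` I" "v \<in> f ` I" unfolding img using far uv
      by (auto simp: closed_segment_eq_real_ivl)
    then obtain w w' where w: "w \<in> I" "w' \<in> I" "f w = u" "f w' = v" by auto
    then have "w < y" "y < w'"
      using 1 pts uv by (metis less_asym linorder_neqE_linordered_idom)+
    then show thesis using fin w by blast
  next
    case 2
    then have "f (y - r) > f y" "f y > f (y + r)" using pts r by auto
    then have "u \<in> f ` I" "v \<in> f ` I" unfolding img using far uv
      by (auto simp: closed_segment_eq_real_ivl)
    then obtain w w' where w: "w \<in> I" "w' \<in> I" "f w = v" "f w' = u" by auto
    then have "w < y" "y < w'"
      using 2 pts uv by (metis less_asym linorder_neqE_linordered_idom)+
    then show thesis using fin w by blast
  qed
qed

section \<open>Limits of long pullbacks\<close>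

lemma expand_bound:
  assumes "in_reg m {u..v}" "u \<le> v"
  shows "c ^ m * (v - u) \<le> len m u v"
proof -
  obtain \<xi> where \<xi>: "\<xi> \<in> closed_segment u v" "(f ^^ m) u - (f ^^ m) v = (u - v) * Df m \<xi>"
    using iter_mvt by blast
  have x: "\<xi> \<in> {u..v}" using \<xi>(1) assms(2) by (simp add: closed_segment_eq_real_ivl)
  have "c ^ m = (\<Prod>i<m. c)" by simp
  also have "\<dots> \<le> (\<Prod>i<m. \<bar>f' ((f ^^ i) \<xi>)\<bar>)"
    using assms(1) x c_pos unfolding in_reg_def
    by (intro prod_mono) (auto intro!: lower simp: image_subset_iff)
  finally have "c ^ m \<le> \<bar>Df m \<xi>\<bar>" by (simp add: Df_def abs_prod)
  then have "c ^ m * \<bar>u - v\<bar> \<le> \<bar>Df m \<xi>\<bar> * \<bar>u - v\<bar>" by (rule mult_right_mono) simp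
  then show ?thesis using assms(2) unfolding \<xi>(2) abs_mult by (simp add: mult.commute)
qed

text \<open>Compactness: intervals of definite length whose images stay short for longer and longer
  times accumulate on an interval whose images are short forever, as required by
  \<open>small_interval\<close>.\<close>

lemma small_limit:
  fixes i n :: "nat \<Rightarrow> nat" and u v :: "nat \<Rightarrow> real"
  assumes Xi: "\<And>k. u k < X (i k)" "\<And>k. X (i k) < v k"
    and small: "\<And>k j. j \<le> n k \<Longrightarrow> len j (u k) (v k) \<le> \<rho> / 2"
    and long: "\<And>k. \<eta> \<le> v k - u k" and eta: "0 < \<eta>"
    and n: "filterlim n at_top sequentially"
  shows "\<exists>h a b y. strict_mono (h :: nat \<Rightarrow> nat) \<and> (\<lambda>k. u (h k)) \<longlonglongrightarrow> a \<and> (\<lambda>k. v (h k)) \<longlonglongrightarrow> b \<and>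
    (\<lambda>k. X (i (h k))) \<longlonglongrightarrow> y \<and> a < b \<and> y \<in> {a..b} \<and> (\<forall>j. len j a b \<le> \<rho> / 2)"
proof -
  have "(u k, v k, X (i k)) \<in> Reg \<times> Reg \<times> Reg" for k
  proof -
    obtain a where a: "a \<in> A" "\<bar>X (i k) - a\<bar> \<le> \<rho>" using near[of "i k"] unfolding nhd_def by auto
    have "v k - u k \<le> \<rho> / 2" using small[of 0 k] Xi[of k] by auto
    then have "\<bar>u k - a\<bar> \<le> 2 * \<rho>" "\<bar>v k - a\<bar> \<le> 2 * \<rho>" "\<bar>X (i k) - a\<bar> \<le> 2 * \<rho>"
      using a(2) Xi[of k] rho by linarith+
    then show ?thesis using a(1) unfolding nhd_def by auto
  qed
  moreover have "compact (Reg \<times> Reg \<times> Reg)"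
    by (intro compact_Times compact_nhd compact_A)
  ultimately obtain l h where h: "strict_mono (h :: nat \<Rightarrow> nat)"
      "((\<lambda>k. (u k, v k, X (i k))) \<circ> h) \<longlonglongrightarrow> l"
    unfolding compact_def by meson
  define a b y where "a = fst l" "b = fst (snd l)" "y = snd (snd l)"
  have lim: "(\<lambda>k. u (h k)) \<longlonglongrightarrow> a" "(\<lambda>k. v (h k)) \<longlonglongrightarrow> b" "(\<lambda>k. X (i (h k))) \<longlonglongrightarrow> y"
    using tendsto_fst[OF h(2)] tendsto_fst[OF tendsto_snd[OF h(2)]] tendsto_snd[OF tendsto_snd[OF h(2)]]
    unfolding a_b_y_def by (simp_all add: o_def)
  have "a \<le> y" "y \<le> b"
    using LIMSEQ_le[OF lim(1,3)] LIMSEQ_le[OF lim(3,2)] Xi less_imp_le by blast+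
  moreover have "\<eta> \<le> b - a"
    using tendsto_lowerbound[OF tendsto_diff[OF lim(2,1)]] long by auto
  moreover have "len j a b \<le> \<rho> / 2" for j
  proof (rule tendsto_upperbound)
    show "(\<lambda>k. len j (u (h k)) (v (h k))) \<longlonglongrightarrow> len j a b"
      using lim by (intro tendsto_intros tendsto_iter)
    have "filterlim (\<lambda>k. n (h k)) at_top sequentially"
      using filterlim_compose[OF n filterlim_subseq[OF h(1)]] by simp
    then have "eventually (\<lambda>k. j \<le> n (h k)) sequentially"
      by (simp add: filterlim_at_top)
    then show "eventually (\<lambda>k. len j (u (h k)) (v (h k)) \<le> \<rho> / 2) sequentially"
      by eventually_elim (rule small)
  qed simp
  ultimately have "a < b" "y \<in> {a..b}" "\<forall>j. len j a b \<le> \<rho> / 2"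
    using eta by auto
  then show ?thesis using h(1) lim by blast
qed

lemma limit_in_A:
  assumes "filterlim i at_top sequentially" "(\<lambda>k. X (i k)) \<longlonglongrightarrow> y"
  shows "y \<in> A"
proof -
  have "\<exists>n\<ge>N. \<bar>X n - y\<bar> < e" if "e > 0" for e N
  proof -
    have "eventually (\<lambda>k. dist (X (i k)) y < e) sequentially" using assms(2) that tendstoD by blast
    moreover have "eventually (\<lambda>k. N \<le> i k) sequentially" using assms(1) by (simp add: filterlim_at_top)
    ultimately have "eventually (\<lambda>k. dist (X (i k)) y < e \<and> N \<le> i k) sequentially"
      by (rule eventually_conj)
    then show ?thesis by (auto simp: eventually_sequentially dist_real_def)
  qed
  then show ?thesis using omega_limitI omega by blast
qed

text \<open>The pullbacks converge to an interval to which \<open>small_interval\<close> applies and which the orbit of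
  \<open>x\<close> avoids, so the limit of the points \<open>X (i k)\<close> is an endpoint of it.\<close>

lemma long_pullbacks:
  fixes i n :: "nat \<Rightarrow> nat" and u v :: "nat \<Rightarrow> real"
  assumes Xi: "\<And>k. u k < X (i k)" "\<And>k. X (i k) < v k"
    and small: "\<And>k j. j \<le> n k \<Longrightarrow> len j (u k) (v k) \<le> \<rho> / 2"
    and long: "\<And>k. \<eta> \<le> v k - u k" and eta: "0 < \<eta>"
    and n: "filterlim n at_top sequentially" and i: "filterlim i at_top sequentially"
  shows "\<exists>h y. strict_mono (h :: nat \<Rightarrow> nat) \<and> (\<lambda>k. X (i (h k))) \<longlonglongrightarrow> y \<and> y \<in> A \<and>
    finite (range (\<lambda>k. (f ^^ k) y)) \<and> (\<forall>k. u (h k) < y \<and> y < v (h k))"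
proof -
  obtain h a b y where h: "strict_mono (h :: nat \<Rightarrow> nat)" "(\<lambda>k. u (h k)) \<longlonglongrightarrow> a" "(\<lambda>k. v (h k)) \<longlonglongrightarrow> b"
    "(\<lambda>k. X (i (h k))) \<longlonglongrightarrow> y" "a < b" "y \<in> {a..b}" "\<And>j. len j a b \<le> \<rho> / 2"
    using small_limit[where i = i and n = n and u = u and v = v and \<eta> = \<eta>, OF Xi small long eta n] by blast
  have "filterlim (\<lambda>k. i (h k)) at_top sequentially"
    using filterlim_compose[OF i filterlim_subseq[OF h(1)]] by simp
  then have yA: "y \<in> A" using limit_in_A h(4) by blast
  have fin: "finite (range (\<lambda>k. (f ^^ k) y))" and no: "\<And>i. X i \<notin> {a..b}"
    using small_interval[OF h(5,7) h(6) yA] by auto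
  have "eventually (\<lambda>k. u (h k) < b \<and> a < v (h k) \<and> X (i (h k)) \<notin> {a..b} \<and>
      (a < y \<longrightarrow> a < X (i (h k))) \<and> (y < b \<longrightarrow> X (i (h k)) < b)) sequentially"
    using order_tendstoD(2)[OF h(2,5)] order_tendstoD(1)[OF h(3,5)]
      order_tendstoD(1)[OF h(4), of a] order_tendstoD(2)[OF h(4), of b] no
    by (intro eventually_conj) (auto elim: eventually_mono)
  then have "eventually (\<lambda>k. u (h k) < y \<and> y < v (h k)) sequentially"
  proof eventually_elim
    case (elim k)
    then show ?case using h(5,6) Xi[of "h k"] by auto
  qed
  then obtain K where K: "\<And>k. k \<ge> K \<Longrightarrow> u (h k) < y \<and> y < v (h k)"
    by (auto simp: eventually_sequentially)
  show ?thesis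
  proof (intro exI[of _ "\<lambda>k. h (k + K)"] exI[of _ y] conjI)
    show "strict_mono (\<lambda>k. h (k + K))" using h(1) by (simp add: strict_mono_def)
    show "(\<lambda>k. X (i (h (k + K)))) \<longlonglongrightarrow> y" using h(4) LIMSEQ_ignore_initial_segment by fastforce
  qed (use yA fin K in auto)
qed

text \<open>One step shortens an interval at most by the factor \<open>c\<close>, so it takes many
  steps to make a long interval short.\<close>

lemma times_unbounded:
  fixes n :: "nat \<Rightarrow> nat"
  assumes reg: "\<And>k. in_reg (n k) {u k..v k}" and long: "\<And>k. \<eta> \<le> v k - u k" and eta: "0 < \<eta>"
    and small: "(\<lambda>k. len (n k) (u k) (v k)) \<longlonglongrightarrow> 0"
  shows "filterlim n at_top sequentially"
  unfolding filterlim_at_top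
proof
  fix N
  have "0 < c ^ N * \<eta>" using c_pos eta by simp
  then have "eventually (\<lambda>k. len (n k) (u k) (v k) < c ^ N * \<eta>) sequentially"
    using small order_tendstoD(2) by blast
  then show "eventually (\<lambda>k. N \<le> n k) sequentially"
  proof eventually_elim
    case (elim k)
    show ?case
    proof (rule ccontr)
      assume "\<not> N \<le> n k"
      then have "c ^ N \<le> c ^ n k" using c_pos c_le by (intro power_decreasing) auto
      then have "c ^ N * \<eta> \<le> c ^ n k * (v k - u k)"
        using long[of k] eta c_pos by (intro mult_mono) auto
      also have "\<dots> \<le> len (n k) (u k) (v k)"
        using expand_bound[OF reg] long[of k] eta by simp
      finally show False using elim by simp
    qed
  qed
qed

text \<open>Go back from time \<open>n\<close> as long as the pullbacks have length at most
  \<open>\<eta>\<close>. The first longer one still exists, because the one after it in time is at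
  most \<open>c * (\<rho> / 2)\<close> long.\<close>

lemma pullback_failure:
  assumes n: "X n \<in> {p<..<q}" "q - p \<le> \<eta>" "\<eta> \<le> c * (\<rho> / 2)" and i: "i \<le> n"
    and no: "\<nexists>u v. pullback i (n - i) u v p q \<and> v - u \<le> \<eta>"
  shows "\<exists>j m u v. i \<le> j \<and> j + m = n \<and> pullback j m u v p q \<and> \<eta> < v - u"
proof (rule ccontr)
  assume no2: "\<not> ?thesis"
  have "c * (\<rho> / 2) \<le> \<rho> / 2" using c_pos c_le rho by (intro mult_left_le_one_le) auto
  then have small: "q - p \<le> \<rho> / 2" using n by linarith
  have "\<exists>u v. pullback j (n - j) u v p q \<and> v - u \<le> \<eta>" if "i \<le> j" "j \<le> n" for j
    using that(2,1)
  proof (induction j rule: inc_induct)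
    case base
    show ?case using pullback_0[OF n(1) small] n(2) by auto
  next
    case (step j)
    then obtain u v where uv: "pullback (Suc j) (n - Suc j) u v p q" "v - u \<le> \<eta>" by auto
    then have "v - u \<le> c * (\<rho> / 2)" using n(3) by linarith
    then obtain u' v' where "pullback j (Suc (n - Suc j)) u' v' p q"
      using pullback_step[OF uv(1)] by metis
    moreover have "Suc (n - Suc j) = n - j" "j + (n - j) = n" using step by simp_all
    ultimately show ?case using no2 step by (metis not_le)
  qed
  then show False using no i by blast
qed

text \<open>Otherwise long pullbacks of infinitely many targets, starting at times tending to
  infinity, would accumulate at a point \<open>y\<close> of \<open>A\<close> with finite orbit that
  lies inside all of them. That finite orbit would meet infinitely many targets, although each of
  its points lies in finitely many only.\<close>

lemma pullbacks_exist:
  fixes p q :: "nat \<Rightarrow> real"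
  assumes pq: "\<And>k. p k < q k" and lim: "(\<lambda>k. q k - p k) \<longlonglongrightarrow> 0"
    and fin: "\<And>z. finite {k. p k < z \<and> z < q k}"
  obtains k where "\<And>i n. k \<le> i \<Longrightarrow> i \<le> n \<Longrightarrow> X n \<in> {p k<..<q k} \<Longrightarrow>
    \<exists>u v. pullback i (n - i) u v (p k) (q k) \<and> v - u \<le> c * (\<rho> / 2)"
proof -
  define \<epsilon> where "\<epsilon> = c * (\<rho> / 2)"
  have e: "0 < \<epsilon>" "\<epsilon> \<le> \<rho> / 2" using c_pos c_le rho unfolding \<epsilon>_def by (auto intro: mult_left_le_one_le)
  let ?ok = "\<lambda>k i n. \<exists>u v. pullback i (n - i) u v (p k) (q k) \<and> v - u \<le> \<epsilon>"
  show thesis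
  proof (rule ccontr)
    assume no: "\<not> thesis"
    have bad: "\<exists>i n. k \<le> i \<and> i \<le> n \<and> X n \<in> {p k<..<q k} \<and> \<not> ?ok k i n" for k
      using that[of k] no unfolding \<epsilon>_def by blast
    have step: "\<exists>i m u v. k \<le> i \<and> pullback i m u v (p k) (q k) \<and> \<epsilon> < v - u" if sm: "q k - p k \<le> \<epsilon>" for k
    proof -
      obtain i n where i: "k \<le> i" "i \<le> n" "X n \<in> {p k<..<q k}" "\<not> ?ok k i n" using bad by blast
      show ?thesis using pullback_failure[OF i(3) sm _ i(2,4)] i(1) unfolding \<epsilon>_def by (meson le_trans order_refl)
    qed
    have "eventually (\<lambda>k. q k - p k < \<epsilon>) sequentially" using order_tendstoD(2)[OF lim e(1)] .
    then obtain K where K: "\<And>k. k \<ge> K \<Longrightarrow> q k - p k \<le> \<epsilon>"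
      unfolding eventually_sequentially using less_imp_le by blast
    then have "\<forall>k. \<exists>i m u v. k + K \<le> i \<and> pullback i m u v (p (k + K)) (q (k + K)) \<and> \<epsilon> < v - u"
      using step by simp
    then obtain i m u v where
      *: "\<And>k. k + K \<le> i k" "\<And>k. pullback (i k) (m k) (u k) (v k) (p (k + K)) (q (k + K))"
         "\<And>k. \<epsilon> < v k - u k"
      by metis
    have m: "filterlim m at_top sequentially"
    proof (rule times_unbounded)
      show "in_reg (m k) {u k..v k}" for k using pullback_reg'[OF *(2)] by simp
      have "(\<lambda>k. q (k + K) - p (k + K)) \<longlonglongrightarrow> 0" using lim by (rule LIMSEQ_ignore_initial_segment)
      then show "(\<lambda>k. len (m k) (u k) (v k)) \<longlonglongrightarrow> 0"
        using pullback_length[OF *(2)] by simp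
    qed (use *(3) e(1) less_imp_le in auto)
    have it: "filterlim i at_top sequentially"
    proof (rule filterlim_at_top_mono[OF filterlim_ident])
      show "eventually (\<lambda>k. k \<le> i k) sequentially"
        using *(1) by (intro always_eventually) (meson le_add1 le_trans)
    qed
    have "\<exists>h y. strict_mono (h :: nat \<Rightarrow> nat) \<and> (\<lambda>k. X (i (h k))) \<longlonglongrightarrow> y \<and> y \<in> A \<and>
      finite (range (\<lambda>k. (f ^^ k) y)) \<and> (\<forall>k. u (h k) < y \<and> y < v (h k))"
    proof (rule long_pullbacks[where i = i and n = m and u = u and v = v and \<eta> = \<epsilon>])
      show "u k < X (i k)" "X (i k) < v k" for k using *(2) unfolding pullback_def by auto
      show "len j (u k) (v k) \<le> \<rho> / 2" if "j \<le> m k" for k j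
        using *(2) that unfolding pullback_def by auto
      show "\<epsilon> \<le> v k - u k" for k using *(3)[of k] by simp
    qed (use e(1) m it in auto)
    then obtain h y where h: "strict_mono (h :: nat \<Rightarrow> nat)" "finite (range (\<lambda>k. (f ^^ k) y))"
        "\<And>k. u (h k) < y \<and> y < v (h k)" by blast
    have "(f ^^ m (h k)) y \<in> {p (h k + K)<..<q (h k + K)}" for k
    proof -
      have "y \<in> {u (h k)<..<v (h k)}" using h(3) by simp
      then show ?thesis using pullback_image[OF *(2)[of "h k"]] by (metis imageI)
    qed
    then have "range h \<subseteq> (\<Union>z\<in>range (\<lambda>k. (f ^^ k) y). {k. p (k + K) < z \<and> z < q (k + K)})"
      by force
    moreover have "finite {k. p (k + K) < z \<and> z < q (k + K)}" for z
    proof -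
      have "finite ((\<lambda>k. k + K) -` {k. p k < z \<and> z < q k})"
        using fin by (intro finite_vimageI) auto
      then show ?thesis by (simp add: vimage_def)
    qed
    ultimately have "finite (range h)" using h(2) by (meson finite_UN_I finite_subset)
    then show False using h(1) by (metis finite_imageD infinite_UNIV_nat strict_mono_imp_inj_on)
  qed
qed

end

section \<open>Nice intervals\<close>

lemma strictly_monotone_sequence:
  fixes A :: "real set"
  assumes "infinite A"
  obtains b :: "nat \<Rightarrow> real" where "range b \<subseteq> A"
    "(\<forall>m n. m < n \<longrightarrow> b m < b n) \<or> (\<forall>m n. m < n \<longrightarrow> b n < b m)"
proof -
  obtain s :: "nat \<Rightarrow> real" where s: "range s \<subseteq> A" "inj s"
    using infinite_countable_subset[OF assms] by blast
  obtain h where h: "strict_mono h" "monoseq (\<lambda>n. s (h n))" using seq_monosub by blast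
  have inj: "inj (\<lambda>n. s (h n))"
    using inj_compose[OF s(2) strict_mono_imp_inj_on[OF h(1)]] by (simp add: o_def)
  have "(\<forall>m n. m < n \<longrightarrow> s (h m) < s (h n)) \<or> (\<forall>m n. m < n \<longrightarrow> s (h n) < s (h m))"
    using h(2) inj unfolding monoseq_def inj_def by (metis less_le nat_less_le)
  then show thesis using that[of "\<lambda>n. s (h n)"] s(1) by blast
qed

lemma finite_if_unique:
  assumes "\<And>k k'. k \<in> S \<Longrightarrow> k' \<in> S \<Longrightarrow> k = k'"
  shows "finite S"
proof (cases "S = {}")
  case False
  then obtain k where "k \<in> S" by blast
  then have "S \<subseteq> {k}" using assms by blast
  then show ?thesis using finite_subset by blast
qed simp

text \<open>Consecutive blocks of a strictly monotone sequence in \<open>A\<close>, sharing their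
  end points, so that the open hulls are disjoint. Five points leave room to choose points with
  finite orbit near the second and the fourth, on either side of the third and inside the
  hull.\<close>

lemma shrinking_quintuples:
  fixes A :: "real set"
  assumes inf: "infinite A" and bdd: "bounded A"
  obtains g :: "nat \<Rightarrow> nat \<Rightarrow> real" where "\<And>k j. j \<le> 4 \<Longrightarrow> g k j \<in> A"
    "\<And>k i j. i < j \<Longrightarrow> j \<le> 4 \<Longrightarrow> g k i < g k j"
    "\<And>z. finite {k. g k 0 < z \<and> z < g k 4}" "(\<lambda>k. g k 4 - g k 0) \<longlonglongrightarrow> 0"
proof -
  obtain b :: "nat \<Rightarrow> real" where b: "range b \<subseteq> A"
    "(\<forall>m n. m < n \<longrightarrow> b m < b n) \<or> (\<forall>m n. m < n \<longrightarrow> b n < b m)"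
    using strictly_monotone_sequence[OF inf] by blast
  have "Bseq b"
  proof -
    obtain B where "\<And>z. z \<in> A \<Longrightarrow> norm z \<le> B" using bdd unfolding bounded_iff by blast
    then show ?thesis using b(1) by (intro BseqI') blast
  qed
  moreover have "monoseq b"
    using b(2) unfolding monoseq_def by (metis le_less order_refl)
  ultimately obtain l where l: "b \<longlonglongrightarrow> l" using Bseq_monoseq_convergent convergent_def by blast
  have lim: "(\<lambda>k. b (4 * k + j)) \<longlonglongrightarrow> l" for j
  proof -
    have "strict_mono (\<lambda>k. 4 * k + j)" by (simp add: strict_mono_def)
    then show ?thesis using LIMSEQ_subseq_LIMSEQ[OF l] by (simp add: o_def)
  qed
  from b(2) show thesis
  proof
    assume mono: "\<forall>m n. m < n \<longrightarrow> b m < b n"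
    show thesis
    proof (rule that[of "\<lambda>k j. b (4 * k + j)"])
      fix z
      show "finite {k. b (4 * k + 0) < z \<and> z < b (4 * k + 4)}"
      proof (rule finite_if_unique)
        have le: "k \<le> k'" if "b (4 * k + 0) < z" "z < b (4 * k' + 4)" for k k'
        proof (rule ccontr)
          assume "\<not> k \<le> k'"
          then have "4 * k' + 4 \<le> 4 * k" by simp
          then have "b (4 * k' + 4) \<le> b (4 * k)" using mono by (metis le_less)
          then show False using that by simp
        qed
        show "k = k'" if "k \<in> {k. b (4 * k + 0) < z \<and> z < b (4 * k + 4)}"
          "k' \<in> {k. b (4 * k + 0) < z \<and> z < b (4 * k + 4)}" for k k'
          using that le by (intro antisym) auto
      qed
    qed (use b(1) mono tendsto_diff[OF lim[of 4] lim[of 0]] in auto)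
  next
    assume mono: "\<forall>m n. m < n \<longrightarrow> b n < b m"
    show thesis
    proof (rule that[of "\<lambda>k j. b (4 * k + (4 - j))"])
      fix z
      show "finite {k. b (4 * k + (4 - 0)) < z \<and> z < b (4 * k + (4 - 4))}"
      proof (rule finite_if_unique)
        have le: "k \<ge> k'" if "b (4 * k + 4) < z" "z < b (4 * k')" for k k'
        proof (rule ccontr)
          assume "\<not> k \<ge> k'"
          then have "4 * k + 4 \<le> 4 * k'" by simp
          then have "b (4 * k') \<le> b (4 * k + 4)" using mono by (metis le_less)
          then show False using that by simp
        qed
        show "k = k'" if "k \<in> {k. b (4 * k + (4 - 0)) < z \<and> z < b (4 * k + (4 - 4))}"
          "k' \<in> {k. b (4 * k + (4 - 0)) < z \<and> z < b (4 * k + (4 - 4))}" for k k'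
          using that le by (intro antisym) auto
      qed
    qed (use b(1) mono tendsto_diff[OF lim[of 0] lim[of 4]] in auto)
  qed
qed

lemma finite_orbit_funpow:
  assumes "finite (range (\<lambda>k. (f ^^ k) ((f ^^ m) z)))"
  shows "finite (range (\<lambda>k. (f ^^ k) z))"
proof (rule finite_subset)
  show "range (\<lambda>k. (f ^^ k) z) \<subseteq> (\<lambda>k. (f ^^ k) z) ` {..<m} \<union> range (\<lambda>k. (f ^^ k) ((f ^^ m) z))"
  proof
    fix w assume "w \<in> range (\<lambda>k. (f ^^ k) z)"
    then obtain k where k: "w = (f ^^ k) z" by auto
    show "w \<in> (\<lambda>k. (f ^^ k) z) ` {..<m} \<union> range (\<lambda>k. (f ^^ k) ((f ^^ m) z))"
    proof (cases "k < m")
      case False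
      then have "w = (f ^^ (k - m)) ((f ^^ m) z)" using k funpow_apply_add[of "k - m" m f z] by simp
      then show ?thesis by blast
    qed (use k in auto)
  qed
  show "finite ((\<lambda>k. (f ^^ k) z) ` {..<m} \<union> range (\<lambda>k. (f ^^ k) ((f ^^ m) z)))"
    using assms by simp
qed

lemma finite_orbit_periodic:
  assumes "(f ^^ m) z = z" "0 < m"
  shows "finite (range (\<lambda>k. (f ^^ k) z))"
proof -
  have "(f ^^ k) z = (f ^^ (k mod m)) z" for k
    using funpow_mod_eq[OF assms(1)] by simp
  then have "range (\<lambda>k. (f ^^ k) z) \<subseteq> (\<lambda>k. (f ^^ k) z) ` {..<m}"
    using assms(2) by (metis (no_types, lifting) image_eqI image_subsetI lessThan_iff mod_less_divisor)
  then show ?thesis using finite_subset by blast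
qed

context regular_orbit
begin

abbreviation "finite_orbit z \<equiv> finite (range (\<lambda>k. (f ^^ k) z))"

lemma orbit_infinite: "\<not> finite_orbit (X i)"
proof
  assume fin: "finite_orbit (X i)"
  have "A \<subseteq> range (\<lambda>k. (f ^^ k) (X i))"
  proof
    fix a assume a: "a \<in> A"
    show "a \<in> range (\<lambda>k. (f ^^ k) (X i))"
    proof (rule ccontr)
      assume "a \<notin> range (\<lambda>k. (f ^^ k) (X i))"
      moreover have "open (- range (\<lambda>k. (f ^^ k) (X i)))"
        using finite_imp_closed[OF fin] by (rule open_Compl)
      ultimately obtain n where n: "n \<ge> i" "X n \<in> - range (\<lambda>k. (f ^^ k) (X i))"
        using recurrent[OF a, of _ i] by blast
      have "X n = (f ^^ (n - i)) (X i)" using X_shift[of i "n - i"] n(1) by simp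
      then show False using n(2) by blast
    qed
  qed
  then show False using fin infinite_A finite_subset by blast
qed

text \<open>Take pullbacks along times \<open>i j\<close> with \<open>X (i j)\<close> tending to
  \<open>a\<close> and with more than \<open>j\<close> steps. If none fits into the
  \<open>r\<close>-neighbourhood of \<open>a\<close>, then all are at least \<open>r / 2\<close>
  long, and \<open>long_pullbacks\<close> shows that the limit \<open>a\<close> has a finite orbit.
  The pullback found need not contain \<open>a\<close>.\<close>

lemma pullback_near:
  assumes PE: "\<And>i n. k0 \<le> i \<Longrightarrow> i \<le> n \<Longrightarrow> X n \<in> {p<..<q} \<Longrightarrow> \<exists>u v. pullback i (n - i) u v p q"
    and visit: "\<And>N. \<exists>n\<ge>N. X n \<in> {p<..<q}"
    and a: "a \<in> A" and r: "0 < r"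
  shows "finite_orbit a \<or> (\<exists>i m u v. 0 < m \<and> pullback i m u v p q \<and> a - r < u \<and> v < a + r)"
proof (rule ccontr)
  assume no: "\<not> ?thesis"
  have "\<forall>j. \<exists>i m u v. k0 + j \<le> i \<and> \<bar>X i - a\<bar> < min (r / 2) (inverse (real (Suc j))) \<and> j < m \<and>
      pullback i m u v p q"
  proof
    fix j
    let ?e = "min (r / 2) (inverse (real (Suc j)))"
    have "0 < ?e" using r by simp
    then obtain i where i: "i \<ge> k0 + j" "X i \<in> ball a ?e"
      using recurrent[OF a open_ball centre_in_ball[THEN iffD2]] by blast
    obtain n where n: "n \<ge> i + Suc j" "X n \<in> {p<..<q}" using visit by blast
    obtain u v where "pullback i (n - i) u v p q" using PE[of i n] i n by auto
    moreover have "j < n - i" using n by simp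
    ultimately show "\<exists>i m u v. k0 + j \<le> i \<and> \<bar>X i - a\<bar> < ?e \<and> j < m \<and> pullback i m u v p q"
      using i by (metis abs_minus_commute dist_real_def mem_ball)
  qed
  then obtain i m u v where *: "\<And>j. k0 + j \<le> i j" "\<And>j. \<bar>X (i j) - a\<bar> < min (r / 2) (inverse (real (Suc j)))"
      "\<And>j. j < m j" "\<And>j. pullback (i j) (m j) (u j) (v j) p q"
    by metis
  have up: "filterlim g at_top sequentially" if "\<And>j. j \<le> g j" for g :: "nat \<Rightarrow> nat"
    by (rule filterlim_at_top_mono[OF filterlim_ident]) (use that in auto)
  have "(\<lambda>j. X (i j) - a) \<longlonglongrightarrow> 0"
    using *(2) by (intro Lim_null_comparison[OF _ LIMSEQ_inverse_real_of_nat] always_eventually)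
      (auto simp: real_norm_def less_imp_le)
  then have lim: "(\<lambda>j. X (i j)) \<longlonglongrightarrow> a" by (simp add: LIM_zero_iff)
  have "\<exists>h y. strict_mono (h :: nat \<Rightarrow> nat) \<and> (\<lambda>k. X (i (h k))) \<longlonglongrightarrow> y \<and> y \<in> A \<and>
      finite_orbit y \<and> (\<forall>k. u (h k) < y \<and> y < v (h k))"
  proof (rule long_pullbacks[where i = i and n = m and u = u and v = v and \<eta> = "r / 2"])
    fix k
    show "u k < X (i k)" "X (i k) < v k" using *(4) unfolding pullback_def by auto
    show "len j (u k) (v k) \<le> \<rho> / 2" if "j \<le> m k" for j
      using *(4) that unfolding pullback_def by auto
    have "\<not> (a - r < u k \<and> v k < a + r)" using no *(3,4) by (metis gr_zeroI not_less_zero)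
    moreover have "\<bar>X (i k) - a\<bar> < r / 2" using *(2)[of k] by simp
    ultimately show "r / 2 \<le> v k - u k"
      using \<open>u k < X (i k)\<close> \<open>X (i k) < v k\<close> by (smt (verit) field_sum_of_halves)
  next
    show "filterlim m at_top sequentially" using *(3) up less_imp_le by blast
    show "filterlim i at_top sequentially" using *(1) up by (meson add_leE)
  qed (use r in simp)
  then obtain h y where "strict_mono (h :: nat \<Rightarrow> nat)" "(\<lambda>k. X (i (h k))) \<longlonglongrightarrow> y" "finite_orbit y"
    by blast
  moreover have "(\<lambda>k. X (i (h k))) \<longlonglongrightarrow> a"
    using LIMSEQ_subseq_LIMSEQ[OF lim \<open>strict_mono h\<close>] by (simp add: o_def)
  ultimately show False using no LIMSEQ_unique by blast
qed

lemma visits: "a \<in> A \<Longrightarrow> a \<in> {p<..<q} \<Longrightarrow> \<exists>n\<ge>N. X n \<in> {p<..<q}"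
  using recurrent[OF _ open_greaterThanLessThan] by blast

text \<open>A pullback of \<open>{p..q}\<close> that lies inside \<open>{p<..<q}\<close> contains a
  periodic point by the intermediate value theorem. Further pullbacks carry this point arbitrarily
  close to any point of \<open>A\<close>.\<close>

lemma finite_orbits_dense:
  assumes a: "a \<in> A" and r: "0 < r"
  shows "\<exists>w. \<bar>w - a\<bar> < r \<and> finite_orbit w"
proof -
  obtain g :: "nat \<Rightarrow> nat \<Rightarrow> real" where g: "\<And>k j. j \<le> 4 \<Longrightarrow> g k j \<in> A"
    "\<And>k i j. i < j \<Longrightarrow> j \<le> 4 \<Longrightarrow> g k i < g k j"
    "\<And>z. finite {k. g k 0 < z \<and> z < g k 4}" "(\<lambda>k. g k 4 - g k 0) \<longlonglongrightarrow> 0"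
    using shrinking_quintuples[OF infinite_A compact_imp_bounded[OF compact_A]] by blast
  obtain k where PE: "\<And>i n. k \<le> i \<Longrightarrow> i \<le> n \<Longrightarrow> X n \<in> {g k 0<..<g k 4} \<Longrightarrow>
      \<exists>u v. pullback i (n - i) u v (g k 0) (g k 4)"
    using pullbacks_exist[of "\<lambda>k. g k 0" "\<lambda>k. g k 4"] g(2)[of 0 4] g(3,4) by (metis (no_types, lifting) order_refl zero_less_numeral)
  define p q b where "p = g k 0" "q = g k 4" "b = g k 2"
  have b: "b \<in> A" "b \<in> {p<..<q}" using g(1)[of 2 k] g(2)[of 0 2 k] g(2)[of 2 4 k] unfolding p_q_b_def by auto
  have near: "finite_orbit a \<or> (\<exists>i m u v. 0 < m \<and> pullback i m u v p q \<and> a - r < u \<and> v < a + r)"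
    if "a \<in> A" "0 < r" for a r
    using pullback_near[OF _ _ that, of k p q] PE visits[OF b] unfolding p_q_b_def by blast
  obtain z where z: "z \<in> {p<..<q}" "finite_orbit z"
  proof -
    \<comment> \<open>With this radius the pullback near \<open>b\<close> lies strictly between
      \<open>p\<close> and \<open>q\<close>.\<close>
    define s where "s = min (b - p) (q - b)"
    have s: "0 < s" "p \<le> b - s" "b + s \<le> q" using b(2) unfolding s_def by auto
    from near[OF b(1) s(1)] consider "finite_orbit b"
      | i m u v where "0 < m" "pullback i m u v p q" "b - s < u" "v < b + s" by blast
    then show thesis
    proof cases
      case 2
      have uv: "u < v" using pullback_less[OF 2(2)] .
      have cont: "continuous_on {u..v} (\<lambda>z. (f ^^ m) z - z)"
        by (intro continuous_intros continuous_on_iter)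
      have "\<exists>z. u \<le> z \<and> z \<le> v \<and> (f ^^ m) z - z = 0"
      proof (cases "(f ^^ m) u = p")
        case True
        then have "(f ^^ m) v = q" using 2(2) unfolding pullback_def by auto
        then show ?thesis using True 2 s uv by (intro IVT'[OF _ _ _ cont]) auto
      next
        case False
        then have "(f ^^ m) u = q" "(f ^^ m) v = p" using 2(2) unfolding pullback_def by auto
        then show ?thesis using 2 s uv by (intro IVT2'[OF _ _ _ cont]) auto
      qed
      then obtain z where z: "u \<le> z" "z \<le> v" "(f ^^ m) z = z" by auto
      have "finite_orbit z" using finite_orbit_periodic[OF z(3) 2(1)] .
      moreover have "z \<in> {p<..<q}" using z 2 s by auto
      ultimately show thesis using that by blast
    qed (use that b in blast)
  qed
  from near[OF a r] consider "finite_orbit a"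
    | i m u v where "0 < m" "pullback i m u v p q" "a - r < u" "v < a + r" by blast
  then show ?thesis
  proof cases
    case 2
    then obtain w where "w \<in> {u<..<v}" "(f ^^ m) w = z" using z(1) pullback_image[OF 2(2)] by (metis imageE)
    then show ?thesis using 2 z(2) finite_orbit_funpow[of f m w] by (intro exI[of _ w]) auto
  qed (use r in \<open>auto intro: exI[of _ a]\<close>)
qed

text \<open>The two finite orbits form a finite forward invariant set, which the orbit of
  \<open>x\<close> never hits. It cuts \<open>{w1..w2}\<close> into finitely many intervals whose
  ends never enter them, and by the pigeonhole principle one of these is visited infinitely
  often.\<close>

lemma nice_subinterval:
  assumes w: "finite_orbit w1" "finite_orbit w2" and a: "a \<in> A" "w1 < a" "a < w2"
  obtains l r where "w1 \<le> l" "l < r" "r \<le> w2" "\<And>j. (f ^^ j) l \<notin> {l<..<r}" "\<And>j. (f ^^ j) r \<notin> {l<..<r}"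
    "\<And>N. \<exists>n\<ge>N. X n \<in> {l<..<r}"
proof -
  define Orb where "Orb = range (\<lambda>k. (f ^^ k) w1) \<union> range (\<lambda>k. (f ^^ k) w2)"
  have finO: "finite Orb" using w unfolding Orb_def by simp
  have wO: "w1 \<in> Orb" "w2 \<in> Orb"
    unfolding Orb_def by (metis UnI1 UnI2 funpow_0 rangeI)+
  have iterO: "(f ^^ j) z \<in> Orb" if "z \<in> Orb" for z j
    using that unfolding Orb_def by (auto simp: funpow_apply_add[symmetric])
  have finz: "finite_orbit z" if "z \<in> Orb" for z
    using finO iterO[OF that] by (meson finite_subset image_subsetI)
  have XO: "X n \<notin> Orb" for n using finz orbit_infinite by blast
  define Vis where "Vis = {n. X n \<in> {w1<..<w2}}"
  have inf: "infinite Vis"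
    unfolding Vis_def infinite_nat_iff_unbounded_le using visits[of a w1 w2] a by auto
  define L where "L n = Max {z \<in> Orb. z < X n}" for n
  define R where "R n = Min {z \<in> Orb. X n < z}" for n
  have LR: "L n \<in> Orb" "L n < X n" "R n \<in> Orb" "X n < R n" "w1 \<le> L n" "R n \<le> w2"
    "\<And>z. z \<in> Orb \<Longrightarrow> z \<notin> {L n<..<R n}" if "n \<in> Vis" for n
  proof -
    have fin: "finite {z \<in> Orb. z < X n}" "finite {z \<in> Orb. X n < z}" using finO by auto
    have mem: "w1 \<in> {z \<in> Orb. z < X n}" "w2 \<in> {z \<in> Orb. X n < z}" using that wO unfolding Vis_def by auto
    have "L n \<in> {z \<in> Orb. z < X n}" "R n \<in> {z \<in> Orb. X n < z}"
      unfolding L_def R_def using fin mem Max_in Min_in by blast+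
    then show "L n \<in> Orb" "L n < X n" "R n \<in> Orb" "X n < R n" by auto
    show "w1 \<le> L n" "R n \<le> w2" unfolding L_def R_def using fin mem by auto
    fix z assume z: "z \<in> Orb"
    show "z \<notin> {L n<..<R n}"
    proof (cases "z < X n")
      case True
      then have "z \<le> L n" unfolding L_def using z fin by auto
      then show ?thesis by simp
    next
      case False
      then have "X n < z" using z XO[of n] by (metis linorder_neqE_linordered_idom)
      then have "R n \<le> z" unfolding R_def using z fin by auto
      then show ?thesis by simp
    qed
  qed
  have "(\<lambda>n. (L n, R n)) ` Vis \<subseteq> Orb \<times> Orb" using LR(1,3) by blast
  then have "finite ((\<lambda>n. (L n, R n)) ` Vis)"
    using finite_subset finite_cartesian_product[OF finO finO] by blast
  then obtain n0 where n0: "n0 \<in> Vis" "infinite {n \<in> Vis. (L n, R n) = (L n0, R n0)}"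
    using pigeonhole_infinite[OF inf] by blast
  show thesis
  proof (rule that[of "L n0" "R n0"])
    show "\<exists>n\<ge>N. X n \<in> {L n0<..<R n0}" for N
    proof -
      obtain n where n: "n \<ge> N" "n \<in> Vis" "(L n, R n) = (L n0, R n0)"
        using n0(2) unfolding infinite_nat_iff_unbounded_le by blast
      then show ?thesis using LR(2,4)[OF n(2)] by (intro exI[of _ n]) auto
    qed
    show "L n0 < R n0" using LR(2,4)[OF n0(1)] by linarith
    show "(f ^^ j) (L n0) \<notin> {L n0<..<R n0}" "(f ^^ j) (R n0) \<notin> {L n0<..<R n0}" for j
      using LR(1,3,7)[OF n0(1)] iterO by blast+
  qed (use LR(5,6)[OF n0(1)] in auto)
qed

text \<open>Nice intervals are found inside each of the shrinking hulls of the quintuples; since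
  they shrink and are disjoint as well, \<open>pullbacks_exist\<close> selects one with all late
  pullbacks.\<close>

lemma nice_interval_exists:
  "\<exists>k0 l r. l < r \<and> (\<forall>j. (f ^^ j) l \<notin> {l<..<r}) \<and> (\<forall>j. (f ^^ j) r \<notin> {l<..<r}) \<and>
    (\<forall>N. \<exists>n\<ge>N. X n \<in> {l<..<r}) \<and>
    (\<forall>i n. k0 \<le> i \<longrightarrow> i \<le> n \<longrightarrow> X n \<in> {l<..<r} \<longrightarrow> (\<exists>u v. pullback i (n - i) u v l r))"
proof -
  obtain g :: "nat \<Rightarrow> nat \<Rightarrow> real" where g: "\<And>k j. j \<le> 4 \<Longrightarrow> g k j \<in> A"
    "\<And>k i j. i < j \<Longrightarrow> j \<le> 4 \<Longrightarrow> g k i < g k j"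
    "\<And>z. finite {k. g k 0 < z \<and> z < g k 4}" "(\<lambda>k. g k 4 - g k 0) \<longlonglongrightarrow> 0"
    using shrinking_quintuples[OF infinite_A compact_imp_bounded[OF compact_A]] by blast
  have "\<forall>k. \<exists>l r. g k 0 \<le> l \<and> l < r \<and> r \<le> g k 4 \<and> (\<forall>j. (f ^^ j) l \<notin> {l<..<r}) \<and>
      (\<forall>j. (f ^^ j) r \<notin> {l<..<r}) \<and> (\<forall>N. \<exists>n\<ge>N. X n \<in> {l<..<r})"
  proof
    fix k
    have gk: "g k 0 < g k 1" "g k 1 < g k 2" "g k 2 < g k 3" "g k 3 < g k 4" using g(2) by auto
    obtain w1 where w1: "\<bar>w1 - g k 1\<bar> < min (g k 1 - g k 0) (g k 2 - g k 1)" "finite_orbit w1"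
      using finite_orbits_dense[of "g k 1" "min (g k 1 - g k 0) (g k 2 - g k 1)"] g(1)[of 1 k] gk by auto
    obtain w2 where w2: "\<bar>w2 - g k 3\<bar> < min (g k 3 - g k 2) (g k 4 - g k 3)" "finite_orbit w2"
      using finite_orbits_dense[of "g k 3" "min (g k 3 - g k 2) (g k 4 - g k 3)"] g(1)[of 3 k] gk by auto
    have le: "g k 0 \<le> w1" "w1 < g k 2" "g k 2 < w2" "w2 \<le> g k 4" using w1(1) w2(1) by auto
    obtain l r where "w1 \<le> l" "l < r" "r \<le> w2" "\<And>j. (f ^^ j) l \<notin> {l<..<r}" "\<And>j. (f ^^ j) r \<notin> {l<..<r}"
      "\<And>N. \<exists>n\<ge>N. X n \<in> {l<..<r}"
      using nice_subinterval[OF w1(2) w2(2) _ le(2,3)] g(1)[of 2 k] by auto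
    then show "\<exists>l r. g k 0 \<le> l \<and> l < r \<and> r \<le> g k 4 \<and> (\<forall>j. (f ^^ j) l \<notin> {l<..<r}) \<and>
      (\<forall>j. (f ^^ j) r \<notin> {l<..<r}) \<and> (\<forall>N. \<exists>n\<ge>N. X n \<in> {l<..<r})"
      using le by (intro exI[of _ l] exI[of _ r]) auto
  qed
  then obtain l r where lr: "\<And>k. g k 0 \<le> l k" "\<And>k. l k < r k" "\<And>k. r k \<le> g k 4"
      "\<And>k j. (f ^^ j) (l k) \<notin> {l k<..<r k}" "\<And>k j. (f ^^ j) (r k) \<notin> {l k<..<r k}"
      "\<And>k N. \<exists>n\<ge>N. X n \<in> {l k<..<r k}"
    by metis
  have lim: "(\<lambda>k. r k - l k) \<longlonglongrightarrow> 0"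
  proof (rule tendsto_sandwich[OF _ _ tendsto_const g(4)])
    show "eventually (\<lambda>k. 0 \<le> r k - l k) sequentially" using lr(2) less_imp_le by (intro always_eventually) auto
    show "eventually (\<lambda>k. r k - l k \<le> g k 4 - g k 0) sequentially"
      using lr(1,3) by (intro always_eventually allI diff_mono) auto
  qed
  have fin: "finite {k. l k < z \<and> z < r k}" for z
    by (rule finite_subset[OF _ g(3)[of z]]) (use lr(1,3) in \<open>auto intro: le_less_trans less_le_trans\<close>)
  show ?thesis
  proof (rule pullbacks_exist[OF lr(2) lim fin])
    fix k
    assume "\<And>i n. k \<le> i \<Longrightarrow> i \<le> n \<Longrightarrow> X n \<in> {l k<..<r k} \<Longrightarrow>
      \<exists>u v. pullback i (n - i) u v (l k) (r k) \<and> v - u \<le> c * (\<rho> / 2)"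
    then have "\<forall>i n. k \<le> i \<longrightarrow> i \<le> n \<longrightarrow> X n \<in> {l k<..<r k} \<longrightarrow> (\<exists>u v. pullback i (n - i) u v (l k) (r k))"
      by meson
    moreover have "l k < r k \<and> (\<forall>j. (f ^^ j) (l k) \<notin> {l k<..<r k}) \<and> (\<forall>j. (f ^^ j) (r k) \<notin> {l k<..<r k}) \<and>
        (\<forall>N. \<exists>n\<ge>N. X n \<in> {l k<..<r k})"
      by (intro conjI allI lr(2) lr(4) lr(5) lr(6))
    ultimately show ?thesis
      by (intro exI[of _ k] exI[of _ "l k"] exI[of _ "r k"]) (simp only: simp_thms conj_assoc)
  qed
qed

end

section \<open>Returns to a nice interval\<close>

lemma sum_lessThan_add:
  fixes g :: "nat \<Rightarrow> real"
  shows "(\<Sum>j<m + n. g j) = (\<Sum>j<m. g j) + (\<Sum>j<n. g (m + j))"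
  by (induction n) (auto simp: add.assoc)

lemma interval_crossing:
  fixes p q :: real
  assumes "is_interval S" "z \<in> S" "z \<in> {p<..<q}" "w \<in> S" "w \<notin> {p<..<q}"
  shows "p \<in> S \<or> q \<in> S"
proof (cases "w \<le> p")
  case True
  then have "p \<in> S" using assms mem_is_interval_1_I[of S w z p] by auto
  then show ?thesis by simp
next
  case False
  then have "q \<in> S" using assms mem_is_interval_1_I[of S z w q] by auto
  then show ?thesis by simp
qed

context regular_orbit
begin

text \<open>The nice intervals of one-dimensional dynamics. An image interval that crosses the
  boundary would later bring a boundary point inside; hence the disjointness results below.\<close>

definition nice :: "real \<Rightarrow> real \<Rightarrow> bool" where
  "nice p q \<longleftrightarrow> (\<forall>j. (f ^^ j) p \<notin> {p<..<q} \<and> (f ^^ j) q \<notin> {p<..<q})"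

lemma iter_interval: "is_interval ((f ^^ j) ` {u<..<v})"
  using is_interval_connected_1 connected_continuous_image[OF continuous_on_iter connected_Ioo] by blast

lemma X_in_image: "pullback i m u v p q \<Longrightarrow> X (i + j) \<in> (f ^^ j) ` {u<..<v}"
  unfolding pullback_def using X_shift by auto

lemma pullback_within:
  assumes pb: "pullback i m u v p q" and X: "X i \<in> {p'<..<q'}"
    and out: "(f ^^ m) p' \<notin> {p<..<q}" "(f ^^ m) q' \<notin> {p<..<q}"
  shows "p' \<le> u \<and> v \<le> q'"
proof -
  have "p' \<notin> {u<..<v}" "q' \<notin> {u<..<v}" using pullback_image[OF pb] out by (metis imageI)+
  then show ?thesis using X pb unfolding pullback_def by auto
qed

text \<open>Push an intersection forward to time \<open>m\<close>: the image at time
  \<open>m - (j' - j)\<close> then meets the target. The orbit is outside the target at that time,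
  so this image contains an endpoint of the target, which later enters it, against niceness.\<close>

lemma pullback_disjoint:
  assumes pb: "pullback i m u v p q" and nice: "nice p q" and j: "j < j'" "j' \<le> m"
    and out: "X (i + (m - (j' - j))) \<notin> {p<..<q}"
  shows "(f ^^ j) ` {u<..<v} \<inter> (f ^^ j') ` {u<..<v} = {}"
proof (rule ccontr)
  define d where "d = m - (j' - j)"
  assume "\<not> ?thesis"
  then obtain z w where zw: "z \<in> {u<..<v}" "w \<in> {u<..<v}" "(f ^^ j) z = (f ^^ j') w" by blast
  have "(f ^^ d) z = (f ^^ (m - j')) ((f ^^ j) z)"
    using funpow_apply_add[of "m - j'" j f z] j unfolding d_def by simp
  also have "\<dots> = (f ^^ m) w"
    unfolding zw(3) using funpow_apply_add[of "m - j'" j' f w] j by simp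
  finally have "(f ^^ d) z \<in> {p<..<q}" using pullback_image[OF pb] zw(2) by (metis imageI)
  then have "p \<in> (f ^^ d) ` {u<..<v} \<or> q \<in> (f ^^ d) ` {u<..<v}"
    using interval_crossing[OF iter_interval imageI[OF zw(1)] _ X_in_image[OF pb]] out
    unfolding d_def by blast
  then obtain e y where e: "e = p \<or> e = q" "y \<in> {u<..<v}" "e = (f ^^ d) y" by blast
  have "(f ^^ (m - d)) e = (f ^^ m) y"
    unfolding e(3) using funpow_apply_add[of "m - d" d f y] unfolding d_def by simp
  then have "(f ^^ (m - d)) e \<in> {p<..<q}" using pullback_image[OF pb] e(2) by (metis imageI)
  then show False using nice e(1) unfolding nice_def by blast
qed

lemma first_entry_sum:
  assumes pb: "pullback i m u v p q" and nice: "nice p q"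
    and out: "\<And>d. 0 < d \<Longrightarrow> d < m \<Longrightarrow> X (i + d) \<notin> {p<..<q}"
  shows "(\<Sum>j<m. len j u v) \<le> M"
proof (rule sum_lengths_le_disjoint[OF pullback_less[OF pb] pullback_reg'[OF pb order_refl]])
  fix j j' :: nat assume "j < j'" "j' < m"
  then show "(f ^^ j) ` {u<..<v} \<inter> (f ^^ j') ` {u<..<v} = {}"
    by (intro pullback_disjoint[OF pb nice] out) auto
qed

lemma pullback_compose_sum:
  assumes "pullback i m u v p q"
  shows "(\<Sum>j<m + n. len j u v) =
    (\<Sum>j<m. len j u v) + (\<Sum>j<n. len j p q)"
proof -
  have "(f ^^ (m + j)) w = (f ^^ j) ((f ^^ m) w)" for j w
    using funpow_apply_add[of j m f w] by (simp add: add.commute)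
  then have "len (m + j) u v = len j p q" for j
    using assms unfolding pullback_def by (auto simp: abs_minus_commute)
  then show ?thesis by (simp add: sum_lessThan_add)
qed

text \<open>Bounded distortion between time \<open>j\<close> and time \<open>m\<close>: the share of
  the subinterval at time \<open>j\<close> is, up to the distortion factor, its share of the target
  at the end.\<close>

lemma subpullback_length:
  assumes pb: "pullback i m u' v' p q" and S: "(\<Sum>j<m. len j u' v') \<le> S"
    and uv: "u \<in> {u'..v'}" "v \<in> {u'..v'}" and j: "j \<le> m"
  shows "len j u v * (q - p) \<le>
    exp (C * S) * (len m u v * len j u' v')"
proof -
  define a b where "a = min ((f ^^ j) u') ((f ^^ j) v')" "b = max ((f ^^ j) u') ((f ^^ j) v')"
  have e: "(f ^^ k) ((f ^^ j) z) = (f ^^ (j + k)) z" for k z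
    using funpow_apply_add[of k j f z] by (simp add: add.commute)
  have len: "len k a b = len (j + k) u' v'" for k
    unfolding a_b_def min_def max_def using e by (auto simp: abs_minus_commute)
  have tail: "pullback (i + j) (m - j) a b p q"
    using pullback_tail[OF pb j] unfolding a_b_def .
  have "(\<Sum>k<m - j. len k a b) \<le> (\<Sum>k<j + (m - j). len k u' v')"
    unfolding len sum_lessThan_add by (simp add: sum_nonneg)
  then have sum: "(\<Sum>k<m - j. len k a b) \<le> S" using S j by simp
  have img: "(f ^^ j) ` {u'..v'} = {a..b}"
    using iter_closed_segment[OF less_imp_le[OF pullback_less[OF pb]] pullback_reg'[OF pb j]]
    unfolding a_b_def closed_segment_eq_real_ivl by (simp add: min_def max_def)
  have mem: "(f ^^ j) u' \<in> {a..b}" "(f ^^ j) v' \<in> {a..b}" "(f ^^ j) u \<in> {a..b}" "(f ^^ j) v \<in> {a..b}"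
    using uv pullback_less[OF pb] by (auto simp flip: img)
  have "len (m - j) ((f ^^ j) u') ((f ^^ j) v') * len j u v \<le>
    exp (C * S) * (len (m - j) ((f ^^ j) u) ((f ^^ j) v) * len j u' v')"
    using four_point[OF pullback_reg'[OF tail order_refl] sum mem] .
  then show ?thesis using j pullback_length[OF pb] unfolding e by (simp add: mult.commute)
qed

end

text \<open>The bound \<open>6 / 5\<close> on the distortion is the one that can be arranged when
  \<open>A\<close> is a null set.\<close>

locale nice_interval = regular_orbit +
  fixes l r :: real and k0 :: nat
  assumes lr: "l < r" and nice_lr: "nice l r"
    and visit: "\<And>N. \<exists>n\<ge>N. X n \<in> {l<..<r}"
    and exists_pullback: "\<And>i n. k0 \<le> i \<Longrightarrow> i \<le> n \<Longrightarrow> X n \<in> {l<..<r} \<Longrightarrow> \<exists>u v. pullback i (n - i) u v l r"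
    and distortion: "exp (C * M) \<le> 6 / 5"
begin

abbreviation "V \<equiv> {l<..<r}"

definition Vis :: "nat \<Rightarrow> bool" where "Vis n \<longleftrightarrow> k0 \<le> n \<and> X n \<in> V"

definition ret :: "nat \<Rightarrow> nat" where "ret n = (LEAST s. 0 < s \<and> X (n + s) \<in> V)"

lemma ret: "0 < ret n" "X (n + ret n) \<in> V"
proof -
  obtain m where "m \<ge> Suc n" "X m \<in> V" using visit by blast
  then have "0 < m - n \<and> X (n + (m - n)) \<in> V" by simp
  then have "0 < ret n \<and> X (n + ret n) \<in> V" unfolding ret_def by (rule LeastI)
  then show "0 < ret n" "X (n + ret n) \<in> V" by auto
qed

lemma before_ret: "0 < d \<Longrightarrow> d < ret n \<Longrightarrow> X (n + d) \<notin> V"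
  unfolding ret_def using not_less_Least by blast

lemma ret_le: "n < m \<Longrightarrow> X m \<in> V \<Longrightarrow> n + ret n \<le> m"
  using before_ret[of "m - n" n] by (metis add.commute add_diff_inverse_nat less_diff_conv
      not_le not_less_iff_gr_or_eq zero_less_diff)

lemma Vis_ret: "Vis n \<Longrightarrow> Vis (n + ret n)"
  using ret[of n] unfolding Vis_def by simp

definition lo where "lo n = fst (SOME w. pullback n (ret n) (fst w) (snd w) l r)"
definition hi where "hi n = snd (SOME w. pullback n (ret n) (fst w) (snd w) l r)"

abbreviation "Ret n \<equiv> {lo n<..<hi n}"

lemma pb_ret:
  assumes "Vis n" shows "pullback n (ret n) (lo n) (hi n) l r"
proof -
  have "\<exists>u v. pullback n (ret n) u v l r"
    using exists_pullback[of n "n + ret n"] ret[of n] assms unfolding Vis_def by simp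
  then have "\<exists>w. pullback n (ret n) (fst w) (snd w) l r" by auto
  then show ?thesis unfolding lo_def hi_def by (rule someI_ex)
qed

lemma X_dom: "Vis n \<Longrightarrow> X n \<in> Ret n"
  using pb_ret unfolding pullback_def by auto

lemma dom_sub:
  assumes "Vis n" shows "l \<le> lo n" "lo n < hi n" "hi n \<le> r"
  using pullback_within[OF pb_ret[OF assms], of l r] assms nice_lr pullback_less[OF pb_ret[OF assms]]
  unfolding Vis_def nice_def by auto

text \<open>Hence \<open>ret n\<close> is the first return time of every point of
  \<open>Ret n\<close> and not only of \<open>X n\<close>. Otherwise an intermediate image would
  contain an end of \<open>V\<close>, which would enter \<open>V\<close> later.\<close>

lemma image_crossing:
  assumes n: "Vis n" and d: "0 < d" "d < ret n" and z: "z \<in> Ret n"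
  shows "(f ^^ d) z \<notin> V"
proof
  assume "(f ^^ d) z \<in> V"
  then have "l \<in> (f ^^ d) ` Ret n \<or> r \<in> (f ^^ d) ` Ret n"
    using interval_crossing[OF iter_interval imageI[OF z] _ X_in_image[OF pb_ret[OF n]] before_ret[OF d]]
    by blast
  then obtain e y where e: "e = l \<or> e = r" "y \<in> Ret n" "e = (f ^^ d) y" by blast
  have "(f ^^ (ret n - d)) e = (f ^^ ret n) y"
    unfolding e(3) using funpow_apply_add[of "ret n - d" d f y] d by simp
  then have "(f ^^ (ret n - d)) e \<in> V" using pullback_image[OF pb_ret[OF n]] e(2) by (metis imageI)
  then show False using nice_lr e(1) unfolding nice_def by blast
qed

text \<open>Before the return, use continuity: \<open>V\<close> is open and disjoint from the images
  of \<open>Ret n\<close>, hence from their closures. At the return the endpoint becomes an end of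
  the nice interval \<open>V\<close>.\<close>

lemma dom_end:
  assumes n: "Vis n" and e: "e = lo n \<or> e = hi n" and j: "0 < j"
  shows "(f ^^ j) e \<notin> V"
proof (cases "j < ret n")
  case True
  have "V \<inter> (f ^^ j) ` Ret n = {}" using image_crossing[OF n j True] by blast
  then have "V \<inter> closure ((f ^^ j) ` Ret n) = {}"
    using open_Int_closure_eq_empty[of V] by simp
  moreover have "(f ^^ j) ` closure (Ret n) \<subseteq> closure ((f ^^ j) ` Ret n)"
    by (intro image_closure_subset continuous_on_iter closed_closure closure_subset)
  moreover have "e \<in> closure (Ret n)" using e dom_sub[OF n] by (auto simp: closure_greaterThanLessThan)
  ultimately show ?thesis by blast
next
  case False
  have "(f ^^ ret n) e = l \<or> (f ^^ ret n) e = r" using pb_ret[OF n] e unfolding pullback_def by auto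
  moreover have "(f ^^ j) e = (f ^^ (j - ret n)) ((f ^^ ret n) e)"
    using funpow_apply_add[of "j - ret n" "ret n" f e] False by simp
  ultimately show ?thesis using nice_lr unfolding nice_def by metis
qed

lemma nice_dom:
  assumes "Vis n" shows "nice (lo n) (hi n)"
  unfolding nice_def
proof
  fix j
  show "(f ^^ j) (lo n) \<notin> Ret n \<and> (f ^^ j) (hi n) \<notin> Ret n"
  proof (cases "j = 0")
    case False
    moreover have "Ret n \<subseteq> V" using dom_sub[OF assms] by auto
    ultimately show ?thesis using dom_end[OF assms] by blast
  qed simp
qed

text \<open>A common point fixes the first return time, and an end of one domain inside the other
  would be mapped into \<open>V\<close>, contrary to \<open>dom_end\<close>. So return domains are
  equal or disjoint.\<close>

lemma dom_meet:
  assumes n: "Vis n" and n': "Vis n'" and meet: "Ret n \<inter> Ret n' \<noteq> {}"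
  shows "ret n = ret n'" "lo n = lo n'" "hi n = hi n'"
proof -
  obtain z where z: "z \<in> Ret n" "z \<in> Ret n'" using meet by blast
  have "(f ^^ ret n) z \<in> V" "(f ^^ ret n') z \<in> V"
    using pullback_image[OF pb_ret[OF n]] pullback_image[OF pb_ret[OF n']] z by (metis imageI)+
  then show ret_eq: "ret n = ret n'"
    using image_crossing[OF n ret(1)[of n'] _ z(1)] image_crossing[OF n' ret(1)[of n] _ z(2)]
    by (metis linorder_neqE_nat)
  have out: "e \<notin> Ret n" if "e = lo n' \<or> e = hi n'" for e
    using dom_end[OF n' that ret(1)[of n]] pullback_image[OF pb_ret[OF n]] by (metis imageI)
  have out': "e \<notin> Ret n'" if "e = lo n \<or> e = hi n" for e
    using dom_end[OF n that ret(1)[of n']] pullback_image[OF pb_ret[OF n']] by (metis imageI)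
  show "lo n = lo n'" "hi n = hi n'"
    using out[of "lo n'"] out[of "hi n'"] out'[of "lo n"] out'[of "hi n"] z by auto
qed

definition small where "small n \<longleftrightarrow> Vis n \<and> hi n - lo n \<le> (r - l) / 2"

text \<open>Two return domains that both fill more than half of \<open>V\<close> coincide. So if all visits were
  to such domains, the orbit would be confined to an interval on which a fixed iterate is monotone.\<close>

lemma small_visits_infinite: "\<exists>n\<ge>N. small n"
proof (rule ccontr)
  assume no: "\<not> ?thesis"
  obtain n0 where n0: "n0 \<ge> max N k0" "X n0 \<in> V" using visit by blast
  have Vis0: "Vis n0" using n0 unfolding Vis_def by simp
  have same: "ret n = ret n0 \<and> lo n = lo n0 \<and> hi n = hi n0" if n: "Vis n" "n \<ge> N" for n
  proof -
    have "hi n - lo n > (r - l) / 2" "hi n0 - lo n0 > (r - l) / 2"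
      using no n Vis0 n0(1) unfolding small_def by (auto simp: not_le)
    then have "max (lo n) (lo n0) < min (hi n) (hi n0)"
      using dom_sub[OF n(1)] dom_sub[OF Vis0] by auto
    then obtain z where "max (lo n) (lo n0) < z" "z < min (hi n) (hi n0)" using dense by blast
    then have "z \<in> Ret n \<inter> Ret n0" by auto
    then show ?thesis using dom_meet[OF n(1) Vis0] by blast
  qed
  have "Vis (n0 + k * ret n0)" for k
  proof (induction k)
    case (Suc k)
    then show ?case using Vis_ret[OF Suc] same[OF Suc] n0(1) by (simp add: algebra_simps)
  qed (use Vis0 in simp)
  then have "X (n0 + k * ret n0) \<in> Ret n0" for k
    using X_dom same n0(1) by (metis max.bounded_iff trans_le_add1)
  then show False
    using trap_interval[OF ret(1), of n0 n0 "Ret n0"] in_reg_subset[OF pullback_reg'[OF pb_ret[OF Vis0] order_refl]]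
    by (simp add: is_interval_oo greaterThanLessThan_subseteq_atLeastAtMost_iff)
qed

lemma ret_sum:
  assumes "Vis n" shows "(\<Sum>j<ret n. len j (lo n) (hi n)) \<le> M"
  using first_entry_sum[OF pb_ret[OF assms] nice_lr] before_ret by blast

lemma D_ge: "1 \<le> exp (C * M)"
  using C_nonneg M_nonneg by simp

text \<open>At the first return to \<open>V\<close> the pullback is either the target itself, which fills at most half of
  \<open>V\<close>, or it is disjoint from its image at the next return, which is not much shorter. In both cases
  it leaves out a definite part of \<open>V\<close>.\<close>

lemma contraction:
  assumes n: "small n" and n': "small n'" and less: "n < n'"
    and between: "\<And>t. n < t \<Longrightarrow> t < n' \<Longrightarrow> \<not> small t"
  obtains u v where "pullback n (n' - n) u v (lo n') (hi n')" "lo n \<le> u" "v \<le> hi n"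
    "(v - u) * (1 + exp (C * M)) \<le> exp (C * M) * exp (C * M) * (hi n - lo n)"
    "(\<Sum>j<n' - n. len j u v) \<le> M"
proof -
  define D where "D = exp (C * M)"
  have D: "1 \<le> D" using D_ge unfolding D_def .
  have Vn: "Vis n" and Vn': "Vis n'" using n n' unfolding small_def by auto
  note sub = dom_sub[OF Vn] and sub' = dom_sub[OF Vn']
  \<comment> \<open>A visit to \<open>Ret n'\<close> would have \<open>Ret n'\<close> as its return
    domain and would itself be small.\<close>
  have notQ: "X t \<notin> Ret n'" if t: "n < t" "t < n'" for t
  proof
    assume X: "X t \<in> Ret n'"
    then have "Vis t" using sub' Vn t unfolding Vis_def by auto
    then have "Ret t \<inter> Ret n' \<noteq> {}" using X_dom X by blast
    then have "small t" using dom_meet[OF \<open>Vis t\<close> Vn'] \<open>Vis t\<close> n' unfolding small_def by auto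
    then show False using between t by blast
  qed
  obtain a b where "pullback n (n' - n) a b l r"
    using exists_pullback[of n n'] Vn Vn' less unfolding Vis_def by auto
  moreover have "lo n' < X (n + (n' - n))" "X (n + (n' - n)) < hi n'" using X_dom[OF Vn'] less by auto
  ultimately obtain u v where pb: "pullback n (n' - n) u v (lo n') (hi n')"
    using pullback_restrict sub'(1,3) by blast
  have V_end: "(f ^^ j) e \<notin> Ret n'" if "Vis t" "e = lo t \<or> e = hi t" "0 < j" for e t j
    using dom_end[OF that] sub' by auto
  have uv: "lo n \<le> u" "v \<le> hi n"
    using pullback_within[OF pb X_dom[OF Vn]] V_end[OF Vn] less by auto
  have sum: "(\<Sum>j<n' - n. len j u v) \<le> M"
    using first_entry_sum[OF pb nice_dom[OF Vn']] notQ by (metis add.commute less_add_same_cancel2 less_diff_conv)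
  define t where "t = n + ret n"
  have Vt: "Vis t" unfolding t_def using Vis_ret[OF Vn] .
  have t: "n < t" "t \<le> n'"
    using ret(1)[of n] ret_le[OF less] Vn' unfolding t_def Vis_def by auto
  define pl pr where "pl = min ((f ^^ ret n) u) ((f ^^ ret n) v)" "pr = max ((f ^^ ret n) u) ((f ^^ ret n) v)"
  have pbt: "pullback t (n' - t) pl pr (lo n') (hi n')"
    using pullback_tail[OF pb, of "ret n"] t unfolding t_def pl_pr_def by simp
  define L where "L = r - l"
  have L: "0 < L" using lr unfolding L_def by simp
  have P: "(pr - pl) * (1 + D) \<le> D * L"
  proof (cases "t = n'")
    case True
    then have "pr - pl = hi n' - lo n'" using pullback_length[OF pbt] pullback_less[OF pbt] by simp
    also have "\<dots> \<le> L / 2" using n' unfolding small_def L_def by simp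
    finally have "(pr - pl) * (1 + D) \<le> L / 2 * (1 + D)" using D by (intro mult_right_mono) auto
    also have "\<dots> \<le> L / 2 * (2 * D)" using D L by (intro mult_left_mono) auto
    finally show ?thesis by (simp add: mult.commute)
  next
    case False
    then have tn': "t < n'" using t by simp
    note subt = dom_sub[OF Vt]
    have P_in: "lo t \<le> pl" "pr \<le> hi t" "pl < pr"
      using pullback_within[OF pbt X_dom[OF Vt]] V_end[OF Vt] tn' pullback_less[OF pbt] by auto
    define t2 where "t2 = t + ret t"
    have t2: "t2 \<le> n'" "t < t2" using ret_le[OF tn'] Vn' ret(1)[of t] unfolding t2_def Vis_def by auto
    define ql qr where "ql = min ((f ^^ ret t) pl) ((f ^^ ret t) pr)" "qr = max ((f ^^ ret t) pl) ((f ^^ ret t) pr)"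
    have pbt2: "pullback t2 (n' - t2) ql qr (lo n') (hi n')"
      using pullback_tail[OF pbt, of "ret t"] t2 unfolding t2_def ql_qr_def by simp
    have "X t2 \<in> V" using ret(2)[of t] unfolding t2_def .
    moreover have "(f ^^ j) l \<notin> Ret n'" "(f ^^ j) r \<notin> Ret n'" for j
      using nice_lr sub' unfolding nice_def by (auto simp: not_less) (meson le_less_trans less_le_trans not_le)+
    ultimately have Q_in: "l \<le> ql" "qr \<le> r" "ql < qr"
      using pullback_within[OF pbt2] pullback_less[OF pbt2] by auto
    \<comment> \<open>The time in question is \<open>n' - ret t\<close>; it is at least
      \<open>t\<close> because \<open>t2 \<le> n'\<close>, so \<open>notQ\<close> applies.\<close>
    have "X (t + (n' - t - (ret t - 0))) \<notin> Ret n'"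
      using t2 t by (intro notQ) (auto simp: t2_def)
    then have "(f ^^ 0) ` {pl<..<pr} \<inter> (f ^^ ret t) ` {pl<..<pr} = {}"
      using t2 ret(1)[of t] by (intro pullback_disjoint[OF pbt nice_dom[OF Vn']]) (auto simp: t2_def)
    moreover have "(f ^^ ret t) ` {pl<..<pr} = {ql<..<qr}"
    proof -
      have "in_reg (ret t) {pl..pr}" using pullback_reg'[OF pbt, of "ret t"] t2 by (simp add: t2_def)
      then show ?thesis
        using iter_open_segment[OF P_in(3)] unfolding ql_qr_def open_segment_eq_real_ivl
        by (simp add: min_def max_def)
    qed
    ultimately have disj: "{pl<..<pr} \<inter> {ql<..<qr} = {}" by simp
    have "pr \<le> ql \<or> qr \<le> pl"
    proof (rule ccontr)
      assume "\<not> ?thesis"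
      then have "max pl ql < min pr qr" using P_in(3) Q_in(3) by auto
      then obtain z where "max pl ql < z" "z < min pr qr" using dense by blast
      then have "z \<in> {pl<..<pr} \<inter> {ql<..<qr}" by auto
      then show False using disj by blast
    qed
    then have tot: "(pr - pl) + (qr - ql) \<le> L"
      using P_in Q_in subt unfolding L_def by auto
    have "len (ret t) pl pr = qr - ql" "\<bar>pl - pr\<bar> = pr - pl" "\<bar>lo t - hi t\<bar> = hi t - lo t"
      using P_in(3) subt unfolding ql_qr_def by auto
    \<comment> \<open>Distortion of the first return at time \<open>t\<close>, which maps the domain
      of \<open>t\<close> onto \<open>V\<close> and \<open>{pl..pr}\<close> onto
      \<open>{ql..qr}\<close>.\<close>
    then have "L * (pr - pl) \<le> D * ((qr - ql) * (hi t - lo t))"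
      using four_point[OF pullback_reg'[OF pb_ret[OF Vt] order_refl] ret_sum[OF Vt], of "lo t" "hi t" pl pr]
        P_in subt
      unfolding pullback_length[OF pb_ret[OF Vt]] D_def L_def by simp
    also have "\<dots> \<le> D * ((qr - ql) * L)"
      using D Q_in subt unfolding L_def by (intro mult_left_mono) auto
    finally have "L * (pr - pl) \<le> L * (D * (qr - ql))" by (simp add: mult_ac)
    then have "pr - pl \<le> D * (qr - ql)" using L by simp
    also have "\<dots> \<le> D * (L - (pr - pl))" using D tot by (intro mult_left_mono) auto
    finally show ?thesis by (simp add: algebra_simps)
  qed
  have uvl: "u < v" using pullback_less[OF pb] .
  have "len (ret n) u v = pr - pl" "\<bar>u - v\<bar> = v - u" "\<bar>lo n - hi n\<bar> = hi n - lo n"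
    using uvl sub unfolding pl_pr_def by auto
  then have "L * (v - u) \<le> D * ((pr - pl) * (hi n - lo n))"
    using four_point[OF pullback_reg'[OF pb_ret[OF Vn] order_refl] ret_sum[OF Vn], of "lo n" "hi n" u v]
      uv uvl sub
    unfolding pullback_length[OF pb_ret[OF Vn]] D_def L_def by simp
  then have "L * (v - u) * (1 + D) \<le> D * ((pr - pl) * (hi n - lo n)) * (1 + D)"
    using D by (intro mult_right_mono) auto
  also have "\<dots> = D * (hi n - lo n) * ((pr - pl) * (1 + D))" by (simp add: mult_ac)
  also have "\<dots> \<le> D * (hi n - lo n) * (D * L)" using P D sub by (intro mult_left_mono) auto
  finally have "L * ((v - u) * (1 + D)) \<le> L * (D * D * (hi n - lo n))" by (simp add: mult_ac)
  then have "(v - u) * (1 + D) \<le> D * D * (hi n - lo n)" using L by (simp only: mult_le_cancel_left_pos)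
  then show thesis using that pb uv sum unfolding D_def by blast
qed

section \<open>Iterating the contraction\<close>

definition \<tau> :: "nat \<Rightarrow> nat" where "\<tau> = enumerate {n. small n}"

lemma infinite_small: "infinite {n. small n}"
  unfolding infinite_nat_iff_unbounded_le using small_visits_infinite by auto

lemma small_\<tau>: "small (\<tau> k)"
  using enumerate_in_set[OF infinite_small] unfolding \<tau>_def by auto

lemma Vis_\<tau>: "Vis (\<tau> k)"
  using small_\<tau> unfolding small_def by blast

lemma \<tau>_Suc: "\<tau> k < \<tau> (Suc k)" "\<And>t. \<tau> k < t \<Longrightarrow> t < \<tau> (Suc k) \<Longrightarrow> \<not> small t"
proof -
  show "\<tau> k < \<tau> (Suc k)" using enumerate_step[OF infinite_small] unfolding \<tau>_def .
  fix t assume "\<tau> k < t" "t < \<tau> (Suc k)"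
  moreover have "\<tau> (Suc k) = (LEAST s. s \<in> {n. small n} \<and> \<tau> k < s)"
    unfolding \<tau>_def by (rule enumerate_Suc''[OF infinite_small])
  ultimately show "\<not> small t" using not_less_Least by fastforce
qed

lemma \<tau>_le: "\<tau> k \<le> \<tau> (k + d)"
  by (induction d) (auto intro: le_trans less_imp_le[OF \<tau>_Suc(1)])

text \<open>Induction by prepending one step. At each time of the new step the pullback is at most
  \<open>D * (4/5) ^ d\<close> times as long as the interval given by \<open>contraction\<close>. So
  the step adds at most \<open>6/5 * (4/5) ^ d * M\<close> to the total length, and
  \<open>6 * M * (1 - (4/5) ^ d)\<close> is the sum of this geometric series.\<close>

lemma long_pullback_contracts:
  "\<exists>u v. pullback (\<tau> k) (\<tau> (k + d) - \<tau> k) u v (lo (\<tau> (k + d))) (hi (\<tau> (k + d))) \<and>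
     lo (\<tau> k) \<le> u \<and> v \<le> hi (\<tau> k) \<and> v - u \<le> (4/5) ^ d * (hi (\<tau> k) - lo (\<tau> k)) \<and>
     (\<Sum>j<\<tau> (k + d) - \<tau> k. len j u v) \<le> 6 * M * (1 - (4/5) ^ d)"
proof (induction d arbitrary: k)
  case 0
  have "hi (\<tau> k) - lo (\<tau> k) \<le> \<rho> / 2"
    using pb_ret[OF Vis_\<tau>[of k]] unfolding pullback_def by (auto dest: spec[of _ 0])
  then have "pullback (\<tau> k) 0 (lo (\<tau> k)) (hi (\<tau> k)) (lo (\<tau> k)) (hi (\<tau> k))"
    using X_dom[OF Vis_\<tau>] by (intro pullback_0)
  then show ?case by auto
next
  case (Suc d)
  define n n' where "n = \<tau> k" "n' = \<tau> (Suc k)"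
  define N where "N = \<tau> (k + Suc d)"
  define D where "D = exp (C * M)"
  have D: "1 \<le> D" "D \<le> 6 / 5" using D_ge distortion unfolding D_def by auto
  have Vn: "Vis n" "Vis n'" unfolding n_n'_def by (rule Vis_\<tau>)+
  obtain z1 z2 where Z: "pullback n' (N - n') z1 z2 (lo N) (hi N)" "lo n' \<le> z1" "z2 \<le> hi n'"
      "z2 - z1 \<le> (4/5) ^ d * (hi n' - lo n')"
      "(\<Sum>j<N - n'. len j z1 z2) \<le> 6 * M * (1 - (4/5) ^ d)"
    using Suc[of "Suc k"] unfolding n_n'_def N_def by auto
  have nn': "n < n'" unfolding n_n'_def by (rule \<tau>_Suc(1))
  have sm: "small n" "small n'" unfolding n_n'_def by (rule small_\<tau>)+
  have between: "\<not> small t" if "n < t" "t < n'" for t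
    using \<tau>_Suc(2) that unfolding n_n'_def by blast
  obtain u' v' where U: "pullback n (n' - n) u' v' (lo n') (hi n')" "lo n \<le> u'" "v' \<le> hi n"
      "(v' - u') * (1 + D) \<le> D * D * (hi n - lo n)"
      "(\<Sum>j<n' - n. len j u' v') \<le> M"
    using contraction[OF sm nn' between, folded D_def] by blast
  have "z1 < X (n + (n' - n))" "X (n + (n' - n)) < z2" using Z(1) nn' unfolding pullback_def by auto
  then obtain u v where uv: "u' \<le> u" "v \<le> v'" "pullback n (n' - n) u v z1 z2"
    using pullback_restrict[OF U(1) Z(2) _ _ Z(3)] by blast
  define q where "q = hi n' - lo n'"
  have q: "0 < q" using dom_sub(2)[OF Vn(2)] unfolding q_def by simp
  have uvl: "u < v" using pullback_less[OF uv(3)] .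
  have len: "len j u v \<le> D * (4/5) ^ d * len j u' v'" if j: "j \<le> n' - n" for j
  proof -
    have "len j u v * q \<le> D * ((z2 - z1) * len j u' v')"
      using subpullback_length[OF U(1,5) _ _ j, of u v] uv uvl pullback_length[OF uv(3)]
      unfolding D_def q_def by auto
    also have "\<dots> \<le> D * (((4/5) ^ d * q) * len j u' v')"
      using Z(4) D unfolding q_def by (intro mult_left_mono mult_right_mono) auto
    finally have "len j u v * q \<le> (D * (4/5) ^ d * len j u' v') * q"
      by (simp add: mult_ac)
    then show ?thesis using q by (simp only: mult_le_cancel_right_pos)
  qed
  have u'v': "u' < v'" using pullback_less[OF U(1)] .
  have hn: "0 < hi n - lo n" using dom_sub(2)[OF Vn(1)] by simp
  have "D * (v' - u') \<le> 4/5 * (hi n - lo n)"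
  proof -
    \<comment> \<open>One factor \<open>D\<close> comes from passing to the subinterval, the factor
      \<open>D * D / (1 + D)\<close> from \<open>contraction\<close>. Their product is at most
      \<open>4/5\<close> when \<open>1 \<le> D\<close> and \<open>D \<le> 6/5\<close>.\<close>
    have "D * D \<le> 6/5 * (6/5)" using D by (intro mult_mono) auto
    then have "D * (D * D) \<le> D * (6/5 * (6/5))" using D by (intro mult_left_mono) auto
    also have "\<dots> \<le> 4/5 * (1 + D)" using D by simp
    finally have DD: "D * (D * D) \<le> 4/5 * (1 + D)" .
    have "D * ((v' - u') * (1 + D)) \<le> D * (D * D * (hi n - lo n))"
      using U(4) D by (intro mult_left_mono) auto
    also have "\<dots> = D * (D * D) * (hi n - lo n)" by simp
    also have "\<dots> \<le> 4/5 * (1 + D) * (hi n - lo n)" using DD hn by (intro mult_right_mono) auto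
    finally have "(D * (v' - u')) * (1 + D) \<le> (4/5 * (hi n - lo n)) * (1 + D)" by (simp only: mult_ac)
    moreover have "0 < 1 + D" using D by simp
    ultimately show ?thesis by (simp only: mult_le_cancel_right_pos)
  qed
  then have "(4/5) ^ d * (D * (v' - u')) \<le> (4/5) ^ d * (4/5 * (hi n - lo n))"
    by (intro mult_left_mono) auto
  also have "\<dots> = (4/5) ^ Suc d * (hi n - lo n)" by simp
  finally have "(4/5) ^ d * (D * (v' - u')) \<le> (4/5) ^ Suc d * (hi n - lo n)" .
  moreover have "v - u \<le> D * (4/5) ^ d * (v' - u')" using len[of 0] uvl u'v' by simp
  moreover have "D * (4/5) ^ d * (v' - u') = (4/5) ^ d * (D * (v' - u'))" by (simp only: mult_ac)
  ultimately have shrink: "v - u \<le> (4/5) ^ Suc d * (hi n - lo n)" by linarith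
  have pbN: "pullback n (N - n) u v (lo N) (hi N)"
  proof -
    have "n' \<le> N" using \<tau>_le[of "Suc k" d] unfolding n_n'_def N_def by simp
    then have "n' - n + (N - n') = N - n" using nn' by simp
    then show ?thesis using pullback_compose[OF uv(3), of "N - n'"] Z(1) nn' by simp
  qed
  have "N - n = (n' - n) + (N - n')"
    using \<tau>_le[of "Suc k" d] nn' unfolding n_n'_def N_def by simp
  then have "(\<Sum>j<N - n. len j u v) = (\<Sum>j<n' - n. len j u v) +
      (\<Sum>j<N - n'. len j z1 z2)"
    using pullback_compose_sum[OF uv(3)] by simp
  also have "(\<Sum>j<n' - n. len j u v) \<le>
      (\<Sum>j<n' - n. D * (4/5) ^ d * len j u' v')"
    using len by (intro sum_mono) auto
  also have "\<dots> = D * (4/5) ^ d * (\<Sum>j<n' - n. len j u' v')"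
    by (simp add: sum_distrib_left)
  also have "\<dots> \<le> (6/5) * (4/5) ^ d * M"
    using U(5) D M_nonneg by (intro mult_mono) (auto intro: sum_nonneg)
  finally have "(\<Sum>j<N - n. len j u v) \<le> 6/5 * (4/5) ^ d * M + 6 * M * (1 - (4/5) ^ d)"
    using Z(5) by linarith
  also have "\<dots> = 6 * M * (1 - (4/5) ^ Suc d)" by (simp add: algebra_simps)
  finally have "(\<Sum>j<N - n. len j u v) \<le> 6 * M * (1 - (4/5) ^ Suc d)" .
  then show ?case using pbN shrink U(2,3) uv(1,2) unfolding n_n'_def N_def
    by (intro exI[of _ u] exI[of _ v] conjI) auto
qed

text \<open>The starting time is fixed while \<open>d\<close> grows, which gives arbitrarily small
  scales at a single point. The final return to \<open>V\<close> raises the bound from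
  \<open>6 * M\<close> to \<open>7 * M\<close>.\<close>

lemma bounded_distortion_pullbacks:
  "\<exists>m u v. pullback (\<tau> 0) m u v l r \<and> v - u \<le> (4/5) ^ d * (r - l) \<and>
     (\<Sum>j<m. len j u v) \<le> 7 * M"
proof -
  define n N where "n = \<tau> 0" "N = \<tau> d"
  have nN: "n \<le> N" using \<tau>_le[of 0 d] unfolding n_N_def by simp
  obtain u v where uv: "pullback n (N - n) u v (lo N) (hi N)" "lo n \<le> u" "v \<le> hi n"
      "v - u \<le> (4/5) ^ d * (hi n - lo n)"
      "(\<Sum>j<N - n. len j u v) \<le> 6 * M * (1 - (4/5) ^ d)"
    using long_pullback_contracts[of 0 d] unfolding n_N_def by auto
  have VN: "Vis N" "Vis n" unfolding n_N_def by (rule Vis_\<tau>)+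
  have pb: "pullback n (N - n + ret N) u v l r"
    using pullback_compose[OF uv(1)] pb_ret[OF VN(1)] nN by simp
  have "(\<Sum>j<N - n + ret N. len j u v) = (\<Sum>j<N - n. len j u v) +
      (\<Sum>j<ret N. len j (lo N) (hi N))"
    by (rule pullback_compose_sum[OF uv(1)])
  also have "(\<Sum>j<ret N. len j (lo N) (hi N)) \<le> M" using ret_sum[OF VN(1)] .
  also have "(\<Sum>j<N - n. len j u v) \<le> 6 * M"
  proof -
    have "6 * M * (1 - (4/5) ^ d) \<le> 6 * M * 1" using M_nonneg by (intro mult_left_mono) auto
    then show ?thesis using uv(5) by linarith
  qed
  finally have "(\<Sum>j<N - n + ret N. len j u v) \<le> 7 * M" by simp
  moreover have "v - u \<le> (4/5) ^ d * (r - l)"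
  proof -
    have "(4/5) ^ d * (hi n - lo n) \<le> (4/5) ^ d * (r - l)"
      using dom_sub[OF VN(2)] by (intro mult_left_mono) auto
    then show ?thesis using uv(4) by linarith
  qed
  ultimately show ?thesis using pb unfolding n_N_def by blast
qed

end

section \<open>Porosity\<close>

definition hole_near :: "real set \<Rightarrow> real \<Rightarrow> real \<Rightarrow> real \<Rightarrow> bool" where
  "hole_near E \<kappa> \<delta> z \<longleftrightarrow> (\<exists>u v p q. u < z \<and> z < v \<and> v - u < \<delta> \<and>
     u \<le> p \<and> q \<le> v \<and> \<kappa> * (v - u) \<le> q - p \<and> {p<..<q} \<inter> E = {})"

text \<open>Upper porosity: a definite proportion of hole at arbitrarily small scales, not at all of
  them, with a constant that may depend on the point.\<close>

definition porous_at :: "real set \<Rightarrow> real \<Rightarrow> bool" where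
  "porous_at E z \<longleftrightarrow> (\<exists>\<kappa>>0. \<forall>\<delta>>0. hole_near E \<kappa> \<delta> z)"

lemma card_le_2I:
  fixes B :: "nat set"
  assumes fin: "finite B" and no: "\<And>i j k. i \<in> B \<Longrightarrow> j \<in> B \<Longrightarrow> k \<in> B \<Longrightarrow> i < j \<Longrightarrow> j < k \<Longrightarrow> False"
  shows "card B \<le> 2"
proof (cases "B = {}")
  case False
  have "B \<subseteq> {Min B, Max B}"
  proof
    fix j assume j: "j \<in> B"
    then have "Min B \<le> j" "j \<le> Max B" using fin by auto
    then show "j \<in> {Min B, Max B}"
      using no[OF Min_in[OF fin False] j Max_in[OF fin False]] by (metis insert_iff le_neq_implies_less)
  qed
  then have "card B \<le> card {Min B, Max B}" by (intro card_mono) auto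
  also have "\<dots> \<le> 2" by (simp add: card_insert_if)
  finally show ?thesis .
qed simp

lemma (in nice_interval) porous_at_orbit:
  assumes E: "closed E" "f ` E \<subseteq> E" "E \<subseteq> nhd A \<rho>"
  shows "porous_at E (X (\<tau> 0))"
proof -
  have iterE: "(f ^^ j) z \<in> E" if "z \<in> E" for z j
    by (induction j) (use that E(2) in auto)
  \<comment> \<open>Otherwise all images of \<open>V\<close> would stay near \<open>A\<close>, and
    \<open>few_visits\<close> forbids infinitely many visits to such an interval.\<close>
  have "\<not> V \<subseteq> E"
  proof
    assume VE: "V \<subseteq> E"
    then have reg: "in_reg j V" for j
      unfolding in_reg_def using iterE E(3) near_Reg by blast
    then show False using few_visits[OF is_interval_oo _ visit] by blast
  qed
  then obtain z where z: "z \<in> V" "z \<notin> E" by blast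
  then have "open (V - E)" "z \<in> V - E" using E(1) by (auto intro: open_Diff)
  then obtain e where e: "e > 0" "cball z e \<subseteq> V - E" using open_contains_cball by blast
  define p q where "p = z - e" "q = z + e"
  have "{p..q} = cball z e" unfolding p_q_def by (simp add: cball_eq_atLeastAtMost)
  then have pq: "p < q" "{p..q} \<subseteq> V" "{p..q} \<inter> E = {}" using e unfolding p_q_def by auto
  \<comment> \<open>The share of the hole in \<open>V\<close>, reduced by the distortion for total
    length \<open>7 * M\<close>; it serves all scales. Pulled back holes are holes of
    \<open>E\<close> again because \<open>E\<close> is forward invariant.\<close>
  define \<kappa> where "\<kappa> = (q - p) / (exp (C * (7 * M)) * (r - l))"
  have k: "\<kappa> > 0" using pq lr unfolding \<kappa>_def by simp
  have "hole_near E \<kappa> \<delta> (X (\<tau> 0))" if d: "\<delta> > 0" for \<delta>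
  proof -
    have "(\<lambda>d. (4/5 :: real) ^ d * (r - l)) \<longlonglongrightarrow> 0 * (r - l)"
      by (intro tendsto_mult tendsto_const LIMSEQ_power_zero) auto
    then have "eventually (\<lambda>d. (4/5 :: real) ^ d * (r - l) < \<delta>) sequentially"
      using order_tendstoD(2) d by fastforce
    then obtain d where d: "(4/5 :: real) ^ d * (r - l) < \<delta>" by (auto simp: eventually_sequentially)
    obtain m u v where uv: "pullback (\<tau> 0) m u v l r" "v - u \<le> (4/5) ^ d * (r - l)"
      "(\<Sum>j<m. len j u v) \<le> 7 * M"
      using bounded_distortion_pullbacks by blast
    have uvl: "u < v" using pullback_less[OF uv(1)] .
    have "p \<in> {p..q}" "q \<in> {p..q}" using pq(1) by auto
  then have "p \<in> V" "q \<in> V" using pq(2) by blast+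
    then obtain w1 w2 where w: "w1 \<in> {u<..<v}" "w2 \<in> {u<..<v}" "(f ^^ m) w1 = p" "(f ^^ m) w2 = q"
      using pullback_image[OF uv(1)] by (metis imageE)
    define p' q' where "p' = min w1 w2" "q' = max w1 w2"
    have sub: "u \<le> p'" "q' \<le> v" "p' \<le> q'" using w unfolding p'_q'_def by auto
    have "(q - p) * (v - u) \<le> exp (C * (7 * M)) * ((r - l) * (q' - p'))"
      using four_point[OF pullback_reg'[OF uv(1) order_refl] uv(3), of w1 w2 u v]
        pullback_length[OF uv(1)] w uvl pq(1) unfolding p'_q'_def
      by (auto simp: min_def max_def abs_real_def split: if_splits)
    then have "\<kappa> * (v - u) \<le> q' - p'"
      using lr unfolding \<kappa>_def by (simp add: field_simps)
    moreover have "{p'<..<q'} \<inter> E = {}"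
    proof -
      have "(f ^^ m) y \<in> {p..q}" if "y \<in> {p'<..<q'}" for y
      proof -
        have "in_reg m {p'..q'}"
          using in_reg_subset[OF pullback_reg'[OF uv(1) order_refl]] sub by auto
        then have "(f ^^ m) ` {p'..q'} = closed_segment ((f ^^ m) p') ((f ^^ m) q')"
          using iter_closed_segment sub(3) by blast
        also have "\<dots> = {p..q}"
          using w pq(1) unfolding p'_q'_def closed_segment_eq_real_ivl by (auto simp: min_def max_def)
        finally show ?thesis using that by auto
      qed
      then show ?thesis using iterE pq(3) by blast
    qed
    moreover have "u < X (\<tau> 0)" "X (\<tau> 0) < v" using uv(1) unfolding pullback_def by auto
    ultimately show ?thesis using sub uv(2) d unfolding hole_near_def
      by (intro exI[of _ u] exI[of _ v] exI[of _ p'] exI[of _ q']) auto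
  qed
  then show ?thesis unfolding porous_at_def using k by blast
qed

context regular_orbit
begin

lemma orbit_porous:
  assumes D: "exp (C * M) \<le> 6 / 5"
    and E: "closed E" "f ` E \<subseteq> E" "E \<subseteq> nhd A \<rho>"
  shows "\<exists>N. porous_at E (X N)"
proof -
  from nice_interval_exists obtain k0 l r where *: "l < r"
    "(\<forall>j. (f ^^ j) l \<notin> {l<..<r}) \<and> (\<forall>j. (f ^^ j) r \<notin> {l<..<r})"
    "\<forall>N. \<exists>n\<ge>N. X n \<in> {l<..<r}"
    "\<forall>i n. k0 \<le> i \<longrightarrow> i \<le> n \<longrightarrow> X n \<in> {l<..<r} \<longrightarrow> (\<exists>u v. pullback i (n - i) u v l r)"
    by (elim exE conjE) blast
  interpret nice_interval f f' A \<rho> c C M x l r k0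
    by unfold_locales (use * D in \<open>simp_all add: nice_def\<close>)
  show ?thesis using porous_at_orbit[OF E] by blast
qed

lemma A_contains_no_interval:
  assumes "u < v" shows "\<exists>z. u < z \<and> z < v \<and> z \<notin> A"
proof (rule ccontr)
  assume "\<not> ?thesis"
  then have VA: "{u<..<v} \<subseteq> A" by auto
  then have reg: "in_reg j {u<..<v}" for j
    unfolding in_reg_def using A_near near_Reg by blast
  have mid: "(u + v) / 2 \<in> {u<..<v}" "(u + v) / 2 \<in> A" using assms VA by auto
  show False using few_visits[OF is_interval_oo reg visits[OF mid(2,1)]] .
qed

lemma gap_between:
  assumes uv: "u \<in> A" "v \<in> A" "u < v"
  shows "\<exists>e e'. u \<le> e \<and> e < e' \<and> e' \<le> v \<and> e \<in> A \<and> e' \<in> A \<and> {e<..<e'} \<inter> A = {}"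
proof -
  obtain z where z: "u < z" "z < v" "z \<notin> A" using A_contains_no_interval[OF uv(3)] by blast
  have L: "compact (A \<inter> {u..z})" "A \<inter> {u..z} \<noteq> {}"
    and R: "compact (A \<inter> {z..v})" "A \<inter> {z..v} \<noteq> {}"
    using compact_A z uv by (auto intro: compact_Int_closed)
  obtain e where e: "e \<in> A \<inter> {u..z}" "\<And>w. w \<in> A \<inter> {u..z} \<Longrightarrow> w \<le> e"
    using compact_attains_sup[OF L] by blast
  obtain e' where e': "e' \<in> A \<inter> {z..v}" "\<And>w. w \<in> A \<inter> {z..v} \<Longrightarrow> e' \<le> w"
    using compact_attains_inf[OF R] by blast
  have "e < z" "z < e'" using e(1) e'(1) z(3) by (auto simp: order.strict_iff_order)
  moreover have "w \<notin> A" if "w \<in> {e<..<e'}" for w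
  proof
    assume w: "w \<in> A"
    show False
    proof (cases "w \<le> z")
      case True
      then have "w \<le> e" using w that e(1) by (intro e(2)) auto
      then show False using that by simp
    next
      case False
      then have "e' \<le> w" using w that e'(1) by (intro e'(2)) auto
      then show False using that by simp
    qed
  qed
  ultimately show ?thesis using e(1) e'(1) by (intro exI[of _ e] exI[of _ e']) auto
qed

end

section \<open>Gaps\<close>

text \<open>The constant \<open>\<kappa>\<close> is so small that, by bounded distortion, pulling back the \<open>2\<kappa>\<close>-neighbourhood of
  the gap at most doubles the length of the pulled back gap.\<close>

locale gap_visit = regular_orbit +
  fixes e e' \<kappa> :: real and n :: nat
  assumes gap: "e < e'" "e \<in> A" "e' \<in> A" "{e<..<e'} \<inter> A = {}"
    and kappa: "\<kappa> = exp (- C * (\<rho> / 2 + 4 * M)) / 4"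
    and first: "\<And>m. m < n \<Longrightarrow> X m \<notin> {e - \<kappa> * (e' - e)..e' + \<kappa> * (e' - e)}"
    and visit: "X n \<in> {e - \<kappa> * (e' - e)..e' + \<kappa> * (e' - e)}"
begin

text \<open>The orbit reaches the \<open>\<kappa>\<close>-neighbourhood of the gap, relative to the
  gap length, but the \<open>2 * \<kappa>\<close>-neighbourhood is pulled back. This margin keeps
  the orbit away from the ends of the pullbacks, see \<open>gap_pullback_centred\<close>.\<close>

definition "P = e - 2 * \<kappa> * (e' - e)"
definition "Q = e' + 2 * \<kappa> * (e' - e)"

definition gap_pullback :: "nat \<Rightarrow> nat \<Rightarrow> real \<Rightarrow> real \<Rightarrow> real \<Rightarrow> real \<Rightarrow> bool" where
  "gap_pullback i m u v a b \<longleftrightarrow> pullback i m u v P Q \<and> i + m = n \<and> u \<le> a \<and> a < b \<and> b \<le> v \<and>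
     ((f ^^ m) a = e \<and> (f ^^ m) b = e' \<or> (f ^^ m) a = e' \<and> (f ^^ m) b = e)"

lemma kappa_bounds: "0 < \<kappa>" "4 * \<kappa> \<le> 1"
  using C_nonneg M_nonneg rho unfolding kappa by (auto simp: mult_nonneg_nonneg)

lemma kappa_distortion: "4 * \<kappa> * exp (C * (\<rho> / 2 + 4 * M)) = 1"
proof -
  have "4 * (exp (- C * S) / 4) * exp (C * S) = 1" for S by (simp add: exp_minus)
  then show ?thesis unfolding kappa by blast
qed

lemma PQ: "P < e" "e' < Q"
  using kappa_bounds gap(1) unfolding P_def Q_def by auto

lemma gap_pullbackD:
  assumes "gap_pullback i m u v a b"
  shows "pullback i m u v P Q" "i + m = n" "u \<le> a" "a < b" "b \<le> v" "(f ^^ m) ` {a<..<b} = {e<..<e'}"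
proof -
  show *: "pullback i m u v P Q" "i + m = n" "u \<le> a" "a < b" "b \<le> v"
    using assms unfolding gap_pullback_def by auto
  have "in_reg m {a..b}" using in_reg_subset[OF pullback_reg'[OF *(1) order_refl]] * by auto
  then show "(f ^^ m) ` {a<..<b} = {e<..<e'}"
    using iter_open_segment[OF *(4)] gap(1) assms unfolding gap_pullback_def open_segment_eq_real_ivl by auto
qed

text \<open>An orientation preserving return of a pulled back gap to the gap would map the interval between
  the orbit and the gap into itself.\<close>

lemma overlap_reverses:
  assumes pb: "gap_pullback i m u v a b" and d: "0 < d" "t + d = m"
    and w: "w \<in> (f ^^ t) ` {a<..<b}" "w \<in> {e<..<e'}"
  shows "\<forall>z\<in>(f ^^ t) ` {u..v}. Df d z < 0"
proof (rule ccontr)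
  define S where "S = (f ^^ t) ` {u..v}"
  define G where "G = (f ^^ t) ` {a<..<b}"
  note pb' = gap_pullbackD[OF pb]
  have regm: "in_reg (d + t) {u..v}" using pullback_reg'[OF pb'(1), of m] d by (simp add: add.commute)
  have regS: "in_reg d S" unfolding S_def by (rule in_reg_shift[OF regm])
  have intS: "is_interval S" unfolding S_def
    using is_interval_connected_1 connected_continuous_image[OF continuous_on_iter connected_Icc] by blast
  have intG: "is_interval G" unfolding G_def by (rule iter_interval)
  have GS: "G \<subseteq> S" unfolding G_def S_def using pb' by (intro image_mono) auto
  assume "\<not> ?thesis"
  then have pos: "\<forall>z\<in>S. Df d z > 0" using Df_sign[OF intS regS] unfolding S_def by blast
  have inc: "(f ^^ d) z \<le> (f ^^ d) w" if "z \<in> S" "w \<in> S" "z \<le> w" for z w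
    using iter_increasing[OF intS pos that(1,2)] that(3) by (cases "z = w") auto
  have ft: "(f ^^ d) ((f ^^ t) z) = (f ^^ m) z" for z
    using funpow_apply_add[of d t f z] d by (simp add: add.commute)
  have Gd: "(f ^^ d) y \<in> {e<..<e'}" if y: "y \<in> G" for y
  proof -
    obtain y' where "y' \<in> {a<..<b}" "y = (f ^^ t) y'" using y unfolding G_def by blast
    then have "(f ^^ d) y \<in> (f ^^ m) ` {a<..<b}" using ft by auto
    then show ?thesis unfolding pb'(6) .
  qed
  have GA: "y \<notin> A" if "y \<in> G" for y using Gd[OF that] iter_A gap(4) by blast
  have Xt: "X (i + t) \<in> S" unfolding S_def using X_shift pb'(1) unfolding pullback_def by auto
  have Xn: "(f ^^ d) (X (i + t)) = X n" using X_shift[of "i + t" d] d pb'(2) by (simp add: add.assoc)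
  have t: "i + t < n" using d pb'(2) by simp
  have w': "w \<in> G" "w \<in> S" using w GS unfolding G_def by auto
  have orbit: False if J: "is_interval J" "J \<subseteq> S" "X (i + t) \<in> J" "\<And>z. z \<in> J \<Longrightarrow> (f ^^ d) z \<in> J" for J
  proof (rule trap_interval[OF d(1) _ J(1) in_reg_subset[OF regS J(2)]])
    show "X (i + t + k * d) \<in> J" for k
    proof (induction k)
      case (Suc k)
      have "X (i + t + Suc k * d) = (f ^^ d) (X (i + t + k * d))"
        using X_shift[of "i + t + k * d" d] by (simp add: algebra_simps)
      then show ?case using J(4)[OF Suc] by simp
    qed (use J(3) in simp)
  qed
  from first[OF t] consider "X (i + t) < e - \<kappa> * (e' - e)" | "X (i + t) > e' + \<kappa> * (e' - e)" by fastforce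
  then show False
  proof cases
    case 1
    have "0 < \<kappa> * (e' - e)" using kappa_bounds gap by simp
    then have Xe: "X (i + t) < e" using 1 by linarith
    then have eS: "e \<in> S" using mem_is_interval_1_I[OF intS Xt w'(2)] w(2) by auto
    have ew: "(f ^^ d) e \<le> (f ^^ d) w" using inc[OF eS w'(2)] w(2) by auto
    \<comment> \<open>The image of \<open>e\<close> is in \<open>A\<close>, hence outside the gap,
      and lies below the image of \<open>w\<close>, which is inside the gap.\<close>
    have "(f ^^ d) e \<le> e"
    proof -
      have "(f ^^ d) e \<notin> {e<..<e'}" using iter_A[OF gap(2)] gap(4) by blast
      then show ?thesis using Gd[OF w'(1)] ew by auto
    qed
    moreover have "X (i + t) \<le> X n" using visit 1 by auto
    moreover have JS: "{X (i + t)..e} \<subseteq> S" using mem_is_interval_1_I[OF intS Xt eS] by auto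
    ultimately have "(f ^^ d) z \<in> {X (i + t)..e}" if "z \<in> {X (i + t)..e}" for z
    proof -
      have "z \<in> S" using that JS by blast
      then have "X n \<le> (f ^^ d) z" "(f ^^ d) z \<le> (f ^^ d) e"
        using inc[OF Xt, of z] inc[OF _ eS, of z] that Xn by auto
      then show ?thesis using \<open>(f ^^ d) e \<le> e\<close> \<open>X (i + t) \<le> X n\<close> by auto
    qed
    then show False using orbit[OF is_interval_cc JS] Xe by simp
  next
    case 2
    have "0 < \<kappa> * (e' - e)" using kappa_bounds gap by simp
    then have Xe: "e' < X (i + t)" using 2 by linarith
    then have eS: "e' \<in> S" using mem_is_interval_1_I[OF intS w'(2) Xt] w(2) by auto
    have ew: "(f ^^ d) w \<le> (f ^^ d) e'" using inc[OF w'(2) eS] w(2) by auto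
    have "e' \<le> (f ^^ d) e'"
    proof -
      have "(f ^^ d) e' \<notin> {e<..<e'}" using iter_A[OF gap(3)] gap(4) by blast
      then show ?thesis using Gd[OF w'(1)] ew by auto
    qed
    moreover have "X n \<le> X (i + t)" using visit 2 by auto
    moreover have JS: "{e'..X (i + t)} \<subseteq> S" using mem_is_interval_1_I[OF intS eS Xt] by auto
    ultimately have "(f ^^ d) z \<in> {e'..X (i + t)}" if "z \<in> {e'..X (i + t)}" for z
    proof -
      have "z \<in> S" using that JS by blast
      then have "(f ^^ d) e' \<le> (f ^^ d) z" "(f ^^ d) z \<le> X n"
        using inc[OF eS, of z] inc[OF _ Xt, of z] that Xn by auto
      then show ?thesis using \<open>e' \<le> (f ^^ d) e'\<close> \<open>X n \<le> X (i + t)\<close> by auto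
    qed
    then show False using orbit[OF is_interval_cc JS] Xe by simp
  qed
qed

text \<open>Parity: three overlapping images yield two returns to the gap and a third one that
  closes the triangle. All reverse orientation by \<open>overlap_reverses\<close>, yet one is the
  composition of the other two.\<close>

lemma gap_multiplicity:
  assumes pb: "gap_pullback i m u v a b"
  shows "card {j. j < m \<and> z \<in> (f ^^ j) ` {a<..<b}} \<le> 2"
proof (rule card_le_2I)
  note pb' = gap_pullbackD[OF pb]
  fix j1 j2 j3 assume j: "j1 \<in> {j. j < m \<and> z \<in> (f ^^ j) ` {a<..<b}}"
    "j2 \<in> {j. j < m \<and> z \<in> (f ^^ j) ` {a<..<b}}" "j3 \<in> {j. j < m \<and> z \<in> (f ^^ j) ` {a<..<b}}"
    "j1 < j2" "j2 < j3"
  then obtain z1 z2 z3 where z: "z1 \<in> {a<..<b}" "z2 \<in> {a<..<b}" "z3 \<in> {a<..<b}"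
    "z = (f ^^ j1) z1" "z = (f ^^ j2) z2" "z = (f ^^ j3) z3" by blast
  \<comment> \<open>Moving forward until the latest of the three images becomes the gap
    itself.\<close>
  define p where "p = (f ^^ (m - j3)) z"
  define t1 t2 where "t1 = m - j3 + j1" "t2 = m - j3 + j2"
  have t: "t1 < t2" "t2 < m" using j unfolding t1_t2_def by auto
  have p1: "p = (f ^^ t1) z1" "p = (f ^^ t2) z2"
    unfolding p_def t1_t2_def funpow_apply_add using z by simp_all
  have p3: "p = (f ^^ m) z3"
    unfolding p_def z(6) using funpow_apply_add[of "m - j3" j3 f z3] j by simp
  have pG: "p \<in> {e<..<e'}" unfolding p3 using pb'(6) z(3) by (metis imageI)
  have sub: "{a<..<b} \<subseteq> {u..v}" using pb' by auto
  have neg1: "Df (m - t1) p < 0"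
    using overlap_reverses[OF pb, of "m - t1" t1 p] t p1(1) pG z(1) sub by auto
  have neg2: "Df (m - t2) p < 0"
    using overlap_reverses[OF pb, of "m - t2" t2 p] t p1(2) pG z(2) sub by auto
  define q where "q = (f ^^ (m - t2)) p"
  have "q = (f ^^ m) z2" unfolding q_def p1(2) using funpow_apply_add[of "m - t2" t2 f z2] t by simp
  then have qG: "q \<in> {e<..<e'}" using pb'(6) z(2) by (metis imageI)
  have q1: "q = (f ^^ (m - t2 + t1)) z1" unfolding q_def p1(1) by (simp add: funpow_apply_add)
  have "Df (t2 - t1) q < 0"
    using overlap_reverses[OF pb, of "t2 - t1" "m - t2 + t1" q] t q1 qG z(1) sub by auto
  then have "Df (t2 - t1) q * Df (m - t2) p > 0" using neg2 by (rule mult_neg_neg)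
  moreover have "Df (m - t1) p = Df (t2 - t1) q * Df (m - t2) p"
    using Df_add[of "t2 - t1" "m - t2" p] t unfolding q_def by simp
  ultimately show False using neg1 by simp
qed simp

lemma gap_pullback_sum:
  assumes pb: "gap_pullback i m u v a b"
  shows "(\<Sum>j<m. len j a b) \<le> 2 * M"
proof -
  note pb' = gap_pullbackD[OF pb]
  have "in_reg m {a..b}" using in_reg_subset[OF pullback_reg'[OF pb'(1) order_refl]] pb' by auto
  then show ?thesis using sum_lengths_le[OF pb'(4) _ gap_multiplicity[OF pb]] by simp
qed

lemma gap_pullback_exists:
  assumes pb: "pullback i m u v P Q" "i + m = n"
  shows "\<exists>a b. gap_pullback i m u v a b"
proof -
  have "e \<in> {P..Q}" "e' \<in> {P..Q}" using PQ gap(1) by auto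
  then obtain w1 w2 where w: "w1 \<in> {u..v}" "w2 \<in> {u..v}" "(f ^^ m) w1 = e" "(f ^^ m) w2 = e'"
    using pullback_image_closed[OF pb(1)] by (metis imageE)
  then have "w1 \<noteq> w2" using gap(1) by auto
  then show ?thesis using w pb gap(1) unfolding gap_pullback_def
    by (intro exI[of _ "min w1 w2"] exI[of _ "max w1 w2"]) (auto simp: min_def max_def)
qed

text \<open>Strong induction on \<open>m\<close>: at times \<open>0 < j\<close> the image is a gap
  pullback with fewer steps, hence at most twice its gap, and the gaps have total length at most
  \<open>2 * M\<close>. Time 0, where comparability is still to be shown, is bounded by
  \<open>\<rho> / 2\<close>. The resulting sum is the one built into \<open>\<kappa>\<close>, so
  each side piece is at most half the pulled back gap.\<close>

lemma gap_pullback_comparable: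
  assumes "gap_pullback i m u v a b"
  shows "v - u \<le> 2 * (b - a) \<and> (\<Sum>j<m. len j u v) \<le> \<rho> / 2 + 4 * M"
  using assms
proof (induction m arbitrary: i u v a b rule: less_induct)
  case (less m)
  note pb = less.prems
  note pb' = gap_pullbackD[OF pb]
  have uv: "u < v" using pb' by linarith
  have reg: "in_reg m {u..v}" using pullback_reg'[OF pb'(1) order_refl] .
  have tail: "len j u v \<le> 2 * len j a b" if j: "0 < j" "j \<le> m" for j
  proof -
    let ?u = "min ((f ^^ j) u) ((f ^^ j) v)" let ?v = "max ((f ^^ j) u) ((f ^^ j) v)"
    let ?a = "min ((f ^^ j) a) ((f ^^ j) b)" let ?b = "max ((f ^^ j) a) ((f ^^ j) b)"
    have regj: "in_reg j {u..v}" using reg in_reg_le j by blast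
    have "(f ^^ j) ` {u..v} = {?u..?v}"
      using iter_closed_segment[OF less_imp_le[OF uv] regj] unfolding closed_segment_eq_real_ivl
      by (simp add: min_def max_def)
    then have in_uv: "(f ^^ j) a \<in> {?u..?v}" "(f ^^ j) b \<in> {?u..?v}" using pb' by (metis (no_types, lifting)
        atLeastAtMost_iff image_eqI less_le_trans less_imp_le order_trans)+
    have ne: "(f ^^ j) a \<noteq> (f ^^ j) b"
      using iter_inj[OF is_interval_cc regj] pb' unfolding inj_on_def by force
    have fm: "(f ^^ (m - j)) ((f ^^ j) z) = (f ^^ m) z" for z
      using funpow_apply_add[of "m - j" j f z] j by simp
    have "gap_pullback (i + j) (m - j) ?u ?v ?a ?b"
      unfolding gap_pullback_def
    proof (intro conjI)
      show "pullback (i + j) (m - j) ?u ?v P Q" using pullback_tail[OF pb'(1) j(2)] .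
      show "i + j + (m - j) = n" using pb'(2) j by simp
      show "?u \<le> ?a" "?b \<le> ?v" using in_uv by (auto simp: min_def max_def split: if_splits)
      show "?a < ?b" using ne by auto
      show "(f ^^ (m - j)) ?a = e \<and> (f ^^ (m - j)) ?b = e' \<or> (f ^^ (m - j)) ?a = e' \<and> (f ^^ (m - j)) ?b = e"
        using pb fm unfolding gap_pullback_def by (auto simp: min_def max_def)
    qed
    then have "?v - ?u \<le> 2 * (?b - ?a)" using less.IH[of "m - j"] j by auto
    then show ?thesis by (auto simp: min_def max_def split: if_splits)
  qed
  have sum: "(\<Sum>j<m. len j u v) \<le> \<rho> / 2 + 4 * M"
  proof (cases m)
    case 0
    then show ?thesis using rho M_nonneg by simp
  next
    case (Suc k)
    have "(\<Sum>j<m. len j u v) = \<bar>u - v\<bar> + (\<Sum>j<k. len (Suc j) u v)"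
      unfolding Suc by (subst sum.lessThan_Suc_shift) simp
    also have "\<dots> \<le> \<rho> / 2 + (\<Sum>j<k. 2 * len (Suc j) a b)"
    proof (intro add_mono sum_mono tail)
      show "\<bar>u - v\<bar> \<le> \<rho> / 2" using pb'(1) unfolding pullback_def by (auto dest: spec[of _ 0])
    qed (use Suc in auto)
    also have "(\<Sum>j<k. 2 * len (Suc j) a b) \<le> 2 * (\<Sum>j<m. len j a b)"
      unfolding Suc sum.lessThan_Suc_shift sum_distrib_left[symmetric] by simp
    also have "\<dots> \<le> 2 * (2 * M)" using gap_pullback_sum[OF pb] by linarith
    finally show ?thesis by simp
  qed
  define D where "D = exp (C * (\<rho> / 2 + 4 * M))"
  have D: "0 < D" "4 * \<kappa> * D = 1" unfolding D_def using kappa_distortion by auto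
  have fp: "len m w w' * \<bar>y - y'\<bar> \<le> D * (len m y y' * \<bar>w - w'\<bar>)"
    if "w \<in> {u..v}" "w' \<in> {u..v}" "y \<in> {u..v}" "y' \<in> {u..v}" for w w' y y'
    using four_point[OF reg sum that] unfolding D_def .
  have mem: "u \<in> {u..v}" "v \<in> {u..v}" "a \<in> {u..v}" "b \<in> {u..v}" using pb' by auto
  define g where "g = e' - e"
  have g: "0 < g" using gap(1) unfolding g_def by simp
  have ends: "len m u a = 2 * \<kappa> * g" "len m v b = 2 * \<kappa> * g"
  proof -
    have kg: "2 * \<kappa> * g > 0" using kappa_bounds g by simp
    from iter_monotone[OF is_interval_cc reg]
    have "((f ^^ m) u = P \<and> (f ^^ m) v = Q \<and> (f ^^ m) a = e \<and> (f ^^ m) b = e') \<or>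
          ((f ^^ m) u = Q \<and> (f ^^ m) v = P \<and> (f ^^ m) a = e' \<and> (f ^^ m) b = e)"
    proof
      assume "\<forall>z\<in>{u..v}. \<forall>w\<in>{u..v}. z < w \<longrightarrow> (f ^^ m) z < (f ^^ m) w"
      then have "(f ^^ m) u < (f ^^ m) v" "(f ^^ m) a < (f ^^ m) b" using mem uv pb'(4) by blast+
      then show ?thesis using pb gap(1) PQ unfolding gap_pullback_def pullback_def by auto
    next
      assume "\<forall>z\<in>{u..v}. \<forall>w\<in>{u..v}. z < w \<longrightarrow> (f ^^ m) z > (f ^^ m) w"
      then have "(f ^^ m) u > (f ^^ m) v" "(f ^^ m) a > (f ^^ m) b" using mem uv pb'(4) by blast+
      then show ?thesis using pb gap(1) PQ unfolding gap_pullback_def pullback_def by auto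
    qed
    then show "len m u a = 2 * \<kappa> * g" "len m v b = 2 * \<kappa> * g"
      using kg unfolding P_def Q_def g_def by auto
  qed
  have gab: "len m a b = g" using pb gap(1) unfolding gap_pullback_def g_def by auto
  have half: "\<bar>y - y'\<bar> \<le> (b - a) / 2"
    if "y \<in> {u..v}" "y' \<in> {u..v}" "len m y y' = 2 * \<kappa> * g" for y y'
  proof -
    have "g * \<bar>y - y'\<bar> \<le> D * (2 * \<kappa> * g * (b - a))"
      using fp[OF mem(3,4) that(1,2)] pb'(4) unfolding gab that(3) by simp
    also have "\<dots> = g * ((4 * \<kappa> * D) * (b - a) / 2)" by simp
    finally show ?thesis using g unfolding D(2) by simp
  qed
  have "\<bar>u - a\<bar> \<le> (b - a) / 2" "\<bar>v - b\<bar> \<le> (b - a) / 2" using half mem ends by blast+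
  then have "v - u \<le> 2 * (b - a)" using pb' by auto
  then show ?case using sum by blast
qed

text \<open>At time \<open>n\<close> the distance from the orbit to either end is at least the share
  \<open>\<kappa> / (1 + 4 * \<kappa>)\<close> of \<open>{P..Q}\<close>; the distortion
  \<open>1 / (4 * \<kappa>)\<close> turns this into the stated constant.\<close>

lemma gap_pullback_centred:
  assumes "gap_pullback i m u v a b"
  shows "4 * \<kappa>^2 / (1 + 4 * \<kappa>) * (v - u) \<le> X i - u" "4 * \<kappa>^2 / (1 + 4 * \<kappa>) * (v - u) \<le> v - X i"
proof -
  note pb' = gap_pullbackD[OF assms]
  define D where "D = exp (C * (\<rho> / 2 + 4 * M))"
  have D: "0 < D" "4 * \<kappa> * D = 1" unfolding D_def using kappa_distortion by auto
  define g where "g = e' - e"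
  have g: "0 < g" using gap(1) unfolding g_def by simp
  have Xi: "u < X i" "X i < v" using pb'(1) unfolding pullback_def by auto
  have Xm: "(f ^^ m) (X i) = X n" using X_shift[of i m] pb'(2) by simp
  have len: "len m u v = (1 + 4 * \<kappa>) * g"
    using pullback_length[OF pb'(1)] unfolding P_def Q_def g_def by (simp add: algebra_simps)
  have *: "4 * \<kappa>^2 / (1 + 4 * \<kappa>) * (v - u) \<le> \<bar>X i - w\<bar>" if w: "w = u \<or> w = v" for w
  proof -
    have "(f ^^ m) w = P \<or> (f ^^ m) w = Q" using pb'(1) w unfolding pullback_def by auto
    then have "\<kappa> * g \<le> \<bar>X n - (f ^^ m) w\<bar>"
      using visit kappa_bounds g unfolding P_def Q_def g_def by (auto simp: abs_real_def)
    then have "\<kappa> * g * (v - u) \<le> len m (X i) w * \<bar>u - v\<bar>"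
      using Xi unfolding Xm by (simp add: mult_right_mono)
    also have "\<dots> \<le> D * ((1 + 4 * \<kappa>) * g * \<bar>X i - w\<bar>)"
      using four_point[OF pullback_reg'[OF pb'(1) order_refl]
          gap_pullback_comparable[OF assms, THEN conjunct2], of "X i" w u v] Xi w
      unfolding D_def len by auto
    finally have "g * (\<kappa> * (v - u)) \<le> g * (D * (1 + 4 * \<kappa>) * \<bar>X i - w\<bar>)" by (simp add: mult_ac)
    then have "\<kappa> * (v - u) \<le> D * (1 + 4 * \<kappa>) * \<bar>X i - w\<bar>" using g by simp
    then have "(4 * \<kappa>) * (\<kappa> * (v - u)) \<le> (4 * \<kappa>) * (D * (1 + 4 * \<kappa>) * \<bar>X i - w\<bar>)"
      using kappa_bounds by (intro mult_left_mono) auto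
    also have "\<dots> = (4 * \<kappa> * D) * (1 + 4 * \<kappa>) * \<bar>X i - w\<bar>" by (simp only: mult_ac)
    finally have "4 * \<kappa>^2 * (v - u) \<le> (1 + 4 * \<kappa>) * \<bar>X i - w\<bar>"
      unfolding D(2) by (simp add: power2_eq_square mult_ac)
    then show ?thesis using kappa_bounds by (simp add: field_simps)
  qed
  show "4 * \<kappa>^2 / (1 + 4 * \<kappa>) * (v - u) \<le> X i - u" "4 * \<kappa>^2 / (1 + 4 * \<kappa>) * (v - u) \<le> v - X i"
    using *[of u] *[of v] Xi by auto
qed

end

context regular_orbit
begin

text \<open>Gaps inside the shrinking hulls are pulled back to \<open>x\<close>, where they fill at
  least half of the pullback. These pullbacks become short: otherwise long ones would accumulate on
  an interval as in \<open>small_interval\<close>, and centring would put a limit of orbit points in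
  its interior, although the orbit avoids that interval.\<close>

lemma porous_at_A:
  assumes xA: "x \<in> A"
  shows "porous_at A x"
proof -
  have XA: "X i \<in> A" for i using iter_A[OF xA] .
  obtain g :: "nat \<Rightarrow> nat \<Rightarrow> real" where g: "\<And>k j. j \<le> 4 \<Longrightarrow> g k j \<in> A"
    "\<And>k i j. i < j \<Longrightarrow> j \<le> 4 \<Longrightarrow> g k i < g k j"
    "\<And>z. finite {k. g k 0 < z \<and> z < g k 4}" "(\<lambda>k. g k 4 - g k 0) \<longlonglongrightarrow> 0"
    using shrinking_quintuples[OF infinite_A compact_imp_bounded[OF compact_A]] by blast
  have "\<forall>k. \<exists>e e'. g k 0 \<le> e \<and> e < e' \<and> e' \<le> g k 4 \<and> e \<in> A \<and> e' \<in> A \<and> {e<..<e'} \<inter> A = {}"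
    using gap_between g(1,2) by simp
  then obtain e e' where gap: "\<And>k. g k 0 \<le> e k" "\<And>k. e k < e' k" "\<And>k. e' k \<le> g k 4"
    "\<And>k. e k \<in> A" "\<And>k. e' k \<in> A" "\<And>k. {e k<..<e' k} \<inter> A = {}"
    by metis
  have len: "(\<lambda>k. e' k - e k) \<longlonglongrightarrow> 0"
  proof (rule tendsto_sandwich[OF _ _ tendsto_const g(4)])
    show "eventually (\<lambda>k. 0 \<le> e' k - e k) sequentially"
      using gap(2) less_imp_le by (intro always_eventually) auto
    show "eventually (\<lambda>k. e' k - e k \<le> g k 4 - g k 0) sequentially"
      using gap(1,3) by (intro always_eventually allI diff_mono) auto
  qed
  define \<kappa> where "\<kappa> = exp (- C * (\<rho> / 2 + 4 * M)) / 4"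
  have k0: "0 < \<kappa>" unfolding \<kappa>_def by simp
  define N where "N k = {e k - \<kappa> * (e' k - e k)..e' k + \<kappa> * (e' k - e k)}" for k
  define n where "n k = (LEAST m. X m \<in> N k)" for k
  have "\<exists>m. X m \<in> N k" for k
  proof -
    have "0 < \<kappa> * (e' k - e k)" using k0 gap(2) by simp
    then have "e k \<in> {e k - \<kappa> * (e' k - e k)<..<e' k + \<kappa> * (e' k - e k)}" using gap(2)[of k] by auto
    then obtain m where "X m \<in> {e k - \<kappa> * (e' k - e k)<..<e' k + \<kappa> * (e' k - e k)}"
      using visits[OF gap(4)] by blast
    then show ?thesis unfolding N_def by (intro exI[of _ m]) auto
  qed
  then have vis: "X (n k) \<in> N k" for k unfolding n_def by (rule LeastI_ex)
  have "m < n k \<Longrightarrow> X m \<notin> N k" for k m unfolding n_def using not_less_Least by blast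
  then have gv: "gap_visit f f' A \<rho> c C M x (e k) (e' k) \<kappa> (n k)" for k
    using vis gap unfolding N_def by unfold_locales (auto simp: \<kappa>_def)
  define p q where "p k = gap_visit.P (e k) (e' k) \<kappa>" and "q k = gap_visit.Q (e k) (e' k) \<kappa>" for k
  have pq: "p k = e k - 2 * \<kappa> * (e' k - e k)" "q k = e' k + 2 * \<kappa> * (e' k - e k)" for k
    using gap_visit.P_def[OF gv] gap_visit.Q_def[OF gv] unfolding p_def q_def by auto
  have gap_pb: "\<exists>a b. u \<le> a \<and> a < b \<and> b \<le> v \<and> (f ^^ m) ` {a<..<b} = {e k<..<e' k} \<and>
      v - u \<le> 2 * (b - a) \<and> 4 * \<kappa>^2 / (1 + 4 * \<kappa>) * (v - u) \<le> X i - u \<and>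
      4 * \<kappa>^2 / (1 + 4 * \<kappa>) * (v - u) \<le> v - X i"
    if pb: "pullback i m u v (p k) (q k)" "i + m = n k" for i m u v k
  proof -
    obtain a b where ab: "gap_visit.gap_pullback f \<rho> x (e k) (e' k) \<kappa> (n k) i m u v a b"
      using gap_visit.gap_pullback_exists[OF gv] pb unfolding p_def q_def by blast
    show ?thesis
      using gap_visit.gap_pullbackD[OF gv ab] gap_visit.gap_pullback_comparable[OF gv ab]
        gap_visit.gap_pullback_centred[OF gv ab] by blast
  qed
  have key: "\<exists>k u v. pullback 0 (n k) u v (p k) (q k) \<and> v - u \<le> \<eta>"
    if eta: "0 < \<eta>" "\<eta> \<le> c * (\<rho> / 2)" for \<eta>
  proof (rule ccontr)
    assume no: "\<not> ?thesis"
    have qp: "q k - p k = (1 + 4 * \<kappa>) * (e' k - e k)" for k unfolding pq by (simp add: algebra_simps)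
    have lim: "(\<lambda>k. q k - p k) \<longlonglongrightarrow> 0"
      using tendsto_mult[OF tendsto_const len, of "1 + 4 * \<kappa>"] unfolding qp by simp
    have "eventually (\<lambda>k. q k - p k < \<eta>) sequentially" using order_tendstoD(2)[OF lim eta(1)] .
    then obtain K where K: "\<And>k. k \<ge> K \<Longrightarrow> q k - p k < \<eta>"
      unfolding eventually_sequentially by blast
    have "\<forall>k. \<exists>j m u v. j + m = n (k + K) \<and> pullback j m u v (p (k + K)) (q (k + K)) \<and> \<eta> < v - u"
    proof
      fix k0
      define k where "k = k0 + K"
      have "0 < \<kappa> * (e' k - e k)" using k0 gap(2) by simp
      then have "X (n k) \<in> {p k<..<q k}" using vis[of k] unfolding N_def pq by auto
      moreover have "q k - p k \<le> \<eta>" using K[of k] unfolding k_def by simp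
      moreover have "\<nexists>u v. pullback 0 (n k - 0) u v (p k) (q k) \<and> v - u \<le> \<eta>" using no by auto
      ultimately show "\<exists>j m u v. j + m = n (k0 + K) \<and> pullback j m u v (p (k0 + K)) (q (k0 + K)) \<and> \<eta> < v - u"
        using pullback_failure[of "n k" "p k" "q k" \<eta> 0] eta(2) unfolding k_def by blast
    qed
    then obtain i m u v where *: "\<And>k. i k + m k = n (k + K)"
      "\<And>k. pullback (i k) (m k) (u k) (v k) (p (k + K)) (q (k + K))" "\<And>k. \<eta> < v k - u k"
      by metis
    have small: "len j (u k) (v k) \<le> \<rho> / 2" if "j \<le> m k" for k j
      using *(2) that unfolding pullback_def by auto
    have Xi: "u k < X (i k)" "X (i k) < v k" for k using *(2) unfolding pullback_def by auto
    have m: "filterlim m at_top sequentially"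
    proof (rule times_unbounded)
      show "in_reg (m k) {u k..v k}" for k using pullback_reg'[OF *(2)] by simp
      have "(\<lambda>k. q (k + K) - p (k + K)) \<longlonglongrightarrow> 0" using lim by (rule LIMSEQ_ignore_initial_segment)
      then show "(\<lambda>k. len (m k) (u k) (v k)) \<longlonglongrightarrow> 0"
        using pullback_length[OF *(2)] by simp
    qed (use *(3) eta(1) less_imp_le in auto)
    have "\<exists>h a b y. strict_mono (h :: nat \<Rightarrow> nat) \<and> (\<lambda>k. u (h k)) \<longlonglongrightarrow> a \<and> (\<lambda>k. v (h k)) \<longlonglongrightarrow> b \<and>
      (\<lambda>k. X (i (h k))) \<longlonglongrightarrow> y \<and> a < b \<and> y \<in> {a..b} \<and> (\<forall>j. len j a b \<le> \<rho> / 2)"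
      using *(3) by (intro small_limit[where i = i and n = m and u = u and v = v and \<eta> = \<eta>] Xi small eta m)
        (auto intro: less_imp_le)
    then obtain h a b y where h: "(\<lambda>k. u (h k)) \<longlonglongrightarrow> a" "(\<lambda>k. v (h k)) \<longlonglongrightarrow> b"
      "(\<lambda>k. X (i (h k))) \<longlonglongrightarrow> y" "a < b" "y \<in> {a..b}" "\<And>j. len j a b \<le> \<rho> / 2"
      by blast
    define \<theta> where "\<theta> = 4 * \<kappa>^2 / (1 + 4 * \<kappa>)"
    have th: "0 < \<theta>" using k0 unfolding \<theta>_def by (intro divide_pos_pos) auto
    have centred: "\<theta> * \<eta> \<le> X (i k) - u k" "\<theta> * \<eta> \<le> v k - X (i k)" for k
    proof -
      have "\<theta> * \<eta> \<le> \<theta> * (v k - u k)" using th *(3)[of k] by (intro mult_left_mono) auto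
      then show "\<theta> * \<eta> \<le> X (i k) - u k" "\<theta> * \<eta> \<le> v k - X (i k)"
        using gap_pb[OF *(2,1), of k] unfolding \<theta>_def by auto
    qed
    have "\<theta> * \<eta> \<le> y - a" "\<theta> * \<eta> \<le> b - y"
      using tendsto_lowerbound[OF tendsto_diff[OF h(3,1)]] tendsto_lowerbound[OF tendsto_diff[OF h(2,3)]]
        centred by auto
    moreover have "0 < \<theta> * \<eta>" using th eta by simp
    ultimately have y: "a < y" "y < b" by linarith+
    \<comment> \<open>The times \<open>i k\<close> need not tend to infinity here; the limit lies in
      \<open>A\<close> because the whole orbit does and \<open>A\<close> is closed.\<close>
    have yA: "y \<in> A"
      using closed_sequentially[OF compact_imp_closed[OF compact_A] _ h(3)] XA by blast
    have "X i \<notin> {a..b}" for i using small_interval[OF h(4,6,5) yA] by blast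
    moreover have "eventually (\<lambda>k. a < X (i (h k)) \<and> X (i (h k)) < b) sequentially"
      using order_tendstoD[OF h(3)] y by (intro eventually_conj) auto
    then obtain k where "a < X (i (h k))" "X (i (h k)) < b" by (auto simp: eventually_sequentially)
    ultimately show False by (metis atLeastAtMost_iff less_imp_le)
  qed
  have "hole_near A (1/2) \<delta> x" if d: "\<delta> > 0" for \<delta>
  proof -
    define \<eta> where "\<eta> = min (\<delta> / 2) (c * (\<rho> / 2))"
    have eta: "0 < \<eta>" "\<eta> \<le> c * (\<rho> / 2)" "\<eta> < \<delta>" using d c_pos rho unfolding \<eta>_def by auto
    obtain k u v where uv: "pullback 0 (n k) u v (p k) (q k)" "v - u \<le> \<eta>" using key[OF eta(1,2)] by blast
    obtain a b where ab: "u \<le> a" "a < b" "b \<le> v" "(f ^^ n k) ` {a<..<b} = {e k<..<e' k}" "v - u \<le> 2 * (b - a)"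
      using gap_pb[OF uv(1)] by auto
    have "{a<..<b} \<inter> A = {}" using ab(4) iter_A gap(6)[of k] by (metis disjoint_iff imageI)
    moreover have "u < x" "x < v" using uv(1) unfolding pullback_def by auto
    moreover have "v - u < \<delta>" "1/2 * (v - u) \<le> b - a" using uv(2) eta(3) ab(5) by auto
    ultimately show ?thesis using ab(1,3) unfolding hole_near_def by blast
  qed
  then show ?thesis unfolding porous_at_def by (intro exI[of _ "1/2"]) auto
qed

end

section \<open>Porous sets are null\<close>

lemma lmeasurable_outer_open:
  fixes S :: "real set"
  assumes S: "S \<in> lmeasurable" and e: "0 < e"
  shows "\<exists>T. open T \<and> S \<subseteq> T \<and> T \<in> lmeasurable \<and> measure lebesgue T < measure lebesgue S + e"
proof -
  obtain T where T: "open T" "S \<subseteq> T" "T - S \<in> lmeasurable" "emeasure lebesgue (T - S) < ennreal e"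
    using sets_lebesgue_outer_open[OF fmeasurableD[OF S] e] by blast
  have eq: "S \<union> (T - S) = T" using T(2) by blast
  have "measure lebesgue (S \<union> (T - S)) \<le> measure lebesgue S + measure lebesgue (T - S)"
    using S T(3) by (intro measure_Un_le) auto
  moreover have "measure lebesgue (T - S) < e"
    using T(3,4) e by (simp add: emeasure_eq_measure2 ennreal_less_iff)
  moreover have "S \<union> (T - S) \<in> lmeasurable" using S T(3) by (rule fmeasurable.Un)
  ultimately show ?thesis using T(1,2) unfolding eq by (intro exI[of _ T]) auto
qed

text \<open>A covering of the porous points by disjoint intervals with proportional holes lowers their
  outer measure by a fixed factor.\<close>

lemma negligible_uniformly_porous:
  fixes T E :: "real set"
  assumes TE: "T \<subseteq> E" and E: "E \<in> lmeasurable" and \<kappa>: "0 < \<kappa>"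
    and por: "\<And>z \<delta>. z \<in> T \<Longrightarrow> 0 < \<delta> \<Longrightarrow> hole_near E \<kappa> \<delta> z"
  shows "negligible T"
proof -
  define \<mu> where "\<mu> = measure (lebesgue :: real measure)"
  have step: "\<exists>B\<in>lmeasurable. T \<subseteq> B \<and> \<mu> B \<le> (1 - \<kappa>) * \<mu> U"
    if U: "open U" "T \<subseteq> U" "U \<in> lmeasurable" and k1: "\<kappa> \<le> 1" for U
  proof -
    \<comment> \<open>By porosity these intervals form a Vitali cover of \<open>T\<close>, and each
      meets \<open>E\<close> in at most the share \<open>1 - \<kappa>\<close> of its length.\<close>
    define K where "K = {(u, v). u < v \<and> {u..v} \<subseteq> U \<and>
      (\<exists>p q. u \<le> p \<and> q \<le> v \<and> \<kappa> * (v - u) \<le> q - p \<and> {p<..<q} \<inter> E = {})}"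
    define a r where "a w = (fst w + snd w) / 2" and "r w = (snd w - fst w) / 2" for w :: "real \<times> real"
    have cb: "cball (a w) (r w) = {fst w..snd w}" for w
      unfolding cball_eq_atLeastAtMost a_def r_def by (simp add: field_simps)
    obtain D where D: "countable D" "D \<subseteq> K"
      "pairwise (\<lambda>i j. disjnt (cball (a i) (r i)) (cball (a j) (r j))) D"
      "negligible (T - (\<Union>i\<in>D. cball (a i) (r i)))"
    proof (rule Vitali_covering_theorem_cballs[of K r T a])
      show "0 < r i" if "i \<in> K" for i using that unfolding K_def a_def r_def by auto
      fix z d :: real assume z: "z \<in> T" "0 < d"
      then obtain e where e: "e > 0" "ball z e \<subseteq> U" using U openE by blast
      obtain u v p q where uv: "u < z" "z < v" "v - u < min d e" "u \<le> p" "q \<le> v"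
          "\<kappa> * (v - u) \<le> q - p" "{p<..<q} \<inter> E = {}"
        using por[OF z(1), of "min d e"] z(2) e(1) unfolding hole_near_def by auto
      have "{u..v} \<subseteq> ball z e" using uv by (auto simp: dist_real_def)
      then have "(u, v) \<in> K" using uv e unfolding K_def by (auto intro: order_less_trans)
      moreover have "z \<in> cball (a (u, v)) (r (u, v))" unfolding cb using uv by simp
      moreover have "r (u, v) < d" using uv unfolding a_def r_def by simp
      ultimately show "\<exists>i. i \<in> K \<and> z \<in> cball (a i) (r i) \<and> r i < d" by blast
    qed
    define F where "F i = {fst i..snd i}" for i :: "real \<times> real"
    have disjF: "disjoint_family_on F D" "disjoint_family_on (\<lambda>i. F i \<inter> E) D"
      using D(3) unfolding disjoint_family_on_def F_def cb pairwise_def disjnt_def by blast+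
    have Esets: "E \<in> sets lebesgue" using E by (simp add: fmeasurable_def)
    have Fm: "F i \<in> sets lebesgue" "F i \<inter> E \<in> sets lebesgue" for i
      using Esets unfolding F_def by auto
    have Fle: "emeasure lebesgue (F i \<inter> E) \<le> ennreal (1 - \<kappa>) * emeasure lebesgue (F i)" if i: "i \<in> D" for i
    proof -
      obtain u v where uv: "i = (u, v)" by (cases i)
      then obtain p q where pq: "u < v" "u \<le> p" "q \<le> v" "\<kappa> * (v - u) \<le> q - p" "{p<..<q} \<inter> E = {}"
        using i D(2) unfolding K_def by auto
      have "0 < \<kappa> * (v - u)" using \<kappa> pq(1) by simp
      then have "p < q" using pq(4) by linarith
      have "emeasure lebesgue (F i \<inter> E) \<le> emeasure lebesgue ({u..p} \<union> {q..v})"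
      proof (rule emeasure_mono)
        show "F i \<inter> E \<subseteq> {u..p} \<union> {q..v}"
        proof
          fix z assume z: "z \<in> F i \<inter> E"
          then have "z \<notin> {p<..<q}" using pq(5) by blast
          then show "z \<in> {u..p} \<union> {q..v}" using z unfolding F_def uv by auto
        qed
      qed auto
      also have "\<dots> \<le> emeasure lebesgue {u..p} + emeasure lebesgue {q..v}"
        by (rule emeasure_subadditive) auto
      also have "\<dots> = ennreal ((p - u) + (v - q))" using pq by (simp add: ennreal_plus)
      also have "\<dots> \<le> ennreal ((1 - \<kappa>) * (v - u))" using pq(4) by (intro ennreal_leI) (simp add: algebra_simps)
      also have "\<dots> = ennreal (1 - \<kappa>) * emeasure lebesgue (F i)"
        using pq(1) k1 unfolding F_def uv by (simp add: ennreal_mult)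
      finally show ?thesis .
    qed
    define B where "B = (\<Union>i\<in>D. F i \<inter> E)"
    have FU: "(\<Union>i\<in>D. F i) \<subseteq> U" using D(2) unfolding K_def F_def by fastforce
    have Bs: "B \<in> sets lebesgue" unfolding B_def using Fm D(1) by (intro sets.countable_UN') auto
    have BU: "B \<subseteq> U" using FU unfolding B_def by blast
    have Blm: "B \<in> lmeasurable" using fmeasurableI2[OF U(3) BU Bs] .
    have "emeasure lebesgue B = (\<integral>\<^sup>+i. emeasure lebesgue (F i \<inter> E) \<partial>count_space D)"
      unfolding B_def using Fm D(1) disjF by (intro emeasure_UN_countable) auto
    also have "\<dots> \<le> (\<integral>\<^sup>+i. ennreal (1 - \<kappa>) * emeasure lebesgue (F i) \<partial>count_space D)"
      using Fle by (intro nn_integral_mono) auto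
    also have "\<dots> = ennreal (1 - \<kappa>) * (\<integral>\<^sup>+i. emeasure lebesgue (F i) \<partial>count_space D)"
      by (intro nn_integral_cmult) auto
    also have "(\<integral>\<^sup>+i. emeasure lebesgue (F i) \<partial>count_space D) = emeasure lebesgue (\<Union>i\<in>D. F i)"
      using Fm D(1) disjF by (intro emeasure_UN_countable[symmetric]) auto
    also have "ennreal (1 - \<kappa>) * \<dots> \<le> ennreal (1 - \<kappa>) * emeasure lebesgue U"
      using FU U(3) by (intro mult_left_mono emeasure_mono) (auto simp: fmeasurable_def)
    finally have "ennreal (\<mu> B) \<le> ennreal ((1 - \<kappa>) * \<mu> U)"
      using Blm U(3) k1 unfolding \<mu>_def by (simp add: emeasure_eq_measure2 ennreal_mult)
    then have mB: "\<mu> B \<le> (1 - \<kappa>) * \<mu> U" using k1 unfolding \<mu>_def by (subst (asm) ennreal_le_iff) auto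
    define R where "R = T - (\<Union>i\<in>D. F i)"
    have R: "negligible R" using D(4) unfolding R_def F_def cb .
    have "T \<subseteq> B \<union> R" using TE unfolding B_def R_def by blast
    moreover have "\<mu> (B \<union> R) \<le> \<mu> B + \<mu> R"
      unfolding \<mu>_def using Blm negligible_imp_measurable[OF R] by (intro measure_Un_le) auto
    moreover have "\<mu> R = 0" unfolding \<mu>_def using R negligible_imp_measure0 by blast
    moreover have "B \<union> R \<in> lmeasurable" using Blm negligible_imp_measurable[OF R] by auto
    ultimately show ?thesis using mB by (intro bexI[of _ "B \<union> R"]) auto
  qed
  show ?thesis
  proof (cases "\<kappa> \<le> 1")
    \<comment> \<open>A hole is never longer than the interval that contains it, so here
      \<open>T\<close> is empty.\<close>
    case False
    have "T = {}"
    proof (rule ccontr)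
      assume "T \<noteq> {}"
      then obtain z where "z \<in> T" by blast
      then obtain u v p q where *: "u < z" "z < v" "u \<le> p" "q \<le> v" "\<kappa> * (v - u) \<le> q - p"
        using por[of z 1] unfolding hole_near_def by auto
      have "1 * (v - u) < \<kappa> * (v - u)" using False * by (intro mult_strict_right_mono) auto
      also have "\<dots> \<le> q - p" by (rule *(5))
      also have "\<dots> \<le> v - u" using * by linarith
      finally show False by simp
    qed
    then show ?thesis by simp
  next
    case k1: True
    \<comment> \<open>\<open>T\<close> need not be measurable, so its outer measure \<open>m\<close>
      is taken over open supersets. \<open>step\<close> yields supersets of measure close to
      \<open>(1 - \<kappa>) * m\<close>, whence \<open>m = 0\<close>.\<close>
    define S where "S = {\<mu> U | U. open U \<and> T \<subseteq> U \<and> U \<in> lmeasurable}"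
    obtain U0 where "open U0" "E \<subseteq> U0" "U0 \<in> lmeasurable"
      using lmeasurable_outer_open[OF E, of 1] by auto
    then have ne: "S \<noteq> {}" unfolding S_def using TE by blast
    have bdd: "bdd_below S" unfolding S_def \<mu>_def by (intro bdd_belowI[of _ 0]) auto
    define m where "m = Inf S"
    have m0: "0 \<le> m" unfolding m_def S_def[symmetric] using ne unfolding S_def \<mu>_def by (intro cInf_greatest) auto
    have "\<kappa> * m \<le> e" if e: "e > 0" for e
    proof -
      have "\<exists>y\<in>S. y < m + e / 2" using cInf_lessD[OF ne, of "m + e / 2"] e unfolding m_def by auto
      then obtain U where U: "open U" "T \<subseteq> U" "U \<in> lmeasurable" "\<mu> U < m + e / 2"
        unfolding S_def by blast
      obtain B where B: "B \<in> lmeasurable" "T \<subseteq> B" "\<mu> B \<le> (1 - \<kappa>) * \<mu> U"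
        using step[OF U(1-3) k1] by blast
      obtain U' where U': "open U'" "B \<subseteq> U'" "U' \<in> lmeasurable" "\<mu> U' < \<mu> B + e / 2"
        using lmeasurable_outer_open[OF B(1), of "e / 2"] e unfolding \<mu>_def by auto
      have "\<mu> U' \<in> S" unfolding S_def using U' B(2) by blast
      then have "m \<le> \<mu> U'" unfolding m_def using bdd by (rule cInf_lower)
      also have "\<dots> \<le> (1 - \<kappa>) * (m + e / 2) + e / 2"
        using U'(4) B(3) U(4) k1 mult_left_mono[of "\<mu> U" "m + e / 2" "1 - \<kappa>"] by linarith
      finally have "\<kappa> * m \<le> e - \<kappa> * (e / 2)" by (simp add: field_simps)
      then show ?thesis using \<kappa> e by (smt (verit) mult_pos_pos half_gt_zero)
    qed
    then have "\<kappa> * m \<le> 0" using field_le_epsilon[of "\<kappa> * m" 0] by simp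
    then have mz: "m = 0" using \<kappa> m0 by (simp add: mult_le_0_iff)
    show ?thesis unfolding negligible_outer
    proof (intro allI impI)
      fix e :: real assume "e > 0"
      then obtain y where "y \<in> S" "y < e" using cInf_lessD[OF ne, of e] mz unfolding m_def by auto
      then show "\<exists>U. T \<subseteq> U \<and> U \<in> lmeasurable \<and> measure lebesgue U < e"
        unfolding S_def \<mu>_def by blast
    qed
  qed
qed

text \<open>The porosity constant varies with the point; countably many constants
  \<open>1 / (k + 1)\<close> suffice.\<close>

lemma negligible_porous:
  assumes "E \<in> lmeasurable" "T \<subseteq> E" "\<And>z. z \<in> T \<Longrightarrow> porous_at E z"
  shows "negligible T"
proof -
  define S where "S k = {z \<in> T. \<forall>\<delta>>0. hole_near E (inverse (real (Suc k))) \<delta> z}" for k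
  have "negligible (S k)" for k
    by (rule negligible_uniformly_porous[OF _ assms(1), of _ "inverse (real (Suc k))"])
      (use assms(2) in \<open>auto simp: S_def simp del: of_nat_Suc\<close>)
  then have "negligible (\<Union>k. S k)" by (intro negligible_countable_Union) auto
  moreover have "T \<subseteq> (\<Union>k. S k)"
  proof
    fix z assume z: "z \<in> T"
    then obtain \<kappa> where \<kappa>: "\<kappa> > 0" "\<And>\<delta>. \<delta> > 0 \<Longrightarrow> hole_near E \<kappa> \<delta> z"
      using assms(3) unfolding porous_at_def by blast
    obtain k where k: "inverse (real (Suc k)) < \<kappa>" using reals_Archimedean[OF \<kappa>(1)] by blast
    have "hole_near E (inverse (real (Suc k))) \<delta> z" if d: "\<delta> > 0" for \<delta>
    proof -
      obtain u v p q where *: "u < z" "z < v" "v - u < \<delta>" "u \<le> p" "q \<le> v" "\<kappa> * (v - u) \<le> q - p"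
        "{p<..<q} \<inter> E = {}" using \<kappa>(2)[OF d] unfolding hole_near_def by blast
      have "inverse (real (Suc k)) * (v - u) \<le> \<kappa> * (v - u)" using k * by (intro mult_right_mono) auto
      then have le: "inverse (real (Suc k)) * (v - u) \<le> q - p" using *(6) by (rule order_trans)
      show ?thesis unfolding hole_near_def
        by (intro exI[of _ u] exI[of _ v] exI[of _ p] exI[of _ q] conjI *(1) *(2) *(3) *(4) *(5) le *(7))
    qed
    then show "z \<in> (\<Union>k. S k)" using z unfolding S_def by blast
  qed
  ultimately show ?thesis using negligible_subset by blast
qed

section \<open>Generic points of a metric attractor\<close>

lemma has_real_derivative_split_at:
  fixes f :: "real \<Rightarrow> real"
  assumes "u < z" "z < v"
    and "(f has_real_derivative D) (at z within {u..z})" "(f has_real_derivative D) (at z within {z..v})"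
  shows "(f has_real_derivative D) (at z)"
  using assms(3,4) unfolding has_field_derivative_iff at_within_Icc_at_left[OF assms(1)]
    at_within_Icc_at_right[OF assms(2)]
  by (rule filterlim_split_at)

lemma has_real_derivative_cong_on:
  fixes f g :: "real \<Rightarrow> real"
  assumes "(f has_real_derivative D) (at z within S)" "z \<in> S" "\<And>w. w \<in> S \<Longrightarrow> f w = g w"
  shows "(g has_real_derivative D) (at z within S)"
  using has_field_derivative_transform_within[OF assms(1) zero_less_one assms(2)] assms(3) by simp

text \<open>Extending by affine functions keeps the derivative Lipschitz and removes the endpoints of the
  interval, where an inverse branch need not be defined on a full neighbourhood.\<close>

lemma C2_extension:
  assumes ab: "a < b" and C2: "C2_on {a..b} f"
  shows "\<exists>F F' K. (\<forall>z. (F has_real_derivative F' z) (at z)) \<and> (\<forall>z\<in>{a..b}. F z = f z) \<and>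
    (\<forall>z\<in>{a..b}. (f has_real_derivative F' z) (at z within {a..b})) \<and> 0 \<le> K \<and>
    (\<forall>y z. \<bar>F' y - F' z\<bar> \<le> K * \<bar>y - z\<bar>)"
proof -
  obtain f' f'' where f': "\<And>z. z \<in> {a..b} \<Longrightarrow> (f has_real_derivative f' z) (at z within {a..b})"
    and f'': "\<And>z. z \<in> {a..b} \<Longrightarrow> (f' has_real_derivative f'' z) (at z within {a..b})"
    and cont: "continuous_on {a..b} f''"
    using C2 unfolding C2_on_def by blast
  have "bounded (f'' ` {a..b})"
    using compact_continuous_image[OF cont] compact_imp_bounded by blast
  then obtain K where K: "\<And>z. z \<in> {a..b} \<Longrightarrow> norm (f'' z) \<le> K" unfolding bounded_iff by blast
  have K0: "0 \<le> K" using K[of a] ab by (auto intro: order_trans[OF abs_ge_zero])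
  define cl where "cl z = max a (min b z)" for z
  define F where "F z = f (cl z) + f' (cl z) * (z - cl z)" for z
  define F' where "F' z = f' (cl z)" for z
  have cl: "cl z \<in> {a..b}" for z using ab unfolding cl_def by auto
  have cl_id: "cl z = z" if "z \<in> {a..b}" for z using that unfolding cl_def by auto
  have F_low: "F z = f a + f' a * (z - a)" if "z \<le> a" for z
  proof -
    have "cl z = a" using that ab unfolding cl_def by auto
    then show ?thesis by (simp add: F_def)
  qed
  have F_high: "F z = f b + f' b * (z - b)" if "b \<le> z" for z
  proof -
    have "cl z = b" using that ab unfolding cl_def by auto
    then show ?thesis by (simp add: F_def)
  qed
  have F_mid: "F z = f z" if "z \<in> {a..b}" for z using cl_id[OF that] by (simp add: F_def)
  have lin: "((\<lambda>w. p + D * (w - q)) has_real_derivative D) (at z within S)" for p D q z :: real and S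
    by (auto intro!: derivative_eq_intros)
  have left: "\<exists>u<z. (F has_real_derivative F' z) (at z within {u..z})" for z
  proof -
    consider "z \<le> a" | "a < z" "z \<le> b" | "b < z" by linarith
    then show ?thesis
    proof cases
      case 1
      then have eq: "F' z = f' a" using ab unfolding F'_def cl_def by auto
      have d: "(F has_real_derivative f' a) (at z within {z - 1..z})"
        by (rule has_real_derivative_cong_on[OF lin[of "f a" "f' a" a]]) (use 1 F_low in auto)
      show ?thesis unfolding eq by (intro exI[of _ "z - 1"] conjI d) simp
    next
      case 2
      then have d: "(f has_real_derivative f' z) (at z within {a..z})"
        by (intro DERIV_subset[OF f'[of z]]) auto
      have "(F has_real_derivative f' z) (at z within {a..z})"
        by (rule has_real_derivative_cong_on[OF d]) (use 2 F_mid in auto)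
      then have "(F has_real_derivative F' z) (at z within {a..z})" using 2 cl_id[of z] by (simp add: F'_def)
      then show ?thesis using 2(1) by blast
    next
      case 3
      then have eq: "F' z = f' b" using ab unfolding F'_def cl_def by auto
      have d: "(F has_real_derivative f' b) (at z within {b..z})"
        by (rule has_real_derivative_cong_on[OF lin[of "f b" "f' b" b]]) (use 3 F_high in auto)
      show ?thesis unfolding eq by (intro exI[of _ b] conjI d 3)
    qed
  qed
  have right: "\<exists>v>z. (F has_real_derivative F' z) (at z within {z..v})" for z
  proof -
    consider "z < a" | "a \<le> z" "z < b" | "b \<le> z" by linarith
    then show ?thesis
    proof cases
      case 1
      then have eq: "F' z = f' a" using ab unfolding F'_def cl_def by auto
      have d: "(F has_real_derivative f' a) (at z within {z..a})"
        by (rule has_real_derivative_cong_on[OF lin[of "f a" "f' a" a]]) (use 1 F_low in auto)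
      show ?thesis unfolding eq by (intro exI[of _ a] conjI d 1)
    next
      case 2
      then have d: "(f has_real_derivative f' z) (at z within {z..b})"
        by (intro DERIV_subset[OF f'[of z]]) auto
      have "(F has_real_derivative f' z) (at z within {z..b})"
        by (rule has_real_derivative_cong_on[OF d]) (use 2 F_mid in auto)
      then have "(F has_real_derivative F' z) (at z within {z..b})" using 2 cl_id[of z] by (simp add: F'_def)
      then show ?thesis using 2(2) by blast
    next
      case 3
      then have eq: "F' z = f' b" using ab unfolding F'_def cl_def by auto
      have d: "(F has_real_derivative f' b) (at z within {z..z + 1})"
        by (rule has_real_derivative_cong_on[OF lin[of "f b" "f' b" b]]) (use 3 F_high in auto)
      show ?thesis unfolding eq by (intro exI[of _ "z + 1"] conjI d) simp
    qed
  qed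
  have dF: "(F has_real_derivative F' z) (at z)" for z
    using left[of z] right[of z] has_real_derivative_split_at by blast
  have lipF: "\<bar>F' y - F' z\<bar> \<le> K * \<bar>y - z\<bar>" for y z
  proof -
    have "norm (f' (cl y) - f' (cl z)) \<le> K * norm (cl y - cl z)"
      using f'' K cl by (intro field_differentiable_bound[of "{a..b}" f' f'']) auto
    also have "\<dots> \<le> K * \<bar>y - z\<bar>"
      using K0 unfolding cl_def by (intro mult_left_mono) (auto simp: max_def min_def)
    finally show ?thesis by (simp add: F'_def)
  qed
  have df: "(f has_real_derivative F' z) (at z within {a..b})" if "z \<in> {a..b}" for z
    using f'[OF that] cl_id[OF that] by (simp add: F'_def)
  have "\<forall>z\<in>{a..b}. F z = f z" "\<forall>z\<in>{a..b}. (f has_real_derivative F' z) (at z within {a..b})"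
    using F_mid df by blast+
  then show ?thesis using dF K0 lipF
    by - (rule exI[of _ F], rule exI[of _ F'], rule exI[of _ K], intro conjI allI; assumption)
qed

section \<open>Limit sets\<close>

lemma omega_limit_iff:
  fixes f :: "real \<Rightarrow> real"
  shows "y \<in> omega_limit f x \<longleftrightarrow> (\<forall>e>0. \<forall>N. \<exists>n\<ge>N. \<bar>(f ^^ n) x - y\<bar> < e)"
proof
  assume y: "y \<in> omega_limit f x"
  show "\<forall>e>0. \<forall>N. \<exists>n\<ge>N. \<bar>(f ^^ n) x - y\<bar> < e"
  proof (intro allI impI)
    fix e :: real and N assume "e > 0"
    then have "\<exists>n\<ge>N. (f ^^ n) x \<in> ball y e" by (intro omega_limit_recurrent[OF y]) auto
    then show "\<exists>n\<ge>N. \<bar>(f ^^ n) x - y\<bar> < e" by (auto simp: dist_real_def abs_minus_commute)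
  qed
next
  assume "\<forall>e>0. \<forall>N. \<exists>n\<ge>N. \<bar>(f ^^ n) x - y\<bar> < e"
  then have "\<exists>n\<ge>N. \<bar>(f ^^ n) x - y\<bar> < e" if "e > 0" for e N using that by simp
  then show "y \<in> omega_limit f x" by (rule omega_limitI)
qed

lemma omega_limit_shift:
  fixes f :: "real \<Rightarrow> real"
  shows "omega_limit f ((f ^^ m) x) = omega_limit f x"
proof (intro set_eqI iffI)
  fix y assume y: "y \<in> omega_limit f ((f ^^ m) x)"
  show "y \<in> omega_limit f x"
    unfolding omega_limit_iff
  proof (intro allI impI)
    fix e :: real and N assume "e > 0"
    then obtain n where "n \<ge> N" "\<bar>(f ^^ n) ((f ^^ m) x) - y\<bar> < e" using y unfolding omega_limit_iff by blast
    then show "\<exists>n\<ge>N. \<bar>(f ^^ n) x - y\<bar> < e"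
      by (intro exI[of _ "n + m"]) (auto simp: funpow_apply_add)
  qed
next
  fix y assume y: "y \<in> omega_limit f x"
  show "y \<in> omega_limit f ((f ^^ m) x)"
    unfolding omega_limit_iff
  proof (intro allI impI)
    fix e :: real and N assume "e > 0"
    then obtain n where n: "n \<ge> N + m" "\<bar>(f ^^ n) x - y\<bar> < e" using y unfolding omega_limit_iff by blast
    then have "(f ^^ (n - m)) ((f ^^ m) x) = (f ^^ n) x" using funpow_apply_add[of "n - m" m f x] by simp
    then show "\<exists>n\<ge>N. \<bar>(f ^^ n) ((f ^^ m) x) - y\<bar> < e" using n by (intro exI[of _ "n - m"]) auto
  qed
qed

lemma omega_limit_invariant:
  fixes f :: "real \<Rightarrow> real"
  assumes "\<And>z. isCont f z" "y \<in> omega_limit f x"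
  shows "f y \<in> omega_limit f x"
proof -
  obtain r where r: "strict_mono (r :: nat \<Rightarrow> nat)" "(\<lambda>n. (f ^^ r n) x) \<longlonglongrightarrow> y"
    using assms(2) unfolding omega_limit_def by blast
  have "(\<lambda>n. f ((f ^^ r n) x)) \<longlonglongrightarrow> f y" using isCont_tendsto_compose[OF assms(1) r(2)] .
  then have "(\<lambda>n. (f ^^ Suc (r n)) x) \<longlonglongrightarrow> f y" by simp
  moreover have "strict_mono (\<lambda>n. Suc (r n))" using r(1) by (simp add: strict_mono_def)
  ultimately show ?thesis unfolding omega_limit_def by blast
qed

section \<open>Almost every point of the basin\<close>

locale attractor =
  fixes a b K :: real and F F' :: "real \<Rightarrow> real" and A :: "real set"
  assumes ab: "a < b" and self_map: "F \<in> {a..b} \<rightarrow> {a..b}"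
    and deriv_F: "\<And>z. (F has_real_derivative F' z) (at z)"
    and K_nonneg: "0 \<le> K" and lip_F': "\<And>y z. \<bar>F' y - F' z\<bar> \<le> K * \<bar>y - z\<bar>"
    and nonsing: "nonsingular {a..b} F"
    and attr: "metric_attractor {a..b} F A"
    and noncritical: "\<And>z. z \<in> A \<Longrightarrow> F' z \<noteq> 0"
begin

abbreviation "I \<equiv> {a..b}"

lemma A_props: "A \<subseteq> I" "compact A" "F ` A \<subseteq> A"
  using attr unfolding metric_attractor_def forward_invariant_compact_def by auto

lemma isCont_F: "isCont F z"
  using deriv_F DERIV_isCont by blast

lemma isCont_F_iter: "isCont (F ^^ n) z"
proof (induction n)
  case (Suc n)
  then show ?case using isCont_o2[OF Suc isCont_F] by (simp add: o_def)
qed (simp add: id_def)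

lemma iter_I: "z \<in> I \<Longrightarrow> (F ^^ n) z \<in> I"
  by (induction n) (use self_map in auto)

lemma iter_A: "z \<in> A \<Longrightarrow> (F ^^ n) z \<in> A"
  by (induction n) (use A_props in auto)

lemma cont_F': "continuous_on UNIV F'"
proof -
  have "K-lipschitz_on UNIV F'"
    using lip_F' K_nonneg by (intro lipschitz_onI) (auto simp: dist_real_def)
  then show ?thesis by (rule lipschitz_on_continuous_on)
qed

definition W :: "real set" where "W = {x \<in> I. omega_limit F x = A}"

lemma negligible_preimage:
  assumes "negligible N"
  shows "negligible {z \<in> I. (F ^^ n) z \<in> N}"
proof -
  have one: "negligible {z \<in> I. F z \<in> N}" if N: "negligible N" for N
  proof -
    \<comment> \<open>\<open>nonsingular\<close> speaks of Borel sets inside the interval, so a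
      Lebesgue null set is first enclosed in a Borel one.\<close>
    obtain N' where N': "N' \<in> null_sets lborel" "N \<subseteq> N'"
      using N unfolding negligible_iff_null_sets null_sets_completion_iff2 by blast
    then have "I \<inter> N' \<in> null_sets lborel" by (intro null_set_Int1) auto
    then have "F -` (I \<inter> N') \<inter> I \<in> null_sets lebesgue"
      using nonsing unfolding nonsingular_def by blast
    then have "negligible (F -` (I \<inter> N') \<inter> I)" unfolding negligible_iff_null_sets .
    then show ?thesis
      by (rule negligible_subset) (use N'(2) self_map in auto)
  qed
  show ?thesis
  proof (induction n)
    case (Suc n)
    have "{z \<in> I. (F ^^ Suc n) z \<in> N} \<subseteq> {z \<in> I. F z \<in> {w \<in> I. (F ^^ n) w \<in> N}}"
      using self_map by (auto simp del: funpow.simps simp add: funpow_Suc_right)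
    then show ?case using one[OF Suc] negligible_subset by blast
  qed (use assms in \<open>auto intro: negligible_subset\<close>)
qed

text \<open>A point whose limit set misses a point of \<open>A\<close> lies in the basin of a smaller invariant set,
  and countably many such sets suffice.\<close>

lemma negligible_nongeneric: "negligible {x \<in> I. omega_limit F x \<subseteq> A \<and> omega_limit F x \<noteq> A}"
proof -
  \<comment> \<open>The points of \<open>A\<close> whose orbits never enter the interval
    \<open>w\<close>: a compact invariant set, proper as soon as \<open>w\<close> meets
    \<open>A\<close>. Rational endpoints make the family countable.\<close>
  define A' where "A' w = {z \<in> A. \<forall>n. (F ^^ n) z \<notin> {fst w<..<snd w}}" for w :: "real \<times> real"
  define P where "P = {w \<in> \<rat> \<times> \<rat>. A' w \<subset> A}"
  have fic: "forward_invariant_compact I F (A' w)" for w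
  proof -
    have "closed {z. (F ^^ n) z \<notin> {fst w<..<snd w}}" for n
    proof -
      have "closed ((F ^^ n) -` (- {fst w<..<snd w}))"
        using isCont_F_iter by (intro continuous_closed_vimage) auto
      then show ?thesis by (simp add: vimage_def)
    qed
    then have "closed (\<Inter>n. {z. (F ^^ n) z \<notin> {fst w<..<snd w}})" by (intro closed_INT) auto
    then have "compact (A \<inter> (\<Inter>n. {z. (F ^^ n) z \<notin> {fst w<..<snd w}}))"
      using A_props(2) compact_Int_closed by blast
    moreover have "A \<inter> (\<Inter>n. {z. (F ^^ n) z \<notin> {fst w<..<snd w}}) = A' w" unfolding A'_def by blast
    ultimately have "compact (A' w)" by simp
    moreover have "F z \<in> A' w" if z: "z \<in> A' w" for z
    proof -
      have "(F ^^ n) (F z) = (F ^^ Suc n) z" for n by (simp del: funpow.simps add: funpow_Suc_right)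
      moreover have "(F ^^ Suc n) z \<notin> {fst w<..<snd w}" for n using z unfolding A'_def by blast
      moreover have "F z \<in> A" using z A_props(3) unfolding A'_def by blast
      ultimately show ?thesis unfolding A'_def by simp
    qed
    ultimately show ?thesis
      unfolding forward_invariant_compact_def using A_props(1) unfolding A'_def by blast
  qed
  have "negligible (basin I F (A' w))" if "w \<in> P" for w
    using attr fic[of w] that unfolding metric_attractor_def negligible_iff_null_sets P_def by blast
  moreover have "countable P"
    by (rule countable_subset[of _ "\<rat> \<times> \<rat>"]) (auto simp: P_def countable_rat)
  ultimately have "negligible (\<Union>w\<in>P. basin I F (A' w))"
    by (intro negligible_countable_Union) auto
  moreover have "{x \<in> I. omega_limit F x \<subseteq> A \<and> omega_limit F x \<noteq> A} \<subseteq> (\<Union>w\<in>P. basin I F (A' w))"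
  proof
    fix x assume "x \<in> {x \<in> I. omega_limit F x \<subseteq> A \<and> omega_limit F x \<noteq> A}"
    then obtain y where x: "x \<in> I" "omega_limit F x \<subseteq> A" and y: "y \<in> A" "y \<notin> omega_limit F x" by blast
    then obtain e N where e: "e > 0" "\<And>n. n \<ge> N \<Longrightarrow> \<bar>(F ^^ n) x - y\<bar> \<ge> e"
      unfolding omega_limit_iff by (meson not_le)
    obtain s where s: "s \<in> \<rat>" "y - e < s" "s < y" using Rats_dense_in_real[of "y - e" y] e by auto
    obtain t where t: "t \<in> \<rat>" "y < t" "t < y + e" using Rats_dense_in_real[of y "y + e"] e by auto
    have out: "z \<notin> {s<..<t}" if z: "z \<in> omega_limit F x" for z
    proof
      assume "z \<in> {s<..<t}"
      then obtain n where "n \<ge> N" "(F ^^ n) x \<in> {s<..<t}"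
        using omega_limit_recurrent[OF z open_greaterThanLessThan] by blast
      then show False using e(2)[of n] s t by auto
    qed
    have "(F ^^ n) z \<in> omega_limit F x" if "z \<in> omega_limit F x" for n z
      by (induction n) (use that omega_limit_invariant isCont_F in auto)
    then have "omega_limit F x \<subseteq> A' (s, t)" unfolding A'_def using x(2) out by auto
    moreover have "y \<notin> A' (s, t)" unfolding A'_def using s t by (auto intro: exI[of _ 0])
    then have "(s, t) \<in> P" unfolding P_def using s t y(1) unfolding A'_def by blast
    ultimately show "x \<in> (\<Union>w\<in>P. basin I F (A' w))" using x(1) unfolding basin_def by blast
  qed
  ultimately show ?thesis using negligible_subset by blast
qed

lemma generic_point:
  assumes "negligible N" shows "\<exists>x\<in>W. x \<notin> N"
proof (rule ccontr)
  assume "\<not> ?thesis"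
  then have "basin I F A \<subseteq> N \<union> {x \<in> I. omega_limit F x \<subseteq> A \<and> omega_limit F x \<noteq> A}"
    unfolding basin_def W_def by blast
  then have "negligible (basin I F A)"
    using negligible_Un[OF assms negligible_nongeneric] negligible_subset by blast
  then have "emeasure lebesgue (basin I F A) = 0" unfolding negligible_iff_null_sets by (rule null_setsD1)
  then show False using attr unfolding metric_attractor_def by simp
qed

lemma limit_point_exists:
  assumes "x \<in> I" "strict_mono (r :: nat \<Rightarrow> nat)"
  shows "\<exists>y h. strict_mono (h :: nat \<Rightarrow> nat) \<and> (\<lambda>n. (F ^^ r (h n)) x) \<longlonglongrightarrow> y \<and> y \<in> omega_limit F x"
proof -
  have "\<forall>n. (F ^^ r n) x \<in> I" using iter_I[OF assms(1)] by blast
  then obtain y h where h: "strict_mono (h :: nat \<Rightarrow> nat)" "((\<lambda>n. (F ^^ r n) x) \<circ> h) \<longlonglongrightarrow> y"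
    using compact_Icc[of a b] unfolding compact_def by meson
  have "strict_mono (r \<circ> h)" using assms(2) h(1) by (rule strict_mono_o)
  then have "y \<in> omega_limit F x" using h(2) unfolding omega_limit_def by (auto simp: o_def)
  then show ?thesis using h by (auto simp: o_def)
qed

lemma eventually_near:
  assumes x: "x \<in> W" and \<rho>: "0 < \<rho>"
  shows "\<exists>N. \<forall>i\<ge>N. (F ^^ i) x \<in> nhd A \<rho>"
proof (rule ccontr)
  assume no: "\<not> ?thesis"
  define S where "S = {i. (F ^^ i) x \<notin> nhd A \<rho>}"
  have inf: "infinite S" unfolding S_def infinite_nat_iff_unbounded_le using no by auto
  have "x \<in> I" using x unfolding W_def by simp
  then obtain y h where h: "(\<lambda>n. (F ^^ enumerate S (h n)) x) \<longlonglongrightarrow> y" "y \<in> omega_limit F x"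
    using limit_point_exists[OF _ strict_mono_enumerate[OF inf]] by blast
  then have yA: "y \<in> A" using x unfolding W_def by simp
  have "eventually (\<lambda>n. dist ((F ^^ enumerate S (h n)) x) y < \<rho>) sequentially"
    using h(1) \<rho> tendstoD by blast
  then obtain n where "dist ((F ^^ enumerate S (h n)) x) y < \<rho>" by (auto simp: eventually_sequentially)
  then have "(F ^^ enumerate S (h n)) x \<in> nhd A \<rho>"
    using yA unfolding nhd_def by (auto simp: dist_real_def intro!: bexI[of _ y])
  then show False using enumerate_in_set[OF inf, of "h n"] unfolding S_def by blast
qed

lemma A_nonempty: "A \<noteq> {}"
proof -
  obtain x where x: "x \<in> W" using generic_point[of "{}"] by auto
  then have "x \<in> I" unfolding W_def by simp
  then obtain y where "y \<in> omega_limit F x" using limit_point_exists[of x id] by (auto simp: strict_mono_id)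
  then show ?thesis using x unfolding W_def by auto
qed

text \<open>\<open>c\<close> and \<open>C\<close> are fixed before \<open>\<rho>\<close>, so
  shrinking \<open>\<rho>\<close> later lowers the measure bound, and with it the distortion, at no
  cost.\<close>

lemma regular_neighbourhood:
  "\<exists>\<rho>0 c C. 0 < \<rho>0 \<and> 0 \<le> C \<and>
    (\<forall>\<rho>. 0 < \<rho> \<longrightarrow> \<rho> \<le> \<rho>0 \<longrightarrow> regular_map F F' A \<rho> c C (measure lebesgue (nhd A (2 * \<rho>))))"
proof -
  have "continuous_on A (\<lambda>z. \<bar>F' z\<bar>)"
    using cont_F' by (intro continuous_intros) (auto intro: continuous_on_subset)
  then obtain z0 where z0: "z0 \<in> A" "\<And>z. z \<in> A \<Longrightarrow> \<bar>F' z0\<bar> \<le> \<bar>F' z\<bar>"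
    using continuous_attains_inf[OF A_props(2) A_nonempty] by blast
  define s where "s = \<bar>F' z0\<bar>"
  have s: "0 < s" using noncritical[OF z0(1)] unfolding s_def by simp
  define c where "c = min 1 (s / 2)"
  define C where "C = K / c"
  \<comment> \<open>Within distance \<open>2 * \<rho>0\<close> of \<open>A\<close> the derivative
    changes by at most \<open>s / 2\<close>, so \<open>\<bar>F'\<bar>\<close> stays above
    \<open>c\<close>; there \<open>ln\<close> has slope at most \<open>1 / c\<close>, which gives
    \<open>C = K / c\<close>. The summand 1 covers \<open>K = 0\<close>.\<close>
  define \<rho>0 where "\<rho>0 = s / (4 * (K + 1))"
  have c: "0 < c" "c \<le> 1" "c \<le> s / 2" using s unfolding c_def by auto
  have "0 < \<rho>0" using s K_nonneg unfolding \<rho>0_def by simp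
  moreover have C0: "0 \<le> C" using K_nonneg c unfolding C_def by simp
  moreover have "regular_map F F' A \<rho> c C (measure lebesgue (nhd A (2 * \<rho>)))"
    if \<rho>: "0 < \<rho>" "\<rho> \<le> \<rho>0" for \<rho>
  proof
    have low: "c \<le> \<bar>F' z\<bar>" if z: "z \<in> nhd A (2 * \<rho>)" for z
    proof -
      obtain y where y: "y \<in> A" "\<bar>z - y\<bar> \<le> 2 * \<rho>" using z unfolding nhd_def by blast
      have "\<bar>F' z - F' y\<bar> \<le> K * \<bar>z - y\<bar>" by (rule lip_F')
      also have "\<dots> \<le> (K + 1) * (2 * \<rho>0)" using y(2) \<rho> K_nonneg by (intro mult_mono) auto
      also have "\<dots> = s / 2" using K_nonneg unfolding \<rho>0_def by (simp add: field_simps)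
      finally have "\<bar>F' z - F' y\<bar> \<le> s / 2" .
      moreover have "s \<le> \<bar>F' y\<bar>" using z0(2)[OF y(1)] unfolding s_def .
      ultimately show ?thesis using c(3) by linarith
    qed
    then show "\<And>z. z \<in> nhd A (2 * \<rho>) \<Longrightarrow> c \<le> \<bar>F' z\<bar>" .
    have ln_le: "ln p - ln q \<le> \<bar>p - q\<bar> / c" if "c \<le> p" "c \<le> q" for p q
    proof -
      have "ln p - ln q \<le> (p - q) / q" using that c by (intro ln_diff_le) auto
      also have "\<dots> \<le> \<bar>p - q\<bar> / c" using that c by (intro frac_le) auto
      finally show ?thesis .
    qed
    show "\<bar>ln \<bar>F' z\<bar> - ln \<bar>F' w\<bar>\<bar> \<le> C * \<bar>z - w\<bar>"
      if "z \<in> nhd A (2 * \<rho>)" "w \<in> nhd A (2 * \<rho>)" for z w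
    proof -
      have "\<bar>ln \<bar>F' z\<bar> - ln \<bar>F' w\<bar>\<bar> \<le> \<bar>\<bar>F' z\<bar> - \<bar>F' w\<bar>\<bar> / c"
        using ln_le[OF low[OF that(1)] low[OF that(2)]] ln_le[OF low[OF that(2)] low[OF that(1)]]
        unfolding abs_le_iff by (simp add: abs_minus_commute)
      also have "\<dots> \<le> K * \<bar>z - w\<bar> / c"
        using lip_F'[of z w] c by (intro divide_right_mono) auto
      finally show ?thesis by (simp add: C_def)
    qed
  qed (use deriv_F cont_F' A_props \<rho> c C0 in auto)
  ultimately show ?thesis by blast
qed

lemma regular_orbitI:
  assumes "regular_map F F' A \<rho> c C M" "omega_limit F x = A" "infinite A" "\<And>i. (F ^^ i) x \<in> nhd A \<rho>"
  shows "regular_orbit F F' A \<rho> c C M x"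
  using assms unfolding regular_orbit_def regular_orbit_axioms_def by blast

section \<open>Finiteness of the attractor\<close>

lemma finite_A: "finite A"
proof (rule ccontr)
  assume inf: "infinite A"
  obtain \<rho>0 c C where \<rho>0: "0 < \<rho>0" "0 \<le> C"
    "\<And>\<rho>. 0 < \<rho> \<Longrightarrow> \<rho> \<le> \<rho>0 \<Longrightarrow> regular_map F F' A \<rho> c C (measure lebesgue (nhd A (2 * \<rho>)))"
    using regular_neighbourhood by blast
  have Alm: "A \<in> lmeasurable" using A_props(2) by (rule lmeasurable_compact)
  \<comment> \<open>First half, for orbits inside \<open>A\<close>. Any distortion constant will do
    here, so the radius is \<open>\<rho>0\<close>; the points of \<open>A\<close> with a smaller
    limit set are covered by \<open>negligible_nongeneric\<close>.\<close>
  have n1: "negligible {x \<in> A. omega_limit F x = A}"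
  proof (rule negligible_porous[OF Alm])
    fix x assume x: "x \<in> {x \<in> A. omega_limit F x = A}"
    have "(F ^^ i) x \<in> nhd A \<rho>0" for i
      using x iter_A[of x i] \<rho>0(1) unfolding nhd_def by (auto intro!: bexI[of _ "(F ^^ i) x"])
    then interpret regular_orbit F F' A \<rho>0 c C "measure lebesgue (nhd A (2 * \<rho>0))" x
      using x inf \<rho>0 by (intro regular_orbitI) auto
    show "porous_at A x" using x by (intro porous_at_A) auto
  qed auto
  have "omega_limit F x \<subseteq> A" if "x \<in> A" for x
  proof
    fix y assume "y \<in> omega_limit F x"
    then obtain r where "(\<lambda>n. (F ^^ r n) x) \<longlonglongrightarrow> y" unfolding omega_limit_def by blast
    then show "y \<in> A"
      using closed_sequentially[OF compact_imp_closed[OF A_props(2)], of "\<lambda>n. (F ^^ r n) x" y]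
        iter_A[OF that] by blast
  qed
  then have sub: "A \<subseteq> {x \<in> A. omega_limit F x = A} \<union> {x \<in> I. omega_limit F x \<subseteq> A \<and> omega_limit F x \<noteq> A}"
    using A_props(1) by blast
  have "negligible A"
    by (rule negligible_subset[OF negligible_Un[OF n1 negligible_nongeneric] sub])
  then have A0: "measure lebesgue A = 0" by (rule negligible_imp_measure0)
  \<comment> \<open>Measure at most \<open>s\<close> gives \<open>C * M \<le> ln (6 / 5)\<close>;
    \<open>C + 1\<close> keeps the denominator positive.\<close>
  define s where "s = ln (6 / 5) / (C + 1)"
  have s: "0 < s" using \<rho>0(2) unfolding s_def by (intro divide_pos_pos) auto
  obtain U where U: "open U" "A \<subseteq> U" "U \<in> lmeasurable" "measure lebesgue U < s"
    using lmeasurable_outer_open[OF Alm s] A0 by auto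
  obtain d where d: "d > 0" "(\<Union>z\<in>A. cball z d) \<subseteq> U"
    using compact_subset_open_imp_cball_epsilon_subset[OF A_props(2) U(1,2)] by blast
  define \<rho> where "\<rho> = min \<rho>0 (d / 2)"
  have \<rho>: "0 < \<rho>" "\<rho> \<le> \<rho>0" "2 * \<rho> \<le> d" using d(1) \<rho>0(1) unfolding \<rho>_def by auto
  define M where "M = measure lebesgue (nhd A (2 * \<rho>))"
  have "nhd A (2 * \<rho>) \<subseteq> U"
  proof
    fix z assume "z \<in> nhd A (2 * \<rho>)"
    then obtain y where "y \<in> A" "\<bar>z - y\<bar> \<le> 2 * \<rho>" unfolding nhd_def by blast
    then have "z \<in> cball y d" using \<rho>(3) by (simp add: dist_real_def abs_minus_commute)
    then show "z \<in> U" using d(2) \<open>y \<in> A\<close> by blast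
  qed
  then have "M \<le> measure lebesgue U"
    unfolding M_def using U(3) lmeasurable_compact[OF compact_nhd[OF A_props(2)]]
    by (intro measure_mono_fmeasurable) auto
  then have "M \<le> s" using U(4) by simp
  then have "C * M \<le> C * s" using \<rho>0(2) by (intro mult_left_mono) auto
  also have "\<dots> \<le> ln (6 / 5)"
    using \<rho>0(2) unfolding s_def by (simp add: field_simps)
  finally have "exp (C * M) \<le> exp (ln (6 / 5))" by (simp only: exp_le_cancel_iff)
  also have "exp (ln (6 / 5)) = (6 / 5 :: real)" by simp
  finally have D: "exp (C * M) \<le> 6 / 5" .
  have reg: "regular_map F F' A \<rho> c C M" unfolding M_def using \<rho>0(3) \<rho> by blast
  \<comment> \<open>Closed and forward invariant, and every orbit from \<open>W\<close> enters it by
    \<open>eventually_near\<close>.\<close>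
  define E where "E = {z. \<forall>i. (F ^^ i) z \<in> nhd A \<rho>}"
  have clE: "closed E"
  proof -
    have "closed ((F ^^ i) -` nhd A \<rho>)" for i
      using isCont_F_iter compact_imp_closed[OF compact_nhd[OF A_props(2)]]
      by (intro continuous_closed_vimage) auto
    then have "closed (\<Inter>i. (F ^^ i) -` nhd A \<rho>)" by (intro closed_INT) auto
    moreover have "(\<Inter>i. (F ^^ i) -` nhd A \<rho>) = E" unfolding E_def by auto
    ultimately show ?thesis by simp
  qed
  have Enear: "E \<subseteq> nhd A \<rho>" unfolding E_def by (auto dest: spec[of _ 0])
  have Einv: "F ` E \<subseteq> E"
  proof
    fix w assume "w \<in> F ` E"
    then obtain z where z: "z \<in> E" "w = F z" by blast
    have "(F ^^ i) w = (F ^^ Suc i) z" for i unfolding z(2) by (simp del: funpow.simps add: funpow_Suc_right)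
    moreover have "(F ^^ Suc i) z \<in> nhd A \<rho>" for i using z(1) unfolding E_def by blast
    ultimately show "w \<in> E" unfolding E_def by simp
  qed
  have "compact E"
  proof -
    have "E = nhd A \<rho> \<inter> E" using Enear by blast
    then show ?thesis using compact_Int_closed[OF compact_nhd[OF A_props(2)] clE] by metis
  qed
  then have "negligible {z \<in> E. porous_at E z}"
    by (intro negligible_porous[of E] lmeasurable_compact) auto
  then have "negligible {z \<in> I. (F ^^ n) z \<in> {z \<in> E. porous_at E z}}" for n
    by (rule negligible_preimage)
  then have "negligible (\<Union>n. {z \<in> I. (F ^^ n) z \<in> {z \<in> E. porous_at E z}})"
    by (intro negligible_countable_Union) auto
  \<comment> \<open>A generic point whose orbit never hits a porous point of \<open>E\<close>:
    nonsingularity makes the preimages of the null set of such points null.\<close>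
  then obtain x where x: "x \<in> W" "x \<notin> (\<Union>n. {z \<in> I. (F ^^ n) z \<in> {z \<in> E. porous_at E z}})"
    using generic_point by blast
  obtain N where N: "\<And>i. i \<ge> N \<Longrightarrow> (F ^^ i) x \<in> nhd A \<rho>" using eventually_near[OF x(1) \<rho>(1)] by blast
  have xN: "(F ^^ i) ((F ^^ N) x) \<in> nhd A \<rho>" for i
    using N[of "i + N"] by (simp add: funpow_apply_add)
  have "omega_limit F ((F ^^ N) x) = A" using x(1) unfolding omega_limit_shift W_def by simp
  then interpret regular_orbit F F' A \<rho> c C M "(F ^^ N) x"
    using reg inf xN by (intro regular_orbitI)
  obtain N' where N': "porous_at E ((F ^^ N') ((F ^^ N) x))"
    using orbit_porous[OF D clE Einv Enear] by blast
  have "(F ^^ N) x \<in> E" unfolding E_def using xN by blast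
  then have "(F ^^ N') ((F ^^ N) x) \<in> E" by (induction N') (use Einv in auto)
  then have "(F ^^ (N' + N)) x \<in> {z \<in> E. porous_at E z}" using N' by (simp add: funpow_apply_add)
  moreover have "x \<in> I" using x(1) unfolding W_def by simp
  ultimately show False using x(2) by blast
qed

text \<open>A finite attractor is a single cycle because nearby orbits follow it. A generic point converges
  to it without landing on it, hence from one side, and drags along all points in between.\<close>

lemma attracting_orbit: "\<exists>p x. topologically_attracting I F p x \<and> A = periodic_orbit F p x"
proof -
  have "negligible {z \<in> I. (F ^^ n) z \<in> A}" for n
    by (intro negligible_preimage negligible_finite finite_A)
  then have "negligible (\<Union>n. {z \<in> I. (F ^^ n) z \<in> A})"
    by (intro negligible_countable_Union) auto
  then obtain x where x: "x \<in> W" "x \<notin> (\<Union>n. {z \<in> I. (F ^^ n) z \<in> A})" using generic_point by blast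
  have xI: "x \<in> I" and om: "omega_limit F x = A" using x(1) unfolding W_def by auto
  define X where "X i = (F ^^ i) x" for i
  have XA: "X i \<notin> A" for i using x(2) xI unfolding X_def by blast
  have XI: "X i \<in> I" for i unfolding X_def using iter_I[OF xI] .
  define Dist where "Dist = (\<lambda>(u, v). \<bar>u - v\<bar>) ` {(u, v) \<in> A \<times> A. u \<noteq> v}"
  have "finite {(u, v) \<in> A \<times> A. u \<noteq> v}"
    by (rule finite_subset[of _ "A \<times> A"]) (use finite_A in auto)
  then have finD: "finite (insert 1 Dist)" unfolding Dist_def by simp
  \<comment> \<open>Half the least distance in \<open>A\<close>; inserting 1 provides a minimum when
    \<open>A\<close> is a single point.\<close>
  define e where "e = Min (insert 1 Dist) / 2"
  have e: "0 < e" using finD unfolding e_def Dist_def by auto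
  have sep: "u = v" if "u \<in> A" "v \<in> A" "\<bar>u - v\<bar> < 2 * e" for u v
  proof (rule ccontr)
    assume "u \<noteq> v"
    then have "\<bar>u - v\<bar> \<in> insert 1 Dist" unfolding Dist_def using that by auto
    then have "Min (insert 1 Dist) \<le> \<bar>u - v\<bar>" using finD by (rule Min_le[rotated])
    then show False using that(3) unfolding e_def by simp
  qed
  have "uniformly_continuous_on (nhd A 1) F"
    using compact_nhd[OF A_props(2)] isCont_F
    by (intro compact_uniformly_continuous continuous_at_imp_continuous_on) auto
  then obtain d0 where d0: "d0 > 0"
    "\<And>z w. z \<in> nhd A 1 \<Longrightarrow> w \<in> nhd A 1 \<Longrightarrow> \<bar>w - z\<bar> < d0 \<Longrightarrow> \<bar>F w - F z\<bar> < e"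
    unfolding uniformly_continuous_on_def dist_real_def using e by metis
  define d where "d = min (min d0 e) 1"
  have d: "0 < d" "d \<le> d0" "d \<le> e" "d \<le> 1" using d0(1) e unfolding d_def by auto
  obtain N where N: "\<And>i. i \<ge> N \<Longrightarrow> X i \<in> nhd A (d / 2)"
    using eventually_near[OF x(1), of "d / 2"] d(1) unfolding X_def by auto
  define \<pi> where "\<pi> i = (SOME u. u \<in> A \<and> \<bar>X i - u\<bar> < d)" for i
  have pi: "\<pi> i \<in> A \<and> \<bar>X i - \<pi> i\<bar> < d" if "i \<ge> N" for i
  proof -
    have "\<exists>u. u \<in> A \<and> \<bar>X i - u\<bar> < d" using N[OF that] d(1) unfolding nhd_def by force
    then show ?thesis unfolding \<pi>_def by (rule someI_ex)
  qed
  have pi_eq: "\<pi> i = u" if "i \<ge> N" "u \<in> A" "\<bar>X i - u\<bar> < e" for i u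
    using pi[OF that(1)] that d(3) by (intro sep) auto
  have pi_Suc: "\<pi> (Suc i) = F (\<pi> i)" if i: "i \<ge> N" for i
  proof (rule pi_eq)
    note p = pi[OF i]
    have "X i \<in> nhd A 1" "\<pi> i \<in> nhd A 1" using p d(4) unfolding nhd_def by force+
    then have "\<bar>F (X i) - F (\<pi> i)\<bar> < e" using p d(2) by (intro d0(2)) auto
    then show "\<bar>X (Suc i) - F (\<pi> i)\<bar> < e" unfolding X_def by simp
    show "F (\<pi> i) \<in> A" using p A_props(3) by blast
  qed (use i in simp)
  define y where "y = \<pi> N"
  have yA: "y \<in> A" using pi unfolding y_def by blast
  have pi_iter: "\<pi> (N + k) = (F ^^ k) y" for k
    by (induction k) (use pi_Suc in \<open>auto simp: y_def\<close>)
  have visit: "\<exists>n\<ge>m. n \<ge> N \<and> \<pi> n = u" if u: "u \<in> A" for u m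
  proof -
    have "u \<in> omega_limit F x" using u om by simp
    then obtain n where "n \<ge> max m N" "\<bar>X n - u\<bar> < e"
      using e unfolding omega_limit_iff X_def by meson
    then show ?thesis using pi_eq[of n u] u by (intro exI[of _ n]) auto
  qed
  \<comment> \<open>\<open>Suc N\<close> makes the period \<open>n - N\<close> positive.\<close>
  obtain n where n: "n \<ge> Suc N" "\<pi> n = y" using visit[OF yA] by blast
  define p where "p = n - N"
  have p: "0 < p" "(F ^^ p) y = y" using n pi_iter[of p] unfolding p_def by auto
  have period: "(F ^^ (k * p)) y = y" for k
    using funpow_mod_eq[OF p(2), of "k * p"] by simp
  have orbit: "A = periodic_orbit F p y"
  proof
    show "A \<subseteq> periodic_orbit F p y"
    proof
      fix u assume "u \<in> A"
      then obtain m where m: "m \<ge> N" "\<pi> m = u" using visit by blast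
      then have "u = (F ^^ (m - N)) y" using pi_iter[of "m - N"] by simp
      also have "\<dots> = (F ^^ ((m - N) mod p)) y" using funpow_mod_eq[OF p(2)] by simp
      finally show "u \<in> periodic_orbit F p y" unfolding periodic_orbit_def using p(1) by simp
    qed
    show "periodic_orbit F p y \<subseteq> A" unfolding periodic_orbit_def using iter_A[OF yA] by blast
  qed
  \<comment> \<open>The period is doubled so that the derivative of \<open>F ^^ (2 * p)\<close> at
    \<open>y\<close> is a square, which makes this iterate increasing near \<open>y\<close>.\<close>
  define z where "z k = X (N + k * (2 * p))" for k
  have z_lim: "z \<longlonglongrightarrow> y"
  proof (rule LIMSEQ_I)
    fix \<epsilon> :: real assume eps: "\<epsilon> > 0"
    obtain N' where N': "\<And>i. i \<ge> N' \<Longrightarrow> X i \<in> nhd A (min (\<epsilon> / 2) (e / 2))"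
      using eventually_near[OF x(1), of "min (\<epsilon> / 2) (e / 2)"] eps e unfolding X_def by auto
    have "norm (z k - y) < \<epsilon>" if k: "k \<ge> N'" for k
    proof -
      define i where "i = N + k * (2 * p)"
      have "k * 1 \<le> k * (2 * p)" using p(1) by (intro mult_le_mono2) simp
      then have "N' \<le> k * (2 * p)" using k by (metis mult_1_right order_trans)
      then have i: "i \<ge> N'" "i \<ge> N" unfolding i_def by linarith+
      obtain u where u: "u \<in> A" "\<bar>X i - u\<bar> \<le> min (\<epsilon> / 2) (e / 2)" using N'[OF i(1)] unfolding nhd_def by blast
      then have "\<bar>X i - u\<bar> < e" "\<bar>X i - u\<bar> < \<epsilon>" using e eps by auto
      moreover have "\<pi> i = y" unfolding i_def pi_iter using period[of "k * 2"] by (simp add: mult.assoc)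
      ultimately show ?thesis using pi_eq[OF i(2) u(1)] unfolding z_def i_def by simp
    qed
    then show "\<exists>no. \<forall>k\<ge>no. norm (z k - y) < \<epsilon>" by blast
  qed
  obtain \<rho> c C where \<rho>: "0 < \<rho>" "regular_map F F' A \<rho> c C (measure lebesgue (nhd A (2 * \<rho>)))"
    using regular_neighbourhood by blast
  interpret regular_map F F' A \<rho> c C "measure lebesgue (nhd A (2 * \<rho>))" by (rule \<rho>(2))
  have "eventually (\<lambda>w. (F ^^ j) w \<in> nhd A (2 * \<rho>)) (nhds y)" for j
  proof -
    have "eventually (\<lambda>w. (F ^^ j) w \<in> ball ((F ^^ j) y) \<rho>) (nhds y)"
      using isCont_F_iter[of y j] \<rho>(1) unfolding isCont_def tendsto_at_iff_tendsto_nhds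
      by (intro topological_tendstoD) auto
    then show ?thesis
    proof eventually_elim
      case (elim w)
      then show ?case using iter_A[OF yA, of j] \<rho>(1) unfolding nhd_def
        by (intro CollectI bexI[of _ "(F ^^ j) y"]) (auto simp: dist_real_def abs_minus_commute)
    qed
  qed
  then have "eventually (\<lambda>w. \<forall>j\<in>{..<2 * p}. (F ^^ j) w \<in> nhd A (2 * \<rho>)) (nhds y)"
    by (intro eventually_ball_finite) auto
  then obtain \<eta> where \<eta>: "0 < \<eta>" "\<And>w j. \<bar>w - y\<bar> < \<eta> \<Longrightarrow> j < 2 * p \<Longrightarrow> (F ^^ j) w \<in> nhd A (2 * \<rho>)"
    unfolding eventually_nhds_metric dist_real_def by blast
  define J where "J = {y - \<eta> / 2..y + \<eta> / 2}"
  have yJ: "y \<in> J" using \<eta>(1) unfolding J_def by simp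
  have intJ: "is_interval J" unfolding J_def by (rule is_interval_cc)
  have regJ: "in_reg (2 * p) J"
    unfolding in_reg_def
  proof (intro allI impI image_subsetI)
    fix j w assume "j < 2 * p" "w \<in> J"
    then show "(F ^^ j) w \<in> nhd A (2 * \<rho>)" using \<eta>(1) unfolding J_def by (intro \<eta>(2)) auto
  qed
  have "Df (2 * p) y = Df p y * Df p y" using Df_add[of p p y] p(2) by (simp add: mult_2)
  then have "Df (2 * p) y \<ge> 0" by simp
  then have pos: "\<forall>w\<in>J. Df (2 * p) w > 0" using Df_sign[OF intJ regJ] yJ by force
  have mono: "(F ^^ (2 * p)) u \<le> (F ^^ (2 * p)) v" if "u \<in> J" "v \<in> J" "u \<le> v" for u v
    using iter_increasing[OF intJ pos that(1,2)] that(3) by (cases "u = v") auto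
  have Gy: "(F ^^ (2 * p)) y = y" using period[of 2] .
  have Gz: "z (Suc k) = (F ^^ (2 * p)) (z k)" for k
    unfolding z_def X_def using funpow_apply_add[of "2 * p" "N + k * (2 * p)" F x] by (simp add: algebra_simps)
  have "eventually (\<lambda>k. z k \<in> ball y (\<eta> / 2)) sequentially"
    using z_lim \<eta>(1) by (intro topological_tendstoD) auto
  then obtain K where K: "\<And>k. k \<ge> K \<Longrightarrow> z k \<in> ball y (\<eta> / 2)" by (auto simp: eventually_sequentially)
  have zJ: "z (K + k) \<in> J" for k
  proof -
    have "\<bar>y - z (K + k)\<bar> < \<eta> / 2" using K[of "K + k"] by (simp add: dist_real_def)
    then show ?thesis unfolding J_def atLeastAtMost_iff by linarith
  qed
  have zy: "z K \<noteq> y" using XA yA unfolding z_def by metis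
  define S where "S = {min y (z K)<..<max y (z K)}"
  have S_basin: "w \<in> basin I F (periodic_orbit F p y)" if w: "w \<in> S" for w
  proof -
    define h where "h k = (F ^^ (k * (2 * p))) w" for k
    have h_Suc: "h (Suc k) = (F ^^ (2 * p)) (h k)" for k
      unfolding h_def using funpow_apply_add[of "2 * p" "k * (2 * p)" F w] by simp
    \<comment> \<open>By monotonicity the segment between \<open>y\<close> and
      \<open>z (K + k)\<close> is carried into the next one, and these segments shrink to
      \<open>y\<close>.\<close>
    have h_seg: "min y (z (K + k)) \<le> h k \<and> h k \<le> max y (z (K + k))" for k
    proof (induction k)
      case 0
      then show ?case using w unfolding S_def h_def by simp
    next
      case (Suc k)
      have "h k \<in> J" using Suc zJ[of k] yJ unfolding J_def by (auto simp: min_def max_def split: if_splits)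
      then show ?case
        using Suc mono[of y "h k"] mono[of "h k" y] mono[of "h k" "z (K + k)"] mono[of "z (K + k)" "h k"]
          yJ zJ[of k] Gy Gz[of "K + k"] unfolding h_Suc by (auto simp: min_def max_def split: if_splits)
    qed
    have "h \<longlonglongrightarrow> y"
    proof (rule tendsto_sandwich)
      have zK: "(\<lambda>k. z (K + k)) \<longlonglongrightarrow> y"
        using LIMSEQ_ignore_initial_segment[OF z_lim, of K] by (simp add: add.commute)
      show "(\<lambda>k. min y (z (K + k))) \<longlonglongrightarrow> y" "(\<lambda>k. max y (z (K + k))) \<longlonglongrightarrow> y"
        using tendsto_min[OF tendsto_const zK, of y] tendsto_max[OF tendsto_const zK, of y] by simp_all
    qed (use h_seg in auto)
    then have "(\<lambda>k. (F ^^ r) (h k)) \<longlonglongrightarrow> (F ^^ r) y" for r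
      using isCont_tendsto_compose[OF isCont_F_iter] by blast
    then have "(\<lambda>k. (F ^^ (0 + r + k * (2 * p))) w) \<longlonglongrightarrow> (F ^^ r) y" for r
      unfolding h_def by (simp add: funpow_apply_add)
    then have "omega_limit F w \<subseteq> (\<lambda>r. (F ^^ r) y) ` {..<2 * p}"
      using p(1) by (intro omega_limit_residues[where t = 0]) auto
    then have "omega_limit F w \<subseteq> A" using iter_A[OF yA] by blast
    moreover have "w \<in> I"
      using w XI[of "N + K * (2 * p)"] A_props(1) yA unfolding S_def z_def
      by (auto simp: min_def max_def split: if_splits)
    ultimately show ?thesis unfolding basin_def orbit[symmetric] by blast
  qed
  have "S \<subseteq> I" using S_basin unfolding basin_def by blast
  then have "openin (top_of_set I) S"
    unfolding openin_open S_def by (intro exI[of _ "{min y (z K)<..<max y (z K)}"]) auto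
  then have "S \<subseteq> (top_of_set I) interior_of (basin I F (periodic_orbit F p y))"
    using S_basin by (intro interior_of_maximal) auto
  moreover have "S \<noteq> {}" unfolding S_def using zy by (auto simp: min_def max_def)
  ultimately have "topologically_attracting I F p y"
    unfolding topologically_attracting_def periodic_point_def using p A_props(1) yA by blast
  then show ?thesis using orbit by blast
qed

end

theorem corollary5:
  fixes a b :: real and f :: "real \<Rightarrow> real" and A :: "real set"
  assumes "a < b"
    and "f \<in> {a..b} \<rightarrow> {a..b}"
    and "C2_on {a..b} f"
    and "nonsingular {a..b} f"
    and "metric_attractor {a..b} f A"
    and "\<And>c. c \<in> A \<Longrightarrow> \<not> critical_point {a..b} f c"
  shows "\<exists>p x. topologically_attracting {a..b} f p x \<and> A = periodic_orbit f p x"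
proof -
  let ?I = "{a..b}"
  obtain F F' K where F: "\<And>z. (F has_real_derivative F' z) (at z)" "\<And>z. z \<in> ?I \<Longrightarrow> F z = f z"
    "\<And>z. z \<in> ?I \<Longrightarrow> (f has_real_derivative F' z) (at z within ?I)" "0 \<le> K"
    "\<And>y z. \<bar>F' y - F' z\<bar> \<le> K * \<bar>y - z\<bar>"
    using C2_extension[OF assms(1,3)] by metis
  \<comment> \<open>On the invariant interval the extension has the same orbits as \<open>f\<close>,
    so attractors, basins and periodic orbits agree.\<close>
  have iter: "(F ^^ n) z = (f ^^ n) z \<and> (f ^^ n) z \<in> ?I" if "z \<in> ?I" for n z
    by (induction n) (use that F(2) assms(2) in auto)
  have om: "omega_limit F z = omega_limit f z" if "z \<in> ?I" for z
    using iter[OF that] unfolding omega_limit_def by simp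
  have basin_eq: "basin ?I F B = basin ?I f B" for B
    using om unfolding basin_def by auto
  have fic_eq: "forward_invariant_compact ?I F B = forward_invariant_compact ?I f B" for B
  proof -
    have "F ` B = f ` B" if "B \<subseteq> ?I" using that F(2) by (intro image_cong) auto
    then show ?thesis unfolding forward_invariant_compact_def by metis
  qed
  have attr: "metric_attractor ?I F A"
    using assms(5) unfolding metric_attractor_def fic_eq basin_eq .
  then have AI: "A \<subseteq> ?I" unfolding metric_attractor_def forward_invariant_compact_def by blast
  interpret attractor a b K F F' A
  proof
    show "F \<in> ?I \<rightarrow> ?I" using assms(2) F(2) by auto
    have "F -` B \<inter> ?I = f -` B \<inter> ?I" for B using F(2) by auto
    then show "nonsingular ?I F" using assms(4) unfolding nonsingular_def by simp
    show "F' z \<noteq> 0" if "z \<in> A" for z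
      using assms(6)[OF that] F(3)[of z] AI that unfolding critical_point_def by auto
  qed (use assms(1) F attr in auto)
  obtain p x where px: "topologically_attracting ?I F p x" "A = periodic_orbit F p x"
    using attracting_orbit by blast
  then have xI: "x \<in> ?I" unfolding topologically_attracting_def periodic_point_def by blast
  have orbit_eq: "periodic_orbit F p x = periodic_orbit f p x"
    using iter[OF xI] unfolding periodic_orbit_def by simp
  have "topologically_attracting ?I f p x"
    using px(1) iter[OF xI, of p]
    unfolding topologically_attracting_def periodic_point_def orbit_eq basin_eq by simp
  then show ?thesis using px(2) orbit_eq by blast
qed

end
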